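(* Let $W:\mathbb{R}^2\to[0,\infty)$ be locally Hölder continuous and suppose that there are constants $c_1,c_2>0$ and $\bar p>0$ such that $c_1|y|^{2\bar p}-1\le W(y)\le c_2(|y|^{2\bar p}+1)$ for all $y\in\mathbb{R}^2$. Let $a^-,a^+\in\mathbb{R}^2$ with $a_1^-=a_1^+$ and $a_2^-<a_2^+$. Suppose that $W=w^2$ for a function $w:\mathbb{R}^2\to\mathbb{R}$, and suppose that there exist Borel functions $\iota,\kappa,\lambda:\mathbb{R}^2\to[-1,1]$ with $$\iota^2\le\min\{1-\lambda^2,\,(1+\kappa)(1-\lambda),\,(1-\kappa)(1+\lambda)\},$$ such that $\iota w,\kappa w,\lambda w\in C^2(\mathbb{R}^2)\cap C^1_{\bar p}(\mathbb{R}^2)$ and $$\frac{\partial^2}{\partial y_1^2}(\kappa w)=\frac{\partial^2}{\partial y_2^2}(\lambda w)+2\frac{\partial^2}{\partial y_1\partial y_2}(\iota w).$$ Then $$\mathcal{E}(a^-,a^+)\ge\int_{a_2^-}^{a_2^+}(\kappa w)(a_1^-,t)\,dt .$$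
   Context: For $j\in\{0,1,2,\dots\}$ and a real exponent $q>0$, $C^j_q(\mathbb{R}^2)$ is the space of all $\phi\in C^j(\mathbb{R}^2)$ for which there is $C\ge0$ with $|D^k\phi(y)|\le C(|y|^{q-k}+1)$ for all $y\in\mathbb{R}^2$ and $k=0,\dots,j$. $B_1(0)$ is the open unit disc in $\mathbb{R}^2$. For $\epsilon>0$ and $u\in W^{1,2}(B_1(0);\mathbb{R}^2)$ let $E_\epsilon(u;B_1(0))=\frac12\int_{B_1(0)}\left(\epsilon|Du|^2+\frac1\epsilon W(u)\right)dx$. Let $u_0(x)=a^+$ if $x_1>0$ and $u_0(x)=a^-$ if $x_1<0$. Let $\mathcal{U}(a^-,a^+)$ be the set of all families $(u_\epsilon)_{\epsilon>0}$ in $W^{1,2}(B_1(0);\mathbb{R}^2)$ such that $u_\epsilon\to u_0$ in $L^1(B_1(0);\mathbb{R}^2)$ as $\epsilon\searrow0$ and such that there exist $\tau>0$ and $s>2$ with $\lim_{\epsilon\searrow0}\epsilon^{-\tau}\|\operatorname{div}u_\epsilon\|_{L^s(B_1(0))}=0$. Define $$\mathcal{E}(a^-,a^+)=\tfrac12\inf\Bigl\{\liminf_{\epsilon\searrow0}E_\epsilon(u_\epsilon;B_1(0)) : (u_\epsilon)_{\epsilon>0}\in\mathcal{U}(a^-,a^+)\Bigr\}.$$ *)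

theory Defs
  imports "HOL-Analysis.Analysis"
begin

definition pderiv_at :: "2 \<Rightarrow> (real^2 \<Rightarrow> real) \<Rightarrow> real^2 \<Rightarrow> real" where
  "pderiv_at i f x = frechet_derivative f (at x) (axis i 1)"

primrec C_space :: "nat \<Rightarrow> (real^2 \<Rightarrow> real) set" where
  "C_space 0 = {f. continuous_on UNIV f}"
| "C_space (Suc j) = {f. (\<forall>x. f differentiable (at x)) \<and> (\<forall>i. pderiv_at i f \<in> C_space j)}"

text \<open>\<open>D_norm k f x\<close> is the Euclidean norm of the tensor of all \<open>k\<close>-th order partial derivatives,
  indexed by lists of \<open>k\<close> coordinate directions.\<close>

definition D_norm :: "nat \<Rightarrow> (real^2 \<Rightarrow> real) \<Rightarrow> real^2 \<Rightarrow> real" where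
  "D_norm k f x = L2_set (\<lambda>is. foldr pderiv_at is f x) {is. length is = k}"

text \<open>At \<open>y = 0\<close> the library has \<open>0 powr a = 0\<close> for every \<open>a\<close>. This is harmless for \<open>q \<le> k\<close>: the
  condition at the single point \<open>0\<close> can always be met by enlarging the constant.\<close>

definition C_growth :: "nat \<Rightarrow> real \<Rightarrow> (real^2 \<Rightarrow> real) set" where
  "C_growth j q = {f \<in> C_space j.
     \<exists>C\<ge>0. \<forall>y. \<forall>k\<le>j. D_norm k f y \<le> C * (norm y powr (q - real k) + 1)}"

definition locally_hoelder :: "(real^2 \<Rightarrow> real) \<Rightarrow> bool" where
  "locally_hoelder f \<longleftrightarrow>
     (\<forall>x. \<exists>r>0. \<exists>\<alpha>. \<exists>C. 0 < \<alpha> \<and> \<alpha> \<le> 1 \<and>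
        (\<forall>y\<in>ball x r. \<forall>z\<in>ball x r. \<bar>f y - f z\<bar> \<le> C * dist y z powr \<alpha>))"

text \<open>Test functions are extended by zero to the whole plane.\<close>

definition test_functions :: "(real^2) set \<Rightarrow> (real^2 \<Rightarrow> real) set" where
  "test_functions S = {\<phi>. (\<forall>j. \<phi> \<in> C_space j) \<and>
     compact (closure {x. \<phi> x \<noteq> 0}) \<and> closure {x. \<phi> x \<noteq> 0} \<subseteq> S}"

definition locally_integrable :: "(real^2) set \<Rightarrow> (real^2 \<Rightarrow> 'b::{banach, second_countable_topology}) \<Rightarrow> bool" where
  "locally_integrable S f \<longleftrightarrow> (\<forall>K. compact K \<and> K \<subseteq> S \<longrightarrow> integrable (lebesgue_on K) f)"

text \<open>Row \<open>i\<close>, column \<open>j\<close> of the matrix is the weak derivative of the component \<open>u\<^sub>i\<close> in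
  direction \<open>j\<close>; the set \<open>S\<close> is meant to be open.\<close>

definition has_weak_jacobian :: "(real^2) set \<Rightarrow> (real^2 \<Rightarrow> real^2) \<Rightarrow> (real^2 \<Rightarrow> real^2^2) \<Rightarrow> bool" where
  "has_weak_jacobian S u G \<longleftrightarrow> locally_integrable S u \<and> locally_integrable S G \<and>
     (\<forall>\<phi>\<in>test_functions S. \<forall>i j.
        (LINT x|lebesgue_on S. u x $ i * pderiv_at j \<phi> x) = - (LINT x|lebesgue_on S. G x $ i $ j * \<phi> x))"

definition square_integrable :: "(real^2) set \<Rightarrow> (real^2 \<Rightarrow> 'b::{banach, second_countable_topology}) \<Rightarrow> bool" where
  "square_integrable S f \<longleftrightarrow> f \<in> borel_measurable (lebesgue_on S) \<and>
     integrable (lebesgue_on S) (\<lambda>x. (norm (f x))\<^sup>2)"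

definition W12 :: "(real^2) set \<Rightarrow> (real^2 \<Rightarrow> real^2) set" where
  "W12 S = {u. square_integrable S u \<and> (\<exists>G. has_weak_jacobian S u G \<and> square_integrable S G)}"

text \<open>The weak Jacobian is unique only up to null sets; it is used below only under integrals.\<close>

definition weak_jacobian :: "(real^2) set \<Rightarrow> (real^2 \<Rightarrow> real^2) \<Rightarrow> real^2 \<Rightarrow> real^2^2" where
  "weak_jacobian S u = (SOME G. has_weak_jacobian S u G)"

definition weak_div :: "(real^2) set \<Rightarrow> (real^2 \<Rightarrow> real^2) \<Rightarrow> real^2 \<Rightarrow> real" where
  "weak_div S u x = trace (weak_jacobian S u x)"

text \<open>The \<open>L\<^sup>s\<close> norm takes the value \<open>\<infinity>\<close> on functions that are not in \<open>L\<^sup>s\<close>.\<close>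

definition Ls_norm :: "real \<Rightarrow> (real^2) set \<Rightarrow> (real^2 \<Rightarrow> real) \<Rightarrow> ennreal" where
  "Ls_norm s S f =
     (let I = \<integral>\<^sup>+ x. ennreal (\<bar>f x\<bar> powr s) \<partial>lebesgue_on S
      in if I = \<infinity> then \<infinity> else ennreal (enn2real I powr (1 / s)))"

abbreviation unit_disc :: "(real^2) set" where
  "unit_disc \<equiv> ball 0 1"

text \<open>The library's norm on \<open>real^2^2\<close> is the Frobenius norm. The value \<open>\<infinity>\<close> is
  allowed.\<close>

definition energy :: "(real^2 \<Rightarrow> real) \<Rightarrow> real \<Rightarrow> (real^2 \<Rightarrow> real^2) \<Rightarrow> (real^2) set \<Rightarrow> ennreal" where
  "energy W \<epsilon> u S =
     (\<integral>\<^sup>+ x. ennreal (\<epsilon> * (norm (weak_jacobian S u x))\<^sup>2 + 1 / \<epsilon> * W (u x)) \<partial>lebesgue_on S) / 2"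

definition jump_map :: "real^2 \<Rightarrow> real^2 \<Rightarrow> real^2 \<Rightarrow> real^2" where
  "jump_map am ap x = (if x $ 1 > 0 then ap else am)"

text \<open>Families indexed by \<open>\<epsilon> > 0\<close> are total functions of \<open>\<epsilon>\<close>, whose values at \<open>\<epsilon> \<le> 0\<close> are
  irrelevant.\<close>

definition admissible :: "real^2 \<Rightarrow> real^2 \<Rightarrow> (real \<Rightarrow> real^2 \<Rightarrow> real^2) set" where
  "admissible am ap = {u. (\<forall>\<epsilon>>0. u \<epsilon> \<in> W12 unit_disc) \<and>
     ((\<lambda>\<epsilon>. LINT x|lebesgue_on unit_disc. norm (u \<epsilon> x - jump_map am ap x)) \<longlongrightarrow> 0) (at_right 0) \<and>
     (\<exists>\<tau>>0. \<exists>s>2. ((\<lambda>\<epsilon>. ennreal (\<epsilon> powr (- \<tau>)) * Ls_norm s unit_disc (weak_div unit_disc (u \<epsilon>)))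
        \<longlongrightarrow> 0) (at_right 0))}"

definition transition_energy :: "(real^2 \<Rightarrow> real) \<Rightarrow> real^2 \<Rightarrow> real^2 \<Rightarrow> ennreal" where
  "transition_energy W am ap =
     (INF u\<in>admissible am ap. Liminf (at_right 0) (\<lambda>\<epsilon>. energy W \<epsilon> (u \<epsilon>) unit_disc)) / 2"

end

theory Submission
  imports Defs
begin

text \<open>
  The proof is by calibration. Write \<open>k = \<kappa> w\<close>, \<open>l = \<lambda> w\<close>, \<open>m = \<iota> w\<close>. The differential equation for
  \<open>k\<close>, \<open>l\<close>, \<open>m\<close> is the integrability condition for a map \<open>\<Phi> = (f, g)\<close> whose derivative has the
  trace-free part \<open>((m, k), (l, -m))\<close>; hence \<open>div \<Phi>(u)\<close> equals the product of that matrix with \<open>Du\<close> up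
  to a multiple of \<open>div u\<close>, and \<open>f(a\<^sup>+) - f(a\<^sup>-)\<close> is the integral of \<open>k\<close>. The bounds on
  \<open>\<iota>\<close>, \<open>\<kappa>\<close>, \<open>\<lambda>\<close> say that the operator norm of the matrix is at most \<open>|w|\<close>. This gives
  \<open>2 (matrix, Du) \<le> W / \<epsilon> + \<epsilon> (|Du|\<^sup>2 + 2 c det Du)\<close> with a suitable function \<open>c = c(u)\<close>,
  \<open>|c| \<le> 1\<close>. As \<open>c(u) det Du\<close> is a null Lagrangian, its integral against a cutoff is of lower
  order, and \<open>\<epsilon>\<close> times it vanishes in the limit.

  The map \<open>\<Phi>\<close> grows at most like \<open>|y|\<close> to the power \<open>p + 1\<close>, so a cutoff at large \<open>|y|\<close> with logarithmically
  small slope changes the matrix only by a small multiple of the square root of \<open>W\<close>. After this, everything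
  is bounded, which removes all questions of integrability at large values of \<open>u\<close>. Weakly
  differentiable maps are handled by mollification: only the convergence of the maps in \<open>L\<^sup>1\<close> and the
  contraction of the norms of the Jacobians are needed.
\<close>

section \<open>Gradients in the plane\<close>

text \<open>Let \<open>M\<close> be the trace-free matrix and \<open>J\<close> the quarter turn.
  Then \<open>M J\<close> is symmetric and \<open>k a^2 - 2 m a b - l b^2\<close> is its quadratic
  form, so a bound for this form on the unit circle is a bound for the operator norm of
  \<open>M\<close>. On a full derivative the form reads \<open>(a, b) . D\<Phi> (-b, a)\<close>;
  multiples of the identity drop out, which is why the later hypotheses on \<open>f'\<close> and
  \<open>g'\<close> can be stated through it.

  Up to a regularisation \<open>c\<close> is \<open>det M / W\<close>. When \<open>W\<close> and
  \<open>\<epsilon>\<close> are scaled to \<open>1\<close>, the minimum over \<open>Du\<close> of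
  the gap in the pointwise inequality is then \<open>det (1 - (M J)^2) / (1 - c^2)\<close>. This
  \<open>c\<close> is merely continuous, so the null Lagrangian has to be estimated through the size
  of \<open>c\<close> alone.

  The trace of \<open>D\<Phi>\<close> enters only multiplied by \<open>div u\<close>. As
  \<open>div u\<close> tends to zero in \<open>L^1\<close>, it suffices that the trace is bounded,
  and the cutoff ensures this.

  The jump of \<open>f\<close> is weighted with the length \<open>2\<close> of the diameter on
  \<open>x $ 1 = 0\<close>; the factor \<open>1/2\<close> in the transition energy cancels
  it.\<close>

definition C1_grad :: "(real^2 \<Rightarrow> real) \<Rightarrow> (real^2 \<Rightarrow> real^2) \<Rightarrow> bool" where
  "C1_grad f g \<longleftrightarrow> (\<forall>x. (f has_derivative (\<lambda>h. g x \<bullet> h)) (at x)) \<and> continuous_on UNIV g"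

lemma C1_gradI:
  "(\<And>x. (f has_derivative (\<lambda>h. g x \<bullet> h)) (at x)) \<Longrightarrow> continuous_on UNIV g \<Longrightarrow> C1_grad f g"
  by (simp add: C1_grad_def)

lemma C1_grad_derivative: "C1_grad f g \<Longrightarrow> (f has_derivative (\<lambda>h. g x \<bullet> h)) (at x within S)"
  by (auto simp: C1_grad_def intro: has_derivative_at_withinI)

lemma C1_grad_continuous_grad: "C1_grad f g \<Longrightarrow> continuous_on S g"
  by (auto simp: C1_grad_def intro: continuous_on_subset)

lemma C1_grad_continuous: "C1_grad f g \<Longrightarrow> continuous_on S f"
  by (metis C1_grad_derivative continuous_on_eq_continuous_within has_derivative_continuous)

lemma C1_grad_const: "C1_grad (\<lambda>x. c) (\<lambda>x. 0)"
  by (rule C1_gradI) auto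

lemma C1_grad_add:
  assumes "C1_grad f f'" "C1_grad g g'"
  shows "C1_grad (\<lambda>x. f x + g x) (\<lambda>x. f' x + g' x)"
  using assms unfolding C1_grad_def
  by (auto intro!: continuous_intros derivative_eq_intros simp: inner_add_left)

lemma C1_grad_mult:
  assumes "C1_grad f f'" "C1_grad g g'"
  shows "C1_grad (\<lambda>x. f x * g x) (\<lambda>x. f x *\<^sub>R g' x + g x *\<^sub>R f' x)"
proof (rule C1_gradI)
  fix x show "((\<lambda>x. f x * g x) has_derivative (\<lambda>h. (f x *\<^sub>R g' x + g x *\<^sub>R f' x) \<bullet> h)) (at x)"
    by (rule derivative_eq_intros C1_grad_derivative[OF assms(1)] C1_grad_derivative[OF assms(2)] refl ext)+
      (simp add: inner_add_left algebra_simps)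
next
  show "continuous_on UNIV (\<lambda>x. f x *\<^sub>R g' x + g x *\<^sub>R f' x)"
    using assms[THEN C1_grad_continuous] assms[THEN C1_grad_continuous_grad]
    by (intro continuous_intros) auto
qed

lemma C1_grad_cmult:
  assumes "C1_grad f f'" shows "C1_grad (\<lambda>x. c * f x) (\<lambda>x. c *\<^sub>R f' x)"
  using C1_grad_mult[OF C1_grad_const assms, of c] by simp

lemma C1_grad_minus:
  assumes "C1_grad f f'" shows "C1_grad (\<lambda>x. - f x) (\<lambda>x. - f' x)"
  using C1_grad_cmult[OF assms, of "-1"] by simp

lemma C1_grad_diff:
  assumes "C1_grad f f'" "C1_grad g g'"
  shows "C1_grad (\<lambda>x. f x - g x) (\<lambda>x. f' x - g' x)"
  using C1_grad_add[OF assms(1) C1_grad_minus[OF assms(2)]] by simp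

lemma C1_grad_component: "C1_grad (\<lambda>x. x $ i) (\<lambda>x. axis i 1)"
  by (rule C1_gradI) (auto simp: inner_axis inner_commute intro: bounded_linear_imp_has_derivative bounded_linear_vec_nth)

lemma C1_grad_norm_sq: "C1_grad (\<lambda>x. (norm x)\<^sup>2) (\<lambda>x. 2 *\<^sub>R x)"
proof (rule C1_gradI)
  fix x :: "real^2"
  show "((\<lambda>x. (norm x)\<^sup>2) has_derivative (\<lambda>h. (2 *\<^sub>R x) \<bullet> h)) (at x)"
    unfolding power2_norm_eq_inner
    by (rule derivative_eq_intros refl ext)+ (simp add: inner_commute)
qed (intro continuous_intros)

lemma C1_grad_real_compose:
  assumes f: "C1_grad f f'" and h: "\<And>t. (h has_real_derivative h' t) (at t)" "continuous_on UNIV h'"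
  shows "C1_grad (\<lambda>x. h (f x)) (\<lambda>x. h' (f x) *\<^sub>R f' x)"
proof (rule C1_gradI)
  fix x
  show "((\<lambda>x. h (f x)) has_derivative (\<lambda>v. (h' (f x) *\<^sub>R f' x) \<bullet> v)) (at x)"
    using has_derivative_compose[OF C1_grad_derivative[OF f] h(1)[of "f x", unfolded has_field_derivative_def]]
    by (simp add: mult_ac)
next
  have "continuous_on UNIV (\<lambda>x. h' (f x))"
    by (rule continuous_on_compose2[OF h(2) C1_grad_continuous[OF f]]) auto
  then show "continuous_on UNIV (\<lambda>x. h' (f x) *\<^sub>R f' x)"
    using C1_grad_continuous_grad[OF f] by (intro continuous_intros)
qed

abbreviation pair2 :: "real \<Rightarrow> real \<Rightarrow> real^2" where
  "pair2 a b \<equiv> vector [a, b]"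

lemma pair2_eq: "pair2 a b = a *\<^sub>R axis 1 1 + b *\<^sub>R axis 2 1"
  by (simp add: vec_eq_iff forall_2 axis_def)

lemma inner_2: "(x::real^2) \<bullet> y = x $ 1 * y $ 1 + x $ 2 * y $ 2"
  by (simp add: inner_vec_def sum_2)

lemma norm_sq_2: "(norm (x::real^2))\<^sup>2 = (x $ 1)\<^sup>2 + (x $ 2)\<^sup>2"
  unfolding power2_norm_eq_inner by (simp add: inner_2 power2_eq_square)

lemma norm_le_components_2: "norm (x::real^2) \<le> \<bar>x $ 1\<bar> + \<bar>x $ 2\<bar>"
  using norm_le_l1_cart[of x] by (simp add: sum_2)

lemma continuous_on_pair2 [continuous_intros]:
  "continuous_on S f \<Longrightarrow> continuous_on S g \<Longrightarrow> continuous_on S (\<lambda>x. pair2 (f x) (g x))"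
  unfolding pair2_eq by (intro continuous_intros)

lemma has_derivative_pair2:
  assumes "(f has_derivative f') (at x within S)" "(g has_derivative g') (at x within S)"
  shows "((\<lambda>x. pair2 (f x) (g x)) has_derivative (\<lambda>h. pair2 (f' h) (g' h))) (at x within S)"
  unfolding pair2_eq using assms by (intro derivative_intros)

lemma C1_grad_compose_vec:
  assumes F: "C1_grad F F'" and a: "C1_grad a a'" and b: "C1_grad b b'"
  shows "C1_grad (\<lambda>x. F (pair2 (a x) (b x)))
    (\<lambda>x. F' (pair2 (a x) (b x)) $ 1 *\<^sub>R a' x + F' (pair2 (a x) (b x)) $ 2 *\<^sub>R b' x)"
proof (rule C1_gradI)
  fix x
  show "((\<lambda>x. F (pair2 (a x) (b x))) has_derivative
     (\<lambda>h. (F' (pair2 (a x) (b x)) $ 1 *\<^sub>R a' x + F' (pair2 (a x) (b x)) $ 2 *\<^sub>R b' x) \<bullet> h)) (at x)"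
    using has_derivative_compose[OF has_derivative_pair2[OF C1_grad_derivative[OF a] C1_grad_derivative[OF b]]
       C1_grad_derivative[OF F]]
    by (simp add: inner_2 inner_add_left algebra_simps)
next
  have "continuous_on UNIV (\<lambda>x. F' (pair2 (a x) (b x)))"
    by (rule continuous_on_compose2[OF C1_grad_continuous_grad[OF F, of UNIV]])
      (auto intro!: continuous_intros C1_grad_continuous[OF a] C1_grad_continuous[OF b])
  then show "continuous_on UNIV
     (\<lambda>x. F' (pair2 (a x) (b x)) $ 1 *\<^sub>R a' x + F' (pair2 (a x) (b x)) $ 2 *\<^sub>R b' x)"
    using C1_grad_continuous_grad[OF a] C1_grad_continuous_grad[OF b]
    by (intro continuous_intros) auto
qed

lemma C1_grad_outside_support:
  assumes f: "C1_grad f f'" and "\<And>x. x \<notin> K \<Longrightarrow> f x = 0" "closed K" "x \<notin> K"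
  shows "f' x = 0"
proof -
  have "((\<lambda>x. 0) has_derivative (\<lambda>h. f' x \<bullet> h)) (at x)"
    using C1_grad_derivative[OF f, of x UNIV]
    by (rule has_derivative_transform_within_open[where s="-K"]) (use assms in auto)
  then have "(\<lambda>h. f' x \<bullet> h) = (\<lambda>h. 0)"
    by (rule has_derivative_unique) auto
  then have "f' x \<bullet> f' x = 0" by (rule fun_cong)
  then show ?thesis by simp
qed

lemma continuous_compact_support_bounded:
  fixes f :: "real^2 \<Rightarrow> 'a::real_normed_vector"
  assumes "continuous_on UNIV f" "compact K" "\<And>x. x \<notin> K \<Longrightarrow> f x = 0"
  obtains B where "B > 0" "\<And>x. norm (f x) \<le> B"
proof -
  have "compact (f ` K)"
    by (rule compact_continuous_image) (use assms in \<open>auto intro: continuous_on_subset\<close>)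
  then obtain B where B: "\<And>x. x \<in> K \<Longrightarrow> norm (f x) \<le> B"
    using compact_imp_bounded by (force simp: bounded_iff)
  have "norm (f x) \<le> max 1 B" for x
    using B[of x] assms(3)[of x] by (cases "x \<in> K") auto
  then show ?thesis by (intro that[of "max 1 B"]) auto
qed

lemma C1_grad_mvt:
  assumes f: "C1_grad f f'" and B: "\<And>z. z \<in> closed_segment x y \<Longrightarrow> norm (f' z) \<le> B"
  shows "\<bar>f y - f x\<bar> \<le> B * norm (y - x)"
proof -
  have "norm (f y - f x) \<le> B * norm (y - x)"
  proof (rule differentiable_bound[where S="closed_segment x y" and f'="\<lambda>x h. f' x \<bullet> h"])
    show "onorm (\<lambda>h. f' z \<bullet> h) \<le> B" if "z \<in> closed_segment x y" for z
    proof (rule onorm_le)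
      fix h show "norm (f' z \<bullet> h) \<le> B * norm h"
        using Cauchy_Schwarz_ineq2[of "f' z" h] B[OF that]
        by (metis mult_right_mono norm_ge_zero order_trans real_norm_def)
    qed
  qed (use f in \<open>auto intro: C1_grad_derivative\<close>)
  then show ?thesis by simp
qed

section \<open>Translation invariance and integration by parts\<close>

lemma lborel_integrable_translate:
  fixes f :: "real^2 \<Rightarrow> 'b::{banach, second_countable_topology}"
  assumes "integrable lborel f" shows "integrable lborel (\<lambda>x. f (c + x))"
proof -
  have "integrable (distr lborel borel ((+) c)) f" using assms by (simp add: lborel_distr_plus)
  then show ?thesis by (subst (asm) integrable_distr_eq) (use assms in auto)
qed

lemma lborel_integral_translate:
  fixes f :: "real^2 \<Rightarrow> 'b::{banach, second_countable_topology}"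
  assumes "f \<in> borel_measurable borel"
  shows "(\<integral>x. f (c + x) \<partial>lborel) = (\<integral>x. f x \<partial>lborel)"
proof -
  have "(\<integral>x. f x \<partial>lborel) = (\<integral>x. f x \<partial>distr lborel borel ((+) c))" by (simp add: lborel_distr_plus)
  also have "\<dots> = (\<integral>x. f (c + x) \<partial>lborel)" by (rule integral_distr) (use assms in auto)
  finally show ?thesis by simp
qed

lemma integrable_continuous_compact_support:
  fixes f :: "real^2 \<Rightarrow> 'a::euclidean_space"
  assumes "continuous_on UNIV f" "compact K" "\<And>x. x \<notin> K \<Longrightarrow> f x = 0"
  shows "integrable lborel f"
proof -
  have "integrable lborel (\<lambda>x. indicator K x *\<^sub>R f x)"
    by (rule borel_integrable_compact) (use assms in \<open>auto intro: continuous_on_subset\<close>)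
  also have "(\<lambda>x. indicator K x *\<^sub>R f x) = f"
    using assms(3) by (auto simp: fun_eq_iff indicator_def)
  finally show ?thesis .
qed

text \<open>Translation invariance replaces the usual appeal to Fubini's theorem.\<close>

lemma difference_quotient_integral:
  assumes f: "C1_grad f f'" and K: "compact K" "\<And>x. x \<notin> K \<Longrightarrow> f x = 0"
    and A: "A \<in> sets borel"
  shows "(\<lambda>n. \<integral>x. indicator A x * (f (x + (1 / real (Suc n)) *\<^sub>R axis i 1) - f x) * real (Suc n) \<partial>lborel)
     \<longlonglongrightarrow> (\<integral>x. indicator A x * f' x $ i \<partial>lborel)"
proof -
  have f'0: "f' x = 0" if "x \<notin> K" for x
    using C1_grad_outside_support[OF f K(2) compact_imp_closed[OF K(1)] that] .
  obtain B where B: "B > 0" "\<And>x. norm (f' x) \<le> B"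
    using continuous_compact_support_bounded[OF C1_grad_continuous_grad[OF f] K(1) f'0] by blast
  obtain R where R: "\<And>x. x \<in> K \<Longrightarrow> norm x \<le> R"
    using compact_imp_bounded[OF K(1)] by (auto simp: bounded_iff)
  \<comment> \<open>The shifts have length at most \<open>1\<close>, so this ball contains every
    point where a difference quotient is non-zero; on it the mean value theorem bounds all of them
    by \<open>B\<close>.\<close>
  define K' :: "(real^2) set" where "K' = cball 0 (R + 1)"
  have [measurable]: "(\<lambda>x. f (x + c)) \<in> borel_measurable borel" for c
    by (intro borel_measurable_continuous_onI continuous_on_compose2[OF C1_grad_continuous[OF f, of UNIV]])
      (auto intro!: continuous_intros)
  have [measurable]: "f \<in> borel_measurable borel" "(\<lambda>x. f' x $ i) \<in> borel_measurable borel"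
    using C1_grad_continuous[OF f] C1_grad_continuous_grad[OF f]
    by (auto intro!: borel_measurable_continuous_onI continuous_intros)
  note A[measurable]
  show ?thesis
  proof (rule integral_dominated_convergence[where w="\<lambda>x. indicator K' x * B"])
    show "integrable lborel (\<lambda>x. indicator K' x * B)"
      using borel_integrable_compact[of K' "\<lambda>_. B"] by (auto simp: K'_def)
    show "AE x in lborel. (\<lambda>n. indicator A x * (f (x + (1 / real (Suc n)) *\<^sub>R axis i 1) - f x) * real (Suc n))
       \<longlonglongrightarrow> indicator A x * f' x $ i"
    proof (rule AE_I2)
      fix x :: "real^2"
      have "((\<lambda>t::real. x + t *\<^sub>R axis i 1) has_derivative (\<lambda>t. t *\<^sub>R axis i 1)) (at (0::real))"
        by (rule derivative_eq_intros refl)+ simp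
      from has_derivative_compose[OF this, of f "\<lambda>h. f' x \<bullet> h"]
      have "((\<lambda>t. f (x + t *\<^sub>R axis i 1)) has_derivative (\<lambda>t. f' x \<bullet> (t *\<^sub>R axis i 1))) (at 0)"
        using C1_grad_derivative[OF f, of x UNIV] by simp
      then have "((\<lambda>t. f (x + t *\<^sub>R axis i 1)) has_real_derivative f' x $ i) (at 0)"
        unfolding has_field_derivative_def by (simp add: inner_axis mult_commute_abs)
      then have "((\<lambda>h. (f (x + h *\<^sub>R axis i 1) - f x) / h) \<longlongrightarrow> f' x $ i) (at 0)"
        by (simp add: has_field_derivative_iff)
      moreover have "filterlim (\<lambda>n. 1 / real (Suc n)) (at 0) sequentially"
        using LIMSEQ_Suc[OF lim_1_over_n[where ?'a=real]] by (auto simp: filterlim_at)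
      ultimately have "(\<lambda>n. (f (x + (1 / real (Suc n)) *\<^sub>R axis i 1) - f x) / (1 / real (Suc n))) \<longlonglongrightarrow> f' x $ i"
        by (rule filterlim_compose)
      then have "(\<lambda>n. indicator A x * ((f (x + (1 / real (Suc n)) *\<^sub>R axis i 1) - f x) / (1 / real (Suc n)))) \<longlonglongrightarrow> indicator A x * f' x $ i"
        by (intro tendsto_intros)
      then show "(\<lambda>n. indicator A x * (f (x + (1 / real (Suc n)) *\<^sub>R axis i 1) - f x) * real (Suc n))
       \<longlonglongrightarrow> indicator A x * f' x $ i"
        by (simp add: mult.assoc)
    qed
    fix n
    show "AE x in lborel. norm (indicator A x * (f (x + (1 / real (Suc n)) *\<^sub>R axis i 1) - f x) * real (Suc n)) \<le> indicator K' x * B"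
    proof (rule AE_I2)
      fix x :: "real^2"
      let ?h = "(1 / real (Suc n)) *\<^sub>R axis i (1::real) :: real^2"
      have nh: "norm ?h = 1 / real (Suc n)" by simp
      show "norm (indicator A x * (f (x + ?h) - f x) * real (Suc n)) \<le> indicator K' x * B"
      proof (cases "x \<in> K'")
        case True
        have "\<bar>f (x + ?h) - f x\<bar> \<le> B * norm ((x + ?h) - x)"
          by (rule C1_grad_mvt[OF f B(2)])
        then have "\<bar>f (x + ?h) - f x\<bar> * real (Suc n) \<le> B"
          using nh by (simp add: field_simps)
        moreover have "norm (indicator A x * (f (x + ?h) - f x) * real (Suc n)) \<le> \<bar>f (x + ?h) - f x\<bar> * real (Suc n)"
          by (auto simp: indicator_def abs_mult)
        ultimately show ?thesis using True by simp
      next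
        case False
        have nx: "norm x > R + 1" using False by (simp add: K'_def)
        have "norm x \<le> norm (x + ?h) + norm ?h" by (metis add_diff_cancel_right' norm_triangle_ineq4)
        moreover have "norm ?h \<le> 1" unfolding nh by simp
        ultimately have "x \<notin> K" "x + ?h \<notin> K"
          using nx R[of x] R[of "x + ?h"] by linarith+
        then show ?thesis using K(2) False by simp
      qed
    qed
  qed measurable
qed

text \<open>For \<open>A = UNIV\<close> every difference quotient has integral zero, because a shift
  does not change an integral over the whole plane.\<close>

lemma integral_gradient_eq_0:
  assumes f: "C1_grad f f'" and K: "compact K" "\<And>x. x \<notin> K \<Longrightarrow> f x = 0"
  shows "(\<integral>x. f' x $ i \<partial>lborel) = 0"
proof -
  have fi: "integrable lborel f"
    using integrable_continuous_compact_support[OF C1_grad_continuous[OF f] K] .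
  have [measurable]: "f \<in> borel_measurable borel"
    using fi by auto
  have "(\<integral>x. indicator UNIV x * (f (x + (1 / real (Suc n)) *\<^sub>R axis i 1) - f x) * real (Suc n) \<partial>lborel) = 0" for n
    using lborel_integral_translate[of f "(1 / real (Suc n)) *\<^sub>R axis i 1"]
      lborel_integrable_translate[OF fi, of "(1 / real (Suc n)) *\<^sub>R axis i 1"] fi
    by (simp add: add.commute)
  then show ?thesis
    using difference_quotient_integral[OF f K, of UNIV i] by (simp add: LIMSEQ_const_iff)
qed

section \<open>Potentials and growth\<close>

lemma C1_grad_scale:
  assumes "C1_grad f f'" shows "C1_grad (\<lambda>x. f (t *\<^sub>R x)) (\<lambda>x. t *\<^sub>R f' (t *\<^sub>R x))"
proof (rule C1_gradI)
  fix x :: "real^2"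
  have "((\<lambda>x. t *\<^sub>R x) has_derivative (\<lambda>h. t *\<^sub>R h)) (at x)"
    by (rule derivative_eq_intros refl)+ simp
  from has_derivative_compose[OF this C1_grad_derivative[OF assms, of "t *\<^sub>R x" UNIV]]
  show "((\<lambda>x. f (t *\<^sub>R x)) has_derivative (\<lambda>h. (t *\<^sub>R f' (t *\<^sub>R x)) \<bullet> h)) (at x)" by simp
next
  show "continuous_on UNIV (\<lambda>x. t *\<^sub>R f' (t *\<^sub>R x))"
    by (intro continuous_intros continuous_on_compose2[OF C1_grad_continuous_grad[OF assms, of UNIV]]) auto
qed

lemma continuous_on_section:
  assumes "continuous_on (UNIV \<times> T) (\<lambda>(x, t). F x t)"
  shows "continuous_on T (F x)"
proof -
  have "continuous_on T (\<lambda>t. case (x, t) of (x, t) \<Rightarrow> F x t)"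
    by (rule continuous_on_compose2[OF assms]) (auto intro!: continuous_intros)
  then show ?thesis by simp
qed

text \<open>The Leibniz rule on a fixed interval. Antiderivatives with a moving end point are
  rescaled to \<open>{0..1}\<close> before it is applied to them.\<close>

lemma C1_grad_integral:
  fixes F :: "real^2 \<Rightarrow> real \<Rightarrow> real"
  assumes F: "\<And>t. t \<in> {0..1} \<Longrightarrow> C1_grad (\<lambda>x. F x t) (\<lambda>x. F' x t)"
    and c: "\<And>x. continuous_on {0..1} (F x)"
    and c': "continuous_on (UNIV \<times> {0..1}) (\<lambda>(x, t). F' x t)"
  shows "C1_grad (\<lambda>x. integral {0..1} (F x)) (\<lambda>x. integral {0..1} (F' x))"
proof (rule C1_gradI)
  fix x
  have cb: "{0..1} = cbox 0 (1::real)" by simp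
  have ci: "continuous_on {0..1} (F' x)"
    using continuous_on_section[OF c'] .
  have ii: "(\<lambda>t. blinfun_inner_left (F' x t)) integrable_on {0..1}"
    by (intro integrable_continuous_real bounded_linear.continuous_on[OF bounded_linear_blinfun_inner_left] ci)
  have "((\<lambda>x. integral (cbox 0 1) (F x)) has_derivative
      blinfun_apply (integral (cbox 0 1) (\<lambda>t. blinfun_inner_left (F' x t)))) (at x within UNIV)"
  proof (rule leibniz_rule)
    show "((\<lambda>x. F x t) has_derivative blinfun_apply (blinfun_inner_left (F' x t))) (at x within UNIV)"
      if "t \<in> cbox 0 1" for x t
      using C1_grad_derivative[OF F] that by (simp add: inner_commute)
    show "F x integrable_on cbox 0 1" for x
      using integrable_continuous_real[OF c] by simp
    show "continuous_on (UNIV \<times> cbox 0 1) (\<lambda>(x, t). blinfun_inner_left (F' x t))"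
      using bounded_linear.continuous_on[OF bounded_linear_blinfun_inner_left c'] by (simp add: case_prod_beta)
  qed auto
  moreover have "blinfun_apply (integral {0..1} (\<lambda>t. blinfun_inner_left (F' x t))) = (\<lambda>h. integral {0..1} (F' x) \<bullet> h)"
  proof (rule ext)
    fix h
    show "blinfun_apply (integral {0..1} (\<lambda>t. blinfun_inner_left (F' x t))) h = integral {0..1} (F' x) \<bullet> h"
      using blinfun_apply_integral[OF ii, of h]
        integral_linear[OF integrable_continuous_real[OF ci] bounded_linear_inner_left[of h]]
      by (simp add: o_def inner_commute)
  qed
  ultimately show "((\<lambda>x. integral {0..1} (F x)) has_derivative (\<lambda>h. integral {0..1} (F' x) \<bullet> h)) (at x)"
    by simp
next
  show "continuous_on UNIV (\<lambda>x. integral {0..1} (F' x))"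
    using integral_continuous_on_param[of UNIV 0 "1::real" F'] c' by simp
qed

lemma C1_grad_ray_derivative:
  assumes "C1_grad f f'"
  shows "((\<lambda>t. f (t *\<^sub>R x)) has_real_derivative f' (t *\<^sub>R x) \<bullet> x) (at t within T)"
proof -
  have "((\<lambda>t. t *\<^sub>R x) has_derivative (\<lambda>h. h *\<^sub>R x)) (at t within T)"
    by (rule derivative_eq_intros refl)+ simp
  from has_derivative_compose[OF this C1_grad_derivative[OF assms]]
  show ?thesis by (simp add: has_field_derivative_def mult_commute_abs)
qed

lemma integral_ray:
  assumes f: "C1_grad f f'"
  shows "integral {0..1} (\<lambda>t. f (t *\<^sub>R x) + t * (f' (t *\<^sub>R x) \<bullet> x)) = f x"
proof -
  have "((\<lambda>t. f (t *\<^sub>R x) + t * (f' (t *\<^sub>R x) \<bullet> x)) has_integral (1 * f (1 *\<^sub>R x) - 0 * f (0 *\<^sub>R x))) {0..1}"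
    by (rule fundamental_theorem_of_calculus)
      (auto simp flip: has_real_derivative_iff_has_vector_derivative
        intro!: derivative_eq_intros C1_grad_ray_derivative[OF f])
  then show ?thesis by (simp add: integral_unique)
qed

text \<open>The potential is the line integral of \<open>(P, Q)\<close> along the ray from the
  origin. Closedness turns the components of the gradient of the integrand into the derivatives in
  \<open>t\<close> of \<open>t * P (t x)\<close> and \<open>t * Q (t x)\<close>, which
  \<open>integral_ray\<close> evaluates.\<close>

lemma poincare_plane:
  assumes P: "C1_grad P P'" and Q: "C1_grad Q Q'" and closed: "\<And>x. P' x $ 2 = Q' x $ 1"
  obtains f where "C1_grad f (\<lambda>x. pair2 (P x) (Q x))"
proof
  define F where "F x t = x $ 1 * P (t *\<^sub>R x) + x $ 2 * Q (t *\<^sub>R x)" for x t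
  define F' where "F' x t = (x $ 1 *\<^sub>R (t *\<^sub>R P' (t *\<^sub>R x)) + P (t *\<^sub>R x) *\<^sub>R axis 1 1)
     + (x $ 2 *\<^sub>R (t *\<^sub>R Q' (t *\<^sub>R x)) + Q (t *\<^sub>R x) *\<^sub>R axis 2 1)" for x t
  have c: "continuous_on S (\<lambda>z. h (t z *\<^sub>R x z))"
    if "continuous_on UNIV h" "continuous_on S t" "continuous_on S x"
    for h :: "real^2 \<Rightarrow> 'b::topological_space" and x t and S :: "'c::topological_space set"
    by (rule continuous_on_compose2[OF that(1)]) (auto intro!: continuous_intros that)
  note cPQ = c[OF C1_grad_continuous[OF P]] c[OF C1_grad_continuous[OF Q]]
    c[OF C1_grad_continuous_grad[OF P]] c[OF C1_grad_continuous_grad[OF Q]]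
  have c': "continuous_on (UNIV \<times> {0..1}) (\<lambda>(x, t). F' x t)"
    unfolding F'_def case_prod_beta by (intro continuous_intros cPQ)
  have "C1_grad (\<lambda>x. integral {0..1} (F x)) (\<lambda>x. integral {0..1} (F' x))"
  proof (rule C1_grad_integral[OF _ _ c'])
    show "C1_grad (\<lambda>x. F x t) (\<lambda>x. F' x t)" for t
      unfolding F_def F'_def
      by (intro C1_grad_add C1_grad_mult C1_grad_component C1_grad_scale P Q)
    show "continuous_on {0..1} (F x)" for x
      unfolding F_def by (intro continuous_intros cPQ)
  qed
  moreover have "integral {0..1} (F' x) = pair2 (P x) (Q x)" for x
  proof -
    have i: "F' x integrable_on {0..1}"
      by (rule integrable_continuous_real) (rule continuous_on_section[OF c'])
    have "integral {0..1} (F' x) $ 1 = integral {0..1} (\<lambda>t. P (t *\<^sub>R x) + t * (P' (t *\<^sub>R x) \<bullet> x))"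
      by (subst integral_component_eq_cart[OF i, symmetric])
       (simp add: F'_def axis_def inner_2 closed algebra_simps)
    moreover have "integral {0..1} (F' x) $ 2 = integral {0..1} (\<lambda>t. Q (t *\<^sub>R x) + t * (Q' (t *\<^sub>R x) \<bullet> x))"
      by (subst integral_component_eq_cart[OF i, symmetric])
       (simp add: F'_def axis_def inner_2 closed[symmetric] algebra_simps)
    ultimately show ?thesis
      using integral_ray[OF P] integral_ray[OF Q] by (simp add: vec_eq_iff forall_2)
  qed
  ultimately show "C1_grad (\<lambda>x. integral {0..1} (F x)) (\<lambda>x. pair2 (P x) (Q x))" by simp
qed

section \<open>Growth of a planar map from its trace-free derivative\<close>

text \<open>Needed where a derivative is bounded in one direction only and nothing is known about
  the full gradient.\<close>

lemma C1_grad_mvt_directional: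
  assumes f: "C1_grad f f'" and B: "\<And>z. z \<in> closed_segment x y \<Longrightarrow> \<bar>f' z \<bullet> (y - x)\<bar> \<le> B"
  shows "\<bar>f y - f x\<bar> \<le> B"
proof -
  have "\<exists>t\<in>{0<..<1}. f (x + 1 *\<^sub>R (y - x)) - f (x + 0 *\<^sub>R (y - x)) = (\<lambda>h. f' (x + t *\<^sub>R (y - x)) \<bullet> (h *\<^sub>R (y - x))) (1 - 0)"
  proof (rule mvt_simple)
    fix t :: real
    have "((\<lambda>t. x + t *\<^sub>R (y - x)) has_derivative (\<lambda>h. h *\<^sub>R (y - x))) (at t within {0..1})"
      by (rule derivative_eq_intros refl)+ simp
    from has_derivative_compose[OF this C1_grad_derivative[OF f]]
    show "((\<lambda>t. f (x + t *\<^sub>R (y - x))) has_derivative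
        (\<lambda>h. f' (x + t *\<^sub>R (y - x)) \<bullet> (h *\<^sub>R (y - x)))) (at t within {0..1})" .
  qed simp
  then obtain t where t: "0 < t" "t < 1" "f y - f x = f' (x + t *\<^sub>R (y - x)) \<bullet> (y - x)" by auto
  have "x + t *\<^sub>R (y - x) \<in> closed_segment x y"
    unfolding closed_segment_def using t by (auto intro!: exI[of _ t] simp: algebra_simps)
  then show ?thesis using B t by auto
qed

lemma norm_closed_segment_le:
  fixes x y z :: "'a::real_normed_vector"
  assumes "z \<in> closed_segment x y" "norm x \<le> r" "norm y \<le> r"
  shows "norm z \<le> r"
  using closed_segment_subset[of x "cball 0 r" y] assms by auto

text \<open>Halving \<open>s\<close> costs a factor \<open>2\<close> but divides
  \<open>\<bar>s\<bar> powr (p + 1)\<close> by \<open>2 powr (p + 1)\<close>. The net factor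
  \<open>2 powr - p\<close> is below \<open>1\<close> because \<open>p > 0\<close>, so the errors
  over all scales add up like a geometric series.\<close>

lemma halving_growth:
  fixes A :: "real \<Rightarrow> real"
  assumes cont: "continuous_on UNIV A" and p: "p > 0" and C: "C \<ge> 0"
    and halve: "\<And>s. \<bar>s\<bar> \<ge> 2 \<Longrightarrow> \<bar>A s\<bar> \<le> 2 * \<bar>A (s / 2)\<bar> + C * \<bar>s\<bar> powr (p + 1)"
  obtains D where "D \<ge> 0" "\<And>s r. \<bar>s\<bar> \<le> r \<Longrightarrow> 1 \<le> r \<Longrightarrow> \<bar>A s\<bar> \<le> D * r powr (p + 1)"
proof -
  have "compact (A ` {-2..2})"
    by (rule compact_continuous_image) (use cont in \<open>auto intro: continuous_on_subset\<close>)
  then obtain S where S': "\<And>s. s \<in> {-2..2} \<Longrightarrow> \<bar>A s\<bar> \<le> S"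
    using compact_imp_bounded by (force simp: bounded_iff)
  have S: "\<bar>A s\<bar> \<le> S" if "\<bar>s\<bar> \<le> 2" for s
    using that by (intro S') (simp add: abs_le_iff)
  have q: "2 powr - p < (1::real)" using p by (simp add: powr_minus field_simps)
  \<comment> \<open>\<open>C / (1 - 2 powr - p)\<close> solves
    \<open>D * 2 powr - p + C = D\<close>, so a bound with at least this constant reproduces itself
    when \<open>s\<close> is doubled; \<open>S\<close> starts the induction.\<close>
  define D where "D = max (max 0 S) (C / (1 - 2 powr - p))"
  have D0: "D \<ge> 0" "D \<ge> S" by (auto simp: D_def)
  have "C / (1 - 2 powr - p) \<le> D" by (simp add: D_def)
  then have D1: "D * 2 powr - p + C \<le> D" using q by (simp add: field_simps)
  have claim: "\<bar>A s\<bar> \<le> D * \<bar>s\<bar> powr (p + 1)" if "1 \<le> \<bar>s\<bar>" "\<bar>s\<bar> < 2 ^ Suc n" for s n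
    using that
  proof (induction n arbitrary: s)
    case 0
    then have "\<bar>A s\<bar> \<le> S" using S[of s] by auto
    also have "S \<le> D * 1" using D0 by simp
    also have "\<dots> \<le> D * \<bar>s\<bar> powr (p + 1)"
      using 0 D0 p by (intro mult_left_mono ge_one_powr_ge_zero) auto
    finally show ?case .
  next
    case (Suc n)
    show ?case
    proof (cases "\<bar>s\<bar> < 2")
      case True
      then have "\<bar>A s\<bar> \<le> S" using S[of s] by auto
      also have "S \<le> D * 1" using D0 by simp
      also have "\<dots> \<le> D * \<bar>s\<bar> powr (p + 1)"
        using Suc.prems D0 p by (intro mult_left_mono ge_one_powr_ge_zero) auto
      finally show ?thesis .
    next
      case False
      then have "\<bar>A (s / 2)\<bar> \<le> D * \<bar>s / 2\<bar> powr (p + 1)"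
        using Suc.prems by (intro Suc.IH) auto
      also have "\<bar>s / 2\<bar> powr (p + 1) = \<bar>s\<bar> powr (p + 1) * 2 powr - p / 2"
        by (simp add: powr_divide powr_add powr_minus field_simps)
      finally have h: "2 * \<bar>A (s / 2)\<bar> \<le> D * 2 powr - p * \<bar>s\<bar> powr (p + 1)" by (simp add: mult_ac)
      have "\<bar>A s\<bar> \<le> (D * 2 powr - p + C) * \<bar>s\<bar> powr (p + 1)"
        using halve[of s] False h by (simp add: distrib_right)
      also have "\<dots> \<le> D * \<bar>s\<bar> powr (p + 1)" using D1 by (intro mult_right_mono) auto
      finally show ?thesis .
    qed
  qed
  show ?thesis
  proof
    fix s r :: real assume r: "\<bar>s\<bar> \<le> r" "1 \<le> r"
    show "\<bar>A s\<bar> \<le> D * r powr (p + 1)"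
    proof (cases "1 \<le> \<bar>s\<bar>")
      case True
      obtain n where "\<bar>s\<bar> < 2 ^ n" using real_arch_pow[of 2 "\<bar>s\<bar>"] by auto
      then have "\<bar>s\<bar> < 2 ^ Suc n" by simp
      from claim[OF True this] have "\<bar>A s\<bar> \<le> D * \<bar>s\<bar> powr (p + 1)" .
      also have "\<dots> \<le> D * r powr (p + 1)"
        using r D0 p by (intro mult_left_mono powr_mono2) auto
      finally show ?thesis .
    next
      case False
      then have "\<bar>A s\<bar> \<le> S" using S[of s] by auto
      also have "S \<le> D * 1" using D0 by simp
      also have "\<dots> \<le> D * r powr (p + 1)"
        using r D0 p by (intro mult_left_mono ge_one_powr_ge_zero) auto
      finally show ?thesis .
    qed
  qed (use D0 in auto)
qed

text \<open>The trace-free part of the derivative controls the growth of a planar map, although it does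
  not control the full derivative pointwise: along the diagonals the two components vary in step, so
  the first component is almost additive on the axis.\<close>

lemma traceless_growth:
  assumes f: "C1_grad f f'" and g: "C1_grad g g'" and p: "p > 0" and K: "K \<ge> 0"
    and f2: "\<And>y. \<bar>f' y $ 2\<bar> \<le> K * (norm y powr p + 1)"
    and g1: "\<And>y. \<bar>g' y $ 1\<bar> \<le> K * (norm y powr p + 1)"
    and fg: "\<And>y. \<bar>f' y $ 1 - g' y $ 2\<bar> \<le> K * (norm y powr p + 1)"
  obtains C where "C \<ge> 0" "\<And>y. norm y \<ge> 1 \<Longrightarrow> \<bar>f y\<bar> \<le> C * norm y powr (p + 1)"
    "\<And>y. norm y \<ge> 1 \<Longrightarrow> \<bar>g y\<bar> \<le> C * norm y powr (p + 1)"
proof -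
  define N where "N r = K * (r powr p + 1)" for r
  have N_mono: "N a \<le> N b" if "0 \<le> a" "a \<le> b" for a b
    unfolding N_def using that K p by (intro mult_left_mono add_mono powr_mono2) auto
  have N0: "N a \<ge> 0" for a unfolding N_def using K by simp
  define A where "A s = f (pair2 s 0)" for s
  define B where "B t = g (pair2 0 t)" for t
  have seg: "norm z \<le> r" if "z \<in> closed_segment x y" "norm x \<le> r" "norm y \<le> r" for x y z :: "real^2" and r
    using norm_closed_segment_le that by blast
  have vert: "\<bar>f (pair2 s t) - A s\<bar> \<le> N r * \<bar>t\<bar>" if "norm (pair2 s t) \<le> r" "\<bar>s\<bar> \<le> r" for s t r
    unfolding A_def
  proof (rule C1_grad_mvt_directional[OF f])
    fix z assume z: "z \<in> closed_segment (pair2 s 0) (pair2 s t)"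
    have "norm (pair2 s 0) \<le> r" using norm_le_components_2[of "pair2 s 0"] that by simp
    from seg[OF z this that(1)] have "\<bar>f' z $ 2\<bar> \<le> N r"
      using f2[of z] N_mono[of "norm z" r] by (simp add: N_def)
    then show "\<bar>f' z \<bullet> (pair2 s t - pair2 s 0)\<bar> \<le> N r * \<bar>t\<bar>"
      by (simp add: inner_2 abs_mult mult_right_mono)
  qed
  have horz: "\<bar>g (pair2 s t) - B t\<bar> \<le> N r * \<bar>s\<bar>" if "norm (pair2 s t) \<le> r" "\<bar>t\<bar> \<le> r" for s t r
    unfolding B_def
  proof (rule C1_grad_mvt_directional[OF g])
    fix z assume z: "z \<in> closed_segment (pair2 0 t) (pair2 s t)"
    have "norm (pair2 0 t) \<le> r" using norm_le_components_2[of "pair2 0 t"] that by simp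
    from seg[OF z this that(1)] have "\<bar>g' z $ 1\<bar> \<le> N r"
      using g1[of z] N_mono[of "norm z" r] by (simp add: N_def)
    then show "\<bar>g' z \<bullet> (pair2 s t - pair2 0 t)\<bar> \<le> N r * \<bar>s\<bar>"
      by (simp add: inner_2 abs_mult mult_right_mono)
  qed
  \<comment> \<open>In the direction \<open>(1, 1)\<close> the derivative of \<open>f - g\<close> is
    the sum of \<open>f' $ 1 - g' $ 2\<close>, \<open>f' $ 2\<close> and \<open>- g' $ 1\<close>,
    all three of which are controlled.\<close>
  have diag: "\<bar>(f (pair2 (s + h) h) - g (pair2 (s + h) h)) - (f (pair2 s 0) - g (pair2 s 0))\<bar> \<le> 3 * N r * \<bar>h\<bar>"
    if "\<bar>s\<bar> \<le> r" "norm (pair2 (s + h) h) \<le> r" for s h r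
  proof (rule C1_grad_mvt_directional[OF C1_grad_diff[OF f g]])
    fix z assume z: "z \<in> closed_segment (pair2 s 0) (pair2 (s + h) h)"
    have "norm (pair2 s 0) \<le> r" using norm_le_components_2[of "pair2 s 0"] that by simp
    from seg[OF z this that(2)] have "N (norm z) \<le> N r" by (intro N_mono) auto
    then have "\<bar>(f' z $ 1 - g' z $ 2) + f' z $ 2 - g' z $ 1\<bar> \<le> 3 * N r"
      using f2[of z] g1[of z] fg[of z] unfolding N_def[of "norm z"] by linarith
    then have "\<bar>(f' z $ 1 - g' z $ 2) + f' z $ 2 - g' z $ 1\<bar> * \<bar>h\<bar> \<le> 3 * N r * \<bar>h\<bar>"
      by (intro mult_right_mono) auto
    then show "\<bar>(f' z - g' z) \<bullet> (pair2 (s + h) h - pair2 s 0)\<bar> \<le> 3 * N r * \<bar>h\<bar>"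
      by (simp add: inner_2 flip: abs_mult) (simp add: algebra_simps)
  qed
  \<comment> \<open>The increment of \<open>A\<close> over a length \<open>h\<close> nearly equals
    that of \<open>B\<close>, from either starting point; this is the almost additivity of
    \<open>A\<close>. The constant \<open>7\<close> consists of \<open>1\<close> for the vertical
    move, \<open>3\<close> for both horizontal moves together and \<open>3\<close> for the diagonal
    one. The radius four times \<open>\<bar>h\<bar>\<close> covers all points that occur.\<close>
  have step: "\<bar>(A (s + h) - A s) - (B h - B 0)\<bar> \<le> 7 * N (4 * \<bar>h\<bar>) * \<bar>h\<bar>"
    if s: "s = 0 \<or> s = h" for s h
  proof -
    let ?r = "4 * \<bar>h\<bar>" let ?M = "N ?r * \<bar>h\<bar>"
    have n: "norm (pair2 (s + h) h) \<le> ?r" "norm (pair2 s 0) \<le> ?r" "\<bar>s\<bar> \<le> ?r" "\<bar>s + h\<bar> \<le> ?r"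
      using norm_le_components_2[of "pair2 (s + h) h"] norm_le_components_2[of "pair2 s 0"] s by auto
    have 1: "\<bar>f (pair2 (s + h) h) - A (s + h)\<bar> \<le> ?M" by (rule vert) (use n in auto)
    have "\<bar>g (pair2 (s + h) h) - B h\<bar> \<le> N ?r * \<bar>s + h\<bar>" by (rule horz) (use n in auto)
    moreover have "\<bar>g (pair2 s 0) - B 0\<bar> \<le> N ?r * \<bar>s\<bar>" by (rule horz) (use n in auto)
    moreover have "\<bar>s + h\<bar> + \<bar>s\<bar> \<le> 3 * \<bar>h\<bar>" using s by auto
    then have "N ?r * \<bar>s + h\<bar> + N ?r * \<bar>s\<bar> \<le> 3 * ?M"
      using mult_left_mono[of "\<bar>s + h\<bar> + \<bar>s\<bar>" "3 * \<bar>h\<bar>" "N ?r"] N0 by (simp add: algebra_simps)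
    moreover have "\<bar>(f (pair2 (s + h) h) - g (pair2 (s + h) h)) - (A s - g (pair2 s 0))\<bar> \<le> 3 * ?M"
      using diag[of s ?r h] n by (simp add: A_def mult.assoc)
    ultimately show ?thesis using 1 by (simp add: mult.assoc abs_le_iff)
  qed
  define C0 where "C0 = \<bar>A 0\<bar> + 7 * K * (2 powr p + 1)"
  have N_le: "N (c * r) * r \<le> K * (c powr p + 1) * r powr (p + 1)" if "1 \<le> r" "0 \<le> c" for c r
  proof -
    have "(c * r) powr p + 1 \<le> (c powr p + 1) * r powr p"
      using ge_one_powr_ge_zero[of r p] that p by (simp add: powr_mult distrib_right)
    then have "N (c * r) \<le> K * (c powr p + 1) * r powr p"
      unfolding N_def using K mult_left_mono by fastforce
    then show ?thesis
      using mult_right_mono[of _ _ r] that by (fastforce simp: powr_add mult.assoc)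
  qed
  \<comment> \<open>The two cases of \<open>step\<close>, with half the argument as
    \<open>h\<close>, involve the same increment of \<open>B\<close>. Eliminating it compares
    \<open>A s\<close> with \<open>2 * A (s / 2) - A 0\<close>.\<close>
  have halve: "\<bar>A s\<bar> \<le> 2 * \<bar>A (s / 2)\<bar> + C0 * \<bar>s\<bar> powr (p + 1)" if "\<bar>s\<bar> \<ge> 2" for s
  proof -
    have "\<bar>(A s - A (s / 2)) - (B (s / 2) - B 0)\<bar> \<le> 7 * N (2 * \<bar>s\<bar>) * (\<bar>s\<bar> / 2)"
      using step[of "s / 2" "s / 2"] by (simp add: field_simps)
    moreover have "\<bar>(A (s / 2) - A 0) - (B (s / 2) - B 0)\<bar> \<le> 7 * N (2 * \<bar>s\<bar>) * (\<bar>s\<bar> / 2)"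
      using step[of 0 "s / 2"] by (simp add: field_simps)
    moreover have "N (2 * \<bar>s\<bar>) * \<bar>s\<bar> \<le> K * (2 powr p + 1) * \<bar>s\<bar> powr (p + 1)"
      by (rule N_le) (use that in auto)
    moreover have "\<bar>A 0\<bar> \<le> \<bar>A 0\<bar> * \<bar>s\<bar> powr (p + 1)"
      using ge_one_powr_ge_zero[of "\<bar>s\<bar>" "p + 1"] that p by (intro mult_le_cancel_left1[THEN iffD2]) auto
    moreover have "C0 * \<bar>s\<bar> powr (p + 1) = \<bar>A 0\<bar> * \<bar>s\<bar> powr (p + 1) + 7 * (K * (2 powr p + 1) * \<bar>s\<bar> powr (p + 1))"
      unfolding C0_def by (simp add: distrib_right)
    ultimately show ?thesis by linarith
  qed
  have cA: "continuous_on UNIV A"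
    unfolding A_def
    by (rule continuous_on_compose2[OF C1_grad_continuous[OF f, of UNIV]]) (auto intro!: continuous_intros)
  obtain D where D: "D \<ge> 0" "\<And>s r. \<bar>s\<bar> \<le> r \<Longrightarrow> 1 \<le> r \<Longrightarrow> \<bar>A s\<bar> \<le> D * r powr (p + 1)"
    using halving_growth[OF cA p _ halve] K unfolding C0_def by auto
  define C where "C = D + 2 * K + \<bar>A 0\<bar> + \<bar>B 0\<bar> + 7 * K * (4 powr p + 1)"
  have C0: "C \<ge> 0" "D + 2 * K \<le> C" using D(1) K unfolding C_def by auto
  show ?thesis
  proof (rule that[OF C0(1)])
    fix y :: "real^2" assume y: "1 \<le> norm y"
    let ?q = "norm y powr (p + 1)"
    have q1: "1 \<le> ?q" using y p by (intro ge_one_powr_ge_zero) auto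
    have py: "pair2 (y $ 1) (y $ 2) = y" by (simp add: vec_eq_iff forall_2)
    have c1: "\<bar>y $ 1\<bar> \<le> norm y" and c2: "\<bar>y $ 2\<bar> \<le> norm y" by (rule component_le_norm_cart)+
    have NK: "N (norm y) * norm y \<le> 2 * K * ?q" using N_le[of "norm y" 1] y by simp
    have "\<bar>f y - A (y $ 1)\<bar> \<le> N (norm y) * \<bar>y $ 2\<bar>" using vert[of "y $ 1" "y $ 2" "norm y"] c1 py by simp
    also have "\<dots> \<le> N (norm y) * norm y" using c2 N0 by (intro mult_left_mono)
    finally have "\<bar>f y\<bar> \<le> \<bar>A (y $ 1)\<bar> + N (norm y) * norm y" by linarith
    also have "\<dots> \<le> (D + 2 * K) * ?q" using NK D(2)[OF c1 y] by (simp add: distrib_right)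
    also have "\<dots> \<le> C * ?q" using C0 by (intro mult_right_mono) auto
    finally show "\<bar>f y\<bar> \<le> C * ?q" .
    have "\<bar>g y - B (y $ 2)\<bar> \<le> N (norm y) * \<bar>y $ 1\<bar>" using horz[of "y $ 1" "y $ 2" "norm y"] c2 py by simp
    also have "\<dots> \<le> N (norm y) * norm y" using c1 N0 by (intro mult_left_mono)
    finally have 1: "\<bar>g y\<bar> \<le> \<bar>B (y $ 2)\<bar> + 2 * K * ?q" using NK by linarith
    have "N (4 * \<bar>y $ 2\<bar>) * \<bar>y $ 2\<bar> \<le> N (4 * norm y) * norm y"
      using c2 N0 by (intro mult_mono N_mono) auto
    also have "\<dots> \<le> K * (4 powr p + 1) * ?q" by (rule N_le) (use y in auto)
    finally have "7 * N (4 * \<bar>y $ 2\<bar>) * \<bar>y $ 2\<bar> \<le> 7 * K * (4 powr p + 1) * ?q" by simp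
    then have "\<bar>B (y $ 2)\<bar> \<le> D * ?q + \<bar>A 0\<bar> + \<bar>B 0\<bar> + 7 * K * (4 powr p + 1) * ?q"
      using step[of 0 "y $ 2"] D(2)[OF c2 y] by simp
    moreover have "\<bar>A 0\<bar> \<le> \<bar>A 0\<bar> * ?q" "\<bar>B 0\<bar> \<le> \<bar>B 0\<bar> * ?q"
      using q1 by (simp_all add: mult_le_cancel_left1)
    ultimately show "\<bar>g y\<bar> \<le> C * ?q" using 1 unfolding C_def by (simp add: distrib_right)
  qed
qed

section \<open>Cutoff functions and the pointwise inequality\<close>

lemma pos_sq_derivative: "((\<lambda>x. (max 0 x)\<^sup>2) has_real_derivative 2 * max 0 x) (at (x::real))"
proof -
  have b: "\<bar>(max 0 (x + h))\<^sup>2 - (max 0 x)\<^sup>2 - 2 * max 0 x * h\<bar> \<le> h\<^sup>2" for h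
  proof -
    consider "x \<ge> 0" "x + h \<ge> 0" | "x \<le> 0" "x + h \<le> 0" | "x \<ge> 0" "x + h \<le> 0" | "x \<le> 0" "x + h \<ge> 0"
      by linarith
    then show ?thesis
    proof cases
      case 3
      have "x * h \<le> 0" using 3 by (intro mult_nonneg_nonpos) auto
      moreover have "x\<^sup>2 \<le> (- h)\<^sup>2" using 3 by (intro power_mono) auto
      ultimately have "x\<^sup>2 + 2 * x * h \<le> h\<^sup>2" "- (x\<^sup>2 + 2 * x * h) \<le> h\<^sup>2"
        using zero_le_square[of "x + h"] by (auto simp: power2_eq_square algebra_simps)
      moreover have "max 0 x = x" "max 0 (x + h) = 0" using 3 by auto
      ultimately show ?thesis by (simp add: abs_le_iff algebra_simps)
    next
      case 4
      have "(x + h)\<^sup>2 \<le> h\<^sup>2" by (rule power_mono) (use 4 in auto)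
      then show ?thesis using 4 by simp
    qed (auto simp: power2_eq_square algebra_simps)
  qed
  show ?thesis unfolding DERIV_def
  proof (rule LIM_zero_cancel, rule Lim_null_comparison)
    show "\<forall>\<^sub>F h in at 0. norm (((max 0 (x + h))\<^sup>2 - (max 0 x)\<^sup>2) / h - 2 * max 0 x) \<le> \<bar>h\<bar>"
      unfolding eventually_at_filter
    proof (intro always_eventually allI impI)
      fix h :: real assume h: "h \<noteq> 0"
      have "\<bar>((max 0 (x + h))\<^sup>2 - (max 0 x)\<^sup>2) / h - 2 * max 0 x\<bar> * \<bar>h\<bar> = \<bar>(max 0 (x + h))\<^sup>2 - (max 0 x)\<^sup>2 - 2 * max 0 x * h\<bar>"
        using h by (simp flip: abs_mult add: field_simps)
      also have "\<dots> \<le> \<bar>h\<bar> * \<bar>h\<bar>" using b[of h] by (simp add: power2_eq_square)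
      finally show "norm (((max 0 (x + h))\<^sup>2 - (max 0 x)\<^sup>2) / h - 2 * max 0 x) \<le> \<bar>h\<bar>"
        using h by (simp only: real_norm_def mult_le_cancel_right)
    qed
    show "((\<lambda>h::real. \<bar>h\<bar>) \<longlongrightarrow> 0) (at 0)" by (intro tendsto_eq_intros) auto
  qed
qed

text \<open>The square of a positive part is continuously differentiable. Taking it at both ends
  joins the constants \<open>1\<close> and \<open>0\<close> with a continuous first
  derivative.\<close>

definition cutoff :: "real \<Rightarrow> real" where
  "cutoff t = (max 0 (1 - (max 0 t)\<^sup>2))\<^sup>2"

definition cutoff' :: "real \<Rightarrow> real" where
  "cutoff' t = - 4 * max 0 (1 - (max 0 t)\<^sup>2) * max 0 t"

lemma cutoff_derivative: "(cutoff has_real_derivative cutoff' t) (at t)"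
proof -
  have "((\<lambda>t. 1 - (max 0 t)\<^sup>2) has_real_derivative - (2 * max 0 t)) (at t)"
    using DERIV_diff[OF DERIV_const pos_sq_derivative, of 1] by simp
  from DERIV_chain2[OF pos_sq_derivative this] show ?thesis
    unfolding cutoff_def[abs_def] cutoff'_def by (simp add: mult_ac)
qed

lemma continuous_on_cutoff': "continuous_on UNIV cutoff'"
  unfolding cutoff'_def[abs_def] by (intro continuous_intros)

lemma cutoff_bounds: "0 \<le> cutoff t" "cutoff t \<le> 1"
  unfolding cutoff_def by (auto intro!: power_le_one)

lemma cutoff_eq_1: "t \<le> 0 \<Longrightarrow> cutoff t = 1"
  and cutoff_eq_0: "t \<ge> 1 \<Longrightarrow> cutoff t = 0"
  unfolding cutoff_def using one_le_power[of t 2] by auto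

lemma cutoff'_bound: "\<bar>cutoff' t\<bar> \<le> 4"
proof (cases "t \<ge> 1")
  case True
  then have "1 - (max 0 t)\<^sup>2 \<le> 0" by (simp add: max_def)
  then show ?thesis by (simp add: cutoff'_def)
next
  case False
  then have "max 0 (1 - (max 0 t)\<^sup>2) * max 0 t \<le> 1 * 1" by (intro mult_mono) auto
  then show ?thesis by (simp add: cutoff'_def abs_mult mult.assoc)
qed

lemma C1_grad_cutoff:
  "C1_grad f f' \<Longrightarrow> C1_grad (\<lambda>x. cutoff (f x)) (\<lambda>x. cutoff' (f x) *\<^sub>R f' x)"
  by (rule C1_grad_real_compose[OF _ cutoff_derivative continuous_on_cutoff'])

lemma radial_cutoff:
  fixes r1 r2 :: real
  assumes "0 \<le> r1" "r1 < r2"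
  obtains z z' where "C1_grad z z'" "\<And>x. 0 \<le> z x" "\<And>x. z x \<le> 1"
    "\<And>x. norm x \<le> r1 \<Longrightarrow> z x = 1" "\<And>x. norm x > r2 \<Longrightarrow> z x = 0"
proof
  let ?f = "\<lambda>x::real^2. (1 / (r2\<^sup>2 - r1\<^sup>2)) * ((norm x)\<^sup>2 - r1\<^sup>2)"
  have pos: "r2\<^sup>2 - r1\<^sup>2 > 0" using assms by (simp add: power_strict_mono)
  show "C1_grad (\<lambda>x. cutoff (?f x)) (\<lambda>x. cutoff' (?f x) *\<^sub>R ((1 / (r2\<^sup>2 - r1\<^sup>2)) *\<^sub>R (2 *\<^sub>R x - 0)))"
    by (intro C1_grad_cutoff C1_grad_cmult C1_grad_diff C1_grad_norm_sq C1_grad_const)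
  show "cutoff (?f x) = 1" if "norm x \<le> r1" for x
    by (rule cutoff_eq_1) (use pos that assms in \<open>auto intro!: divide_nonpos_pos power_mono\<close>)
  show "cutoff (?f x) = 0" if "norm x > r2" for x
  proof (rule cutoff_eq_0)
    have "r2\<^sup>2 \<le> (norm x)\<^sup>2" using that assms by (intro power_mono) auto
    then show "1 \<le> ?f x" using pos by (simp add: field_simps)
  qed
qed (rule cutoff_bounds)+

text \<open>The gradient of \<open>ln (norm y)\<close> decays like \<open>1 / norm y\<close> while
  the logarithm itself is unbounded. Hence the descent from \<open>1\<close> to \<open>0\<close> can
  be spread over so many scales that slope times radius is as small as desired. At the squared norm,
  \<open>L\<close> is \<open>ln (1 + norm y ^ 4)\<close>, a version without singularity at the
  origin.\<close>

lemma log_cutoff: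
  fixes R \<delta> :: real
  assumes R: "0 \<le> R" and \<delta>: "0 < \<delta>"
  obtains \<theta> \<theta>' R' where "C1_grad \<theta> \<theta>'" "\<And>y. 0 \<le> \<theta> y" "\<And>y. \<theta> y \<le> 1" "R \<le> R'"
    "\<And>y. norm y \<le> R \<Longrightarrow> \<theta> y = 1" "\<And>y. norm y > R' \<Longrightarrow> \<theta> y = 0"
    "\<And>y. norm (\<theta>' y) * norm y \<le> \<delta>"
proof -
  define L where "L t = ln (1 + t\<^sup>2)" for t :: real
  define L' where "L' t = 2 * t / (1 + t\<^sup>2)" for t :: real
  have pos: "1 + t\<^sup>2 > 0" for t :: real by (simp add: add_pos_nonneg)
  have L: "(L has_real_derivative L' t) (at t)" for t
    unfolding L_def[abs_def] L'_def using pos[of t]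
    by (auto intro!: derivative_eq_intros simp: divide_simps)
  have L': "continuous_on UNIV L'"
    unfolding L'_def[abs_def] using pos by (intro continuous_intros) (metis less_irrefl)
  have Lmono: "L s \<le> L t" if "0 \<le> s" "s \<le> t" for s t
    unfolding L_def using that pos by (subst ln_le_cancel_iff) (auto intro!: power_mono)
  \<comment> \<open>The \<open>16\<close> is the product of the bound \<open>4\<close> on
    \<open>cutoff'\<close> and the bound \<open>4\<close> on \<open>norm y\<close> times the
    gradient of \<open>L\<close> at the squared norm. The radius \<open>R'\<close> is where the two
    values of \<open>L\<close> differ by at least \<open>16 / \<delta>\<close>.\<close>
  let ?f = "\<lambda>y::real^2. (\<delta> / 16) * (L ((norm y)\<^sup>2) - L (R\<^sup>2))"
  let ?f' = "\<lambda>y::real^2. (\<delta> / 16) *\<^sub>R (L' ((norm y)\<^sup>2) *\<^sub>R (2 *\<^sub>R y) - 0)"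
  define R' where "R' = max R (exp (16 / \<delta> + L (R\<^sup>2)))"
  show ?thesis
  proof
    show "C1_grad (\<lambda>y. cutoff (?f y)) (\<lambda>y. cutoff' (?f y) *\<^sub>R ?f' y)"
      by (intro C1_grad_cutoff C1_grad_cmult C1_grad_diff C1_grad_const
        C1_grad_real_compose[OF C1_grad_norm_sq, where h=L and h'=L'] L L')
    show "R \<le> R'" by (simp add: R'_def)
    show "cutoff (?f y) = 1" if "norm y \<le> R" for y
      by (rule cutoff_eq_1) (use that \<delta> in \<open>auto intro!: mult_nonneg_nonpos Lmono power_mono\<close>)
    show "cutoff (?f y) = 0" if "norm y > R'" for y
    proof (rule cutoff_eq_0)
      let ?E = "exp (16 / \<delta> + L (R\<^sup>2))"
      have "L (R\<^sup>2) \<ge> 0" unfolding L_def by simp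
      then have E1: "?E \<ge> 1" using \<delta> by simp
      have E: "?E \<le> norm y" using that by (simp add: R'_def)
      have n1: "1 \<le> norm y" using E E1 by (rule order_trans[rotated])
      have "?E \<le> (norm y)\<^sup>2" using E power_increasing[of 1 2 "norm y"] n1 by simp
      then have "?E \<le> ((norm y)\<^sup>2)\<^sup>2" using power_increasing[of 1 2 "(norm y)\<^sup>2"] one_le_power[OF n1] by simp
      then have "?E \<le> 1 + ((norm y)\<^sup>2)\<^sup>2" by simp
      then have "16 / \<delta> + L (R\<^sup>2) \<le> L ((norm y)\<^sup>2)"
        unfolding L_def by (metis exp_gt_zero ln_exp ln_le_cancel_iff pos)
      then show "1 \<le> ?f y" using \<delta> by (simp add: field_simps)
    qed
    show "norm (cutoff' (?f y) *\<^sub>R ?f' y) * norm y \<le> \<delta>" for y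
    proof -
      have "L' ((norm y)\<^sup>2) * (norm y)\<^sup>2 = 2 * (((norm y)\<^sup>2)\<^sup>2 / (1 + ((norm y)\<^sup>2)\<^sup>2))"
        by (simp add: L'_def power2_eq_square)
      also have "\<dots> \<le> 2 * 1"
      proof (rule mult_left_mono)
        show "((norm y)\<^sup>2)\<^sup>2 / (1 + ((norm y)\<^sup>2)\<^sup>2) \<le> 1"
          using pos[of "(norm y)\<^sup>2"] by (simp only: divide_le_eq_1_pos)
      qed simp
      finally have a: "L' ((norm y)\<^sup>2) * (norm y)\<^sup>2 \<le> 2" by simp
      have nn: "L' ((norm y)\<^sup>2) \<ge> 0" unfolding L'_def using pos by (intro divide_nonneg_pos) (auto simp: add_pos_nonneg)
      have "norm (cutoff' (?f y) *\<^sub>R ?f' y) * norm y = \<bar>cutoff' (?f y)\<bar> * (\<delta> / 8 * (L' ((norm y)\<^sup>2) * (norm y)\<^sup>2))"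
        using \<delta> nn by (simp add: abs_mult power2_eq_square)
      also have "\<dots> \<le> 4 * (\<delta> / 8 * 2)"
        using cutoff'_bound[of "?f y"] a nn \<delta> by (intro mult_mono mult_left_mono) auto
      finally show ?thesis by simp
    qed
  qed (rule cutoff_bounds)+
qed

section \<open>The pointwise calibration inequality\<close>

text \<open>For the symmetric matrix \<open>S\<close> with rows \<open>(k, -i)\<close> and
  \<open>(-i, -l)\<close>, the first two hypotheses say that \<open>1 - S\<close> and
  \<open>1 + S\<close> have non-negative determinants, and \<open>c0\<close> is
  \<open>det S\<close>. With this coefficient the gap \<open>P\<close> times \<open>1 - c0^2\<close>
  is the product of the two determinants plus squares. Up to a factor, \<open>p\<close> and
  \<open>q\<close> are the derivatives of \<open>P\<close> in \<open>c\<close> and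
  \<open>b\<close>.\<close>

lemma pointwise_calibration_normalized:
  fixes a b c d i k l :: real
  assumes 1: "i\<^sup>2 \<le> (1 - k) * (1 + l)" and 2: "i\<^sup>2 \<le> (1 + k) * (1 - l)" and c0: "\<bar>- (k * l + i\<^sup>2)\<bar> < 1"
  shows "2 * (i * (a - d) + k * c + l * b)
    \<le> 1 + a\<^sup>2 + b\<^sup>2 + c\<^sup>2 + d\<^sup>2 + 2 * (- (k * l + i\<^sup>2)) * (a * d - b * c)"
proof -
  define c0 where "c0 = - (k * l + i\<^sup>2)"
  define P where "P = 1 + a\<^sup>2 + b\<^sup>2 + c\<^sup>2 + d\<^sup>2 + 2 * c0 * (a * d - b * c) - 2 * (i * (a - d) + k * c + l * b)"
  define p where "p = c - c0 * b - k"
  define q where "q = b - c0 * c - l"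
  have c: "c0 < 1" "- 1 < c0" using c0 by (auto simp: c0_def)
  then have E: "0 < (1 - c0) * (1 + c0)" by simp
  have S: "E * P0 = R" if "E = (1 - c0) * (1 + c0)" "P0 = P"
    "R = ((1 - k) * (1 + l) - i\<^sup>2) * ((1 + k) * (1 - l) - i\<^sup>2)
      + (1 - c0) * (1 + c0) * ((1 + c0) * (a + d)\<^sup>2 / 2)
      + (1 + c0) * (((1 - c0) * (a - d) - 2 * i)\<^sup>2 / 2)
      + ((p + c0 * q)\<^sup>2 + (1 - c0) * (1 + c0) * q\<^sup>2)" for E P0 R
  proof -
    have "((1 - k) * (1 + l) - i\<^sup>2) * ((1 + k) * (1 - l) - i\<^sup>2)
        = (1 - c0) * (1 + c0) - 2 * i\<^sup>2 * (1 + c0) - (k\<^sup>2 + l\<^sup>2 + 2 * c0 * k * l)"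
      unfolding c0_def by (simp add: power2_eq_square algebra_simps)
    then show ?thesis
      unfolding that P_def p_def q_def by (simp add: power2_eq_square field_simps)
  qed
  have "0 \<le> (1 - c0) * (1 + c0) * P"
  proof -
    have "0 \<le> ((1 - k) * (1 + l) - i\<^sup>2) * ((1 + k) * (1 - l) - i\<^sup>2)"
      using 1 2 by (intro mult_nonneg_nonneg) auto
    moreover have "0 \<le> 1 + c0" using c by simp
    then have "0 \<le> (1 - c0) * (1 + c0) * ((1 + c0) * (a + d)\<^sup>2 / 2)" "0 \<le> (1 + c0) * (((1 - c0) * (a - d) - 2 * i)\<^sup>2 / 2)"
      using E by simp_all
    moreover have "0 \<le> (p + c0 * q)\<^sup>2 + (1 - c0) * (1 + c0) * q\<^sup>2" using E by simp
    ultimately show ?thesis unfolding S[OF refl refl refl] by linarith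
  qed
  then have "0 \<le> P" using E by (simp add: zero_le_mult_iff)
  then show ?thesis by (simp add: P_def c0_def)
qed

text \<open>Dividing the matrix by \<open>s = sqrt \<Omega>\<close> and scaling the derivative by
  \<open>\<epsilon> / s\<close> reduces this to the normalised case. The inequality between
  \<open>\<omega>\<^sup>2\<close> and \<open>\<Omega>\<close> is strict in order to make both forms
  in \<open>pos\<close> positive definite, so that the coefficient of the determinant stays strictly
  between \<open>-1\<close> and \<open>1\<close>.\<close>

lemma pointwise_calibration:
  fixes a b c d k l m \<omega> \<Omega> \<epsilon> :: real
  assumes quad: "\<And>a b. \<bar>k * a\<^sup>2 - 2 * m * a * b - l * b\<^sup>2\<bar> \<le> \<omega> * (a\<^sup>2 + b\<^sup>2)"
    and \<Omega>: "\<omega>\<^sup>2 < \<Omega>" and \<epsilon>: "\<epsilon> > 0"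
  shows "2 * (m * (a - d) + k * c + l * b)
      \<le> \<Omega> / \<epsilon> + \<epsilon> * (a\<^sup>2 + b\<^sup>2 + c\<^sup>2 + d\<^sup>2 + 2 * (- (k * l + m\<^sup>2) / \<Omega>) * (a * d - b * c))" (is ?th1)
    and "\<bar>- (k * l + m\<^sup>2) / \<Omega>\<bar> \<le> 1" (is ?th2)
proof -
  define s where "s = sqrt \<Omega>"
  have \<Omega>0: "0 < \<Omega>" using \<Omega> zero_le_power2[of \<omega>] by linarith
  then have s: "s > 0" "s\<^sup>2 = \<Omega>" by (auto simp: s_def)
  have \<omega>s: "\<omega> < s" using \<Omega> s by (metis abs_le_square_iff abs_of_pos linorder_not_le abs_ge_self order_trans)
  have pos: "(s - k) * a\<^sup>2 + 2 * m * a * b + (s + l) * b\<^sup>2 > 0"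
    "(s + k) * a\<^sup>2 - 2 * m * a * b + (s - l) * b\<^sup>2 > 0" if "a \<noteq> 0 \<or> b \<noteq> 0" for a b
  proof -
    have "0 < a\<^sup>2 + b\<^sup>2" using that by (simp add: sum_power2_gt_zero_iff)
    then have "\<omega> * (a\<^sup>2 + b\<^sup>2) < s * (a\<^sup>2 + b\<^sup>2)" using \<omega>s by simp
    then show "(s - k) * a\<^sup>2 + 2 * m * a * b + (s + l) * b\<^sup>2 > 0"
      "(s + k) * a\<^sup>2 - 2 * m * a * b + (s - l) * b\<^sup>2 > 0"
      using quad[of a b] by (auto simp: algebra_simps abs_le_iff)
  qed
  have kl: "k < s" "- s < k" "l < s" "- s < l" using pos[of 1 0] pos[of 0 1] by auto
  \<comment> \<open>At the vector \<open>(s + l, - m)\<close> the form equals \<open>s + l\<close>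
    times its determinant, which gives the sign of the determinant.\<close>
  have "0 < (s + l) * ((s - k) * (s + l) - m\<^sup>2)"
    using pos(1)[of "s + l" "- m"] kl by (simp add: power2_eq_square algebra_simps)
  then have d1: "m\<^sup>2 < (s - k) * (s + l)" using kl by (simp add: zero_less_mult_iff)
  have "0 < (s - l) * ((s + k) * (s - l) - m\<^sup>2)"
    using pos(2)[of "s - l" "m"] kl by (simp add: power2_eq_square algebra_simps)
  then have d2: "m\<^sup>2 < (s + k) * (s - l)" using kl by (simp add: zero_less_mult_iff)
  have "m\<^sup>2 + k * l < s * s"
    using add_strict_mono[OF d1 d2] by (simp add: algebra_simps)
  moreover have "- (s * s) < k * l"
  proof -
    have "\<bar>k\<bar> * \<bar>l\<bar> < s * s" using kl by (intro mult_strict_mono) auto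
    then show ?thesis by (simp add: abs_mult[symmetric] abs_less_iff)
  qed
  ultimately have c0: "\<bar>- (k * l + m\<^sup>2)\<bar> < s\<^sup>2"
    using zero_le_power2[of m] unfolding power2_eq_square[of s] abs_less_iff by linarith
  then have "\<bar>- (k * l + m\<^sup>2)\<bar> / \<Omega> \<le> 1" using s(2) \<Omega>0 by (simp only: divide_le_eq_1_pos)
  then show ?th2 using \<Omega>0 by (simp only: abs_divide abs_of_pos)
  have "2 * (m / s * (\<epsilon> * a / s - \<epsilon> * d / s) + k / s * (\<epsilon> * c / s) + l / s * (\<epsilon> * b / s))
    \<le> 1 + (\<epsilon> * a / s)\<^sup>2 + (\<epsilon> * b / s)\<^sup>2 + (\<epsilon> * c / s)\<^sup>2 + (\<epsilon> * d / s)\<^sup>2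
      + 2 * (- (k / s * (l / s) + (m / s)\<^sup>2)) * (\<epsilon> * a / s * (\<epsilon> * d / s) - \<epsilon> * b / s * (\<epsilon> * c / s))"
  proof (rule pointwise_calibration_normalized)
    have "(1 - k / s) * (1 + l / s) = ((s - k) * (s + l)) / s\<^sup>2" "(1 + k / s) * (1 - l / s) = ((s + k) * (s - l)) / s\<^sup>2"
      using s by (simp_all add: field_simps power2_eq_square)
    then show "(m / s)\<^sup>2 \<le> (1 - k / s) * (1 + l / s)" "(m / s)\<^sup>2 \<le> (1 + k / s) * (1 - l / s)"
      using d1 d2 by (simp_all add: power_divide divide_right_mono)
    have "- (k / s * (l / s) + (m / s)\<^sup>2) = - (k * l + m\<^sup>2) / s\<^sup>2"
      by (simp add: power2_eq_square diff_divide_distrib)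
    then show "\<bar>- (k / s * (l / s) + (m / s)\<^sup>2)\<bar> < 1" using c0 s by (simp add: abs_divide)
  qed
  then have "s\<^sup>2 / \<epsilon> * (2 * (m / s * (\<epsilon> * a / s - \<epsilon> * d / s) + k / s * (\<epsilon> * c / s) + l / s * (\<epsilon> * b / s)))
    \<le> s\<^sup>2 / \<epsilon> * (1 + (\<epsilon> * a / s)\<^sup>2 + (\<epsilon> * b / s)\<^sup>2 + (\<epsilon> * c / s)\<^sup>2 + (\<epsilon> * d / s)\<^sup>2
      + 2 * (- (k / s * (l / s) + (m / s)\<^sup>2)) * (\<epsilon> * a / s * (\<epsilon> * d / s) - \<epsilon> * b / s * (\<epsilon> * c / s)))"
    using s \<epsilon> by (intro mult_left_mono) auto
  also have "s\<^sup>2 / \<epsilon> * (2 * (m / s * (\<epsilon> * a / s - \<epsilon> * d / s) + k / s * (\<epsilon> * c / s) + l / s * (\<epsilon> * b / s)))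
      = 2 * (m * (a - d) + k * c + l * b)"
    using s(1) \<epsilon> by (simp add: field_simps power2_eq_square)
  also have "s\<^sup>2 / \<epsilon> * (1 + (\<epsilon> * a / s)\<^sup>2 + (\<epsilon> * b / s)\<^sup>2 + (\<epsilon> * c / s)\<^sup>2 + (\<epsilon> * d / s)\<^sup>2
      + 2 * (- (k / s * (l / s) + (m / s)\<^sup>2)) * (\<epsilon> * a / s * (\<epsilon> * d / s) - \<epsilon> * b / s * (\<epsilon> * c / s)))
     = s\<^sup>2 / \<epsilon> + \<epsilon> * (a\<^sup>2 + b\<^sup>2 + c\<^sup>2 + d\<^sup>2 + 2 * (- (k * l + m\<^sup>2) / s\<^sup>2) * (a * d - b * c))"
    using s(1) \<epsilon> by (simp add: field_simps power2_eq_square)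
  finally show ?th1 by (simp add: s(2))
qed

text \<open>A binary form whose diagonal entries and determinant are non-negative is non-negative,
  by the inequality of arithmetic and geometric means. This is applied to \<open>1 - S\<close> and
  \<open>1 + S\<close>, where \<open>S\<close> is the symmetric matrix of the form to be
  bounded.\<close>

lemma quadratic_form_bound:
  fixes i k l :: real
  assumes "\<bar>k\<bar> \<le> 1" "\<bar>l\<bar> \<le> 1" "i\<^sup>2 \<le> (1 + k) * (1 - l)" "i\<^sup>2 \<le> (1 - k) * (1 + l)"
  shows "\<bar>k * a\<^sup>2 - 2 * i * a * b - l * b\<^sup>2\<bar> \<le> a\<^sup>2 + b\<^sup>2"
proof -
  have nonneg: "0 \<le> x * a\<^sup>2 + 2 * j * a * b + y * b\<^sup>2" if "0 \<le> x" "0 \<le> y" "j\<^sup>2 \<le> x * y" for x y j :: real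
  proof -
    have "\<bar>j\<bar> \<le> sqrt x * sqrt y" using that by (metis real_sqrt_abs real_sqrt_le_mono real_sqrt_mult)
    then have "\<bar>j\<bar> * (\<bar>a\<bar> * \<bar>b\<bar>) \<le> (sqrt x * sqrt y) * (\<bar>a\<bar> * \<bar>b\<bar>)" by (intro mult_right_mono) auto
    moreover have "0 \<le> (sqrt x * \<bar>a\<bar> - sqrt y * \<bar>b\<bar>)\<^sup>2" by simp
    then have "2 * ((sqrt x * sqrt y) * (\<bar>a\<bar> * \<bar>b\<bar>)) \<le> x * a\<^sup>2 + y * b\<^sup>2"
      using that by (simp add: power2_diff power_mult_distrib algebra_simps)
    moreover have "- (j * a * b) \<le> \<bar>j\<bar> * (\<bar>a\<bar> * \<bar>b\<bar>)" by (metis abs_ge_minus_self abs_mult mult.assoc)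
    ultimately show ?thesis by linarith
  qed
  have "0 \<le> (1 - k) * a\<^sup>2 + 2 * i * a * b + (1 + l) * b\<^sup>2"
    by (rule nonneg) (use assms in auto)
  moreover have "0 \<le> (1 + k) * a\<^sup>2 + 2 * (- i) * a * b + (1 - l) * b\<^sup>2"
    by (rule nonneg) (use assms in auto)
  ultimately show ?thesis by (simp add: abs_le_iff algebra_simps)
qed


section \<open>Construction of the calibration\<close>

text \<open>With the trace-free part prescribed, one function \<open>\<gamma>\<close> is left to be
  found: the derivative has to have the rows \<open>(2 m - \<gamma>, k)\<close> and
  \<open>(l, - \<gamma>)\<close>. These rows are closed exactly if \<open>\<gamma>\<close> has the
  gradient given first in the proof, and \<open>pde\<close> says that this gradient is itself
  closed. The factor \<open>1 + \<delta>\<close> pays for the cutoff at large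
  \<open>y\<close>.\<close>

lemma calibration_exists:
  fixes W k l m :: "real^2 \<Rightarrow> real"
  assumes k: "C1_grad k k'" and l: "C1_grad l l'" and m: "C1_grad m m'"
    and k1: "C1_grad (\<lambda>x. k' x $ 1) k1'" and l2: "C1_grad (\<lambda>x. l' x $ 2) l2'"
    and m2: "C1_grad (\<lambda>x. m' x $ 2) m2'"
    and pde: "\<And>x. k1' x $ 1 = l2' x $ 2 + 2 * m2' x $ 1"
    and p: "p > 0" and c1: "c1 > 0" and c2: "c2 > 0"
    and W_lower: "\<And>y. c1 * norm y powr (2 * p) - 1 \<le> W y"
    and W_upper: "\<And>y. W y \<le> c2 * (norm y powr (2 * p) + 1)"
    and quad: "\<And>y a b. \<bar>k y * a\<^sup>2 - 2 * m y * a * b - l y * b\<^sup>2\<bar> \<le> sqrt (W y) * (a\<^sup>2 + b\<^sup>2)"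
    and \<delta>: "\<delta> > 0"
  obtains f f' g g' R where "C1_grad f f'" "C1_grad g g'" "R > 0"
    "\<And>y. norm y > R \<Longrightarrow> f y = 0" "\<And>y. norm y > R \<Longrightarrow> g y = 0"
    "\<And>y a b. \<bar>f' y $ 2 * a\<^sup>2 - (f' y $ 1 - g' y $ 2) * a * b - g' y $ 1 * b\<^sup>2\<bar>
       \<le> (1 + \<delta>) * sqrt (W y) * (a\<^sup>2 + b\<^sup>2)"
    "\<And>a b. a $ 1 = b $ 1 \<Longrightarrow> a $ 2 \<le> b $ 2 \<Longrightarrow> norm a \<le> R0 \<Longrightarrow> norm b \<le> R0 \<Longrightarrow>
       f b - f a = integral {a $ 2..b $ 2} (\<lambda>t. k (pair2 (a $ 1) t))"
proof -
  obtain \<gamma> where \<gamma>: "C1_grad \<gamma> (\<lambda>x. pair2 (- l' x $ 2) (2 * m' x $ 2 - k' x $ 1))"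
    using poincare_plane[OF C1_grad_minus[OF l2] C1_grad_diff[OF C1_grad_cmult[OF m2, of 2] k1]] pde by auto
  obtain F where F: "C1_grad F (\<lambda>x. pair2 (2 * m x - \<gamma> x) (k x))"
    using poincare_plane[OF C1_grad_diff[OF C1_grad_cmult[OF m, of 2] \<gamma>] k] by auto
  obtain G where G: "C1_grad G (\<lambda>x. pair2 (l x) (- \<gamma> x))"
    using poincare_plane[OF l C1_grad_minus[OF \<gamma>]] by auto
  have sqrtW: "sqrt (W y) \<le> sqrt c2 * (norm y powr p + 1)" for y
  proof -
    have "norm y powr (2 * p) + 1 \<le> (norm y powr p + 1)\<^sup>2"
      by (simp add: power2_eq_square algebra_simps flip: powr_add)
    then have "W y \<le> c2 * (norm y powr p + 1)\<^sup>2"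
      using W_upper[of y] c2 mult_left_mono[of _ _ c2] order_trans by fastforce
    then have "sqrt (W y) \<le> sqrt (c2 * (norm y powr p + 1)\<^sup>2)" by simp
    then show ?thesis by (simp add: real_sqrt_mult)
  qed
  have kb: "\<bar>k y\<bar> \<le> sqrt (W y)" and lb: "\<bar>l y\<bar> \<le> sqrt (W y)" and mb: "\<bar>2 * m y\<bar> \<le> 4 * sqrt (W y)" for y
    using quad[of y 1 0] quad[of y 0 1] quad[of y 1 1] by auto
  have W0: "0 \<le> sqrt (W y)" for y using kb[of y] by linarith
  \<comment> \<open>The form at \<open>(1, 1)\<close> bounds \<open>k - 2 m - l\<close> by
    \<open>2 * sqrt (W y)\<close>; the bounds for \<open>k\<close> and \<open>l\<close> add one
    each, whence the \<open>4\<close> in the bound for \<open>2 m\<close>.\<close>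
  define K where "K = 4 * sqrt c2"
  have KW: "4 * sqrt (W y) \<le> K * (norm y powr p + 1)" for y using sqrtW[of y] by (simp add: K_def mult.assoc)
  have bounds: "\<bar>pair2 (2 * m y - \<gamma> y) (k y) $ 2\<bar> \<le> K * (norm y powr p + 1)"
    "\<bar>pair2 (l y) (- \<gamma> y) $ 1\<bar> \<le> K * (norm y powr p + 1)"
    "\<bar>pair2 (2 * m y - \<gamma> y) (k y) $ 1 - pair2 (l y) (- \<gamma> y) $ 2\<bar> \<le> K * (norm y powr p + 1)" for y
    using kb[of y] lb[of y] mb[of y] KW[of y] W0[of y] by auto
  have K0: "K \<ge> 0" using c2 by (simp add: K_def)
  obtain C where C: "C \<ge> 0" "\<And>y. norm y \<ge> 1 \<Longrightarrow> \<bar>F y\<bar> \<le> C * norm y powr (p + 1)"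
    "\<And>y. norm y \<ge> 1 \<Longrightarrow> \<bar>G y\<bar> \<le> C * norm y powr (p + 1)"
    using traceless_growth[OF F G p K0 bounds] by blast
  \<comment> \<open>From the last of these radii on, \<open>c1 * norm y powr (2 * p)\<close> is at
    least \<open>2\<close>, so the \<open>- 1\<close> in \<open>W_lower\<close> costs at most half
    of it. The second radius keeps the prescribed end points where \<open>\<theta>\<close> is
    \<open>1\<close>, the first serves the growth bounds on \<open>F\<close> and
    \<open>G\<close>.\<close>
  define R1 where "R1 = max (max 1 (\<bar>R0\<bar> + 1)) ((2 / c1) powr (1 / (2 * p)))"
  have R1: "R1 \<ge> 1" "R0 < R1" by (auto simp: R1_def)
  define \<delta>' where "\<delta>' = \<delta> * sqrt (c1 / 2) / (2 * C + 1)"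
  have \<delta>': "\<delta>' > 0" "2 * C * \<delta>' \<le> \<delta> * sqrt (c1 / 2)"
  proof -
    show 1: "\<delta>' > 0" using \<delta> c1 C(1) by (simp add: \<delta>'_def)
    have "(2 * C + 1) * \<delta>' = \<delta> * sqrt (c1 / 2)" using C(1) by (simp add: \<delta>'_def)
    then show "2 * C * \<delta>' \<le> \<delta> * sqrt (c1 / 2)" using 1 by (simp add: distrib_right)
  qed
  obtain \<theta> \<theta>' R where \<theta>: "C1_grad \<theta> \<theta>'" "\<And>y. 0 \<le> \<theta> y" "\<And>y. \<theta> y \<le> 1" "R1 \<le> R"
    "\<And>y. norm y \<le> R1 \<Longrightarrow> \<theta> y = 1" "\<And>y. norm y > R \<Longrightarrow> \<theta> y = 0"
    "\<And>y. norm (\<theta>' y) * norm y \<le> \<delta>'"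
    by (rule log_cutoff[of R1 \<delta>']) (use R1 \<delta>' in auto)
  have \<theta>'0: "\<theta>' y = 0" if "norm y < R1" for y
  proof -
    have "\<theta>' y - 0 = 0"
      by (rule C1_grad_outside_support[OF C1_grad_diff[OF \<theta>(1) C1_grad_const[of 1]], where K="- ball 0 R1"])
        (use \<theta>(5) that in auto)
    then show ?thesis by simp
  qed
  let ?f' = "\<lambda>x. \<theta> x *\<^sub>R pair2 (2 * m x - \<gamma> x) (k x) + F x *\<^sub>R \<theta>' x"
  let ?g' = "\<lambda>x. \<theta> x *\<^sub>R pair2 (l x) (- \<gamma> x) + G x *\<^sub>R \<theta>' x"
  \<comment> \<open>\<open>F\<close> and \<open>G\<close> may exceed the order of
    \<open>sqrt (W y)\<close> by one power of \<open>norm y\<close>; the bound for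
    \<open>norm (\<theta>' y) * norm y\<close> absorbs exactly this power.\<close>
  have FG: "(\<bar>F y\<bar> + \<bar>G y\<bar>) * norm (\<theta>' y) \<le> \<delta> * sqrt (W y)" for y
  proof (cases "norm y < R1")
    case True then show ?thesis using \<theta>'0 \<delta> W0 by simp
  next
    case False
    then have y: "R1 \<le> norm y" "1 \<le> norm y" using R1 by auto
    have "(2 / c1) powr (1 / (2 * p)) \<le> norm y" using y by (simp add: R1_def)
    then have "((2 / c1) powr (1 / (2 * p))) powr (2 * p) \<le> norm y powr (2 * p)"
      using p by (intro powr_mono2) auto
    then have "2 / c1 \<le> norm y powr (2 * p)" using p c1 by (simp add: powr_powr)
    then have "c1 / 2 * norm y powr (2 * p) \<le> W y"
      using W_lower[of y] c1 by (simp add: field_simps)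
    then have "c1 / 2 * (norm y powr p)\<^sup>2 \<le> W y"
      by (simp add: power2_eq_square flip: powr_add)
    then have "sqrt (c1 / 2 * (norm y powr p)\<^sup>2) \<le> sqrt (W y)" by simp
    then have sW: "sqrt (c1 / 2) * norm y powr p \<le> sqrt (W y)" by (simp only: real_sqrt_mult) simp
    have "(\<bar>F y\<bar> + \<bar>G y\<bar>) * norm (\<theta>' y) \<le> (2 * C * norm y powr (p + 1)) * norm (\<theta>' y)"
      using C(2,3)[of y] y by (intro mult_right_mono) auto
    also have "\<dots> = 2 * C * norm y powr p * (norm (\<theta>' y) * norm y)"
      using y by (simp add: powr_add)
    also have "\<dots> \<le> 2 * C * norm y powr p * \<delta>'"
      using \<theta>(7) C(1) by (intro mult_left_mono) auto
    also have "\<dots> = (2 * C * \<delta>') * norm y powr p" by simp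
    also have "\<dots> \<le> (\<delta> * sqrt (c1 / 2)) * norm y powr p"
      using \<delta>'(2) by (intro mult_right_mono) auto
    also have "\<dots> \<le> \<delta> * sqrt (W y)" using sW \<delta> by simp
    finally show ?thesis .
  qed
  show ?thesis
  proof (rule that)
    show "C1_grad (\<lambda>x. \<theta> x * F x) ?f'" by (rule C1_grad_mult[OF \<theta>(1) F])
    show "C1_grad (\<lambda>x. \<theta> x * G x) ?g'" by (rule C1_grad_mult[OF \<theta>(1) G])
    show "R > 0" using \<theta>(4) R1 by linarith
    show "\<theta> y * F y = 0" "\<theta> y * G y = 0" if "norm y > R" for y using \<theta>(6)[OF that] by auto
    fix y a b
    define n where "n = norm (pair2 a b)"
    have n: "n\<^sup>2 = a\<^sup>2 + b\<^sup>2" "\<bar>a\<bar> \<le> n" "\<bar>b\<bar> \<le> n" "norm (pair2 (- b) a) = n"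
      using component_le_norm_cart[of "pair2 a b" 1] component_le_norm_cart[of "pair2 a b" 2]
      by (auto simp: n_def norm_sq_2 norm_eq_sqrt_inner inner_2 power2_eq_square add.commute)
    have n0: "n \<ge> 0" by (simp add: n_def)
    have "\<bar>F y * a + G y * b\<bar> \<le> \<bar>F y\<bar> * \<bar>a\<bar> + \<bar>G y\<bar> * \<bar>b\<bar>"
      by (metis abs_mult abs_triangle_ineq)
    also have "\<dots> \<le> \<bar>F y\<bar> * n + \<bar>G y\<bar> * n" using n by (intro add_mono mult_left_mono) auto
    finally have 1: "\<bar>F y * a + G y * b\<bar> \<le> (\<bar>F y\<bar> + \<bar>G y\<bar>) * n" by (simp add: distrib_right)
    have 2: "\<bar>\<theta>' y \<bullet> pair2 (- b) a\<bar> \<le> norm (\<theta>' y) * n"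
      using Cauchy_Schwarz_ineq2[of "\<theta>' y" "pair2 (- b) a"] n by simp
    have "\<bar>(F y * a + G y * b) * (\<theta>' y \<bullet> pair2 (- b) a)\<bar> \<le> ((\<bar>F y\<bar> + \<bar>G y\<bar>) * n) * (norm (\<theta>' y) * n)"
      unfolding abs_mult using 1 2 n0 by (intro mult_mono) auto
    also have "\<dots> = ((\<bar>F y\<bar> + \<bar>G y\<bar>) * norm (\<theta>' y)) * (a\<^sup>2 + b\<^sup>2)" unfolding n(1)[symmetric] by (simp add: power2_eq_square)
    also have "\<dots> \<le> (\<delta> * sqrt (W y)) * (a\<^sup>2 + b\<^sup>2)" using FG by (intro mult_right_mono) auto
    finally have 3: "\<bar>(F y * a + G y * b) * (\<theta>' y \<bullet> pair2 (- b) a)\<bar> \<le> \<delta> * sqrt (W y) * (a\<^sup>2 + b\<^sup>2)" .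
    have "\<bar>\<theta> y * (k y * a\<^sup>2 - 2 * m y * a * b - l y * b\<^sup>2)\<bar> \<le> 1 * (sqrt (W y) * (a\<^sup>2 + b\<^sup>2))"
      unfolding abs_mult using quad \<theta>(2,3) by (intro mult_mono) auto
    then have 4: "\<bar>\<theta> y * (k y * a\<^sup>2 - 2 * m y * a * b - l y * b\<^sup>2)\<bar> \<le> sqrt (W y) * (a\<^sup>2 + b\<^sup>2)" by simp
    \<comment> \<open>Differentiating the cutoff adds a rank-one matrix to the derivative, and the
      form of a rank-one matrix is a product of two linear factors.\<close>
    have "?f' y $ 2 * a\<^sup>2 - (?f' y $ 1 - ?g' y $ 2) * a * b - ?g' y $ 1 * b\<^sup>2
      = \<theta> y * (k y * a\<^sup>2 - 2 * m y * a * b - l y * b\<^sup>2) + (F y * a + G y * b) * (\<theta>' y \<bullet> pair2 (- b) a)"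
      by (simp add: inner_2 power2_eq_square algebra_simps)
    then show "\<bar>?f' y $ 2 * a\<^sup>2 - (?f' y $ 1 - ?g' y $ 2) * a * b - ?g' y $ 1 * b\<^sup>2\<bar>
        \<le> (1 + \<delta>) * sqrt (W y) * (a\<^sup>2 + b\<^sup>2)"
      using 3 4 by (simp add: algebra_simps)
  next
    fix a b :: "real^2" assume ab: "a $ 1 = b $ 1" "a $ 2 \<le> b $ 2" "norm a \<le> R0" "norm b \<le> R0"
    have "((\<lambda>t. k (pair2 (a $ 1) t)) has_integral F (pair2 (a $ 1) (b $ 2)) - F (pair2 (a $ 1) (a $ 2))) {a $ 2..b $ 2}"
    proof (rule fundamental_theorem_of_calculus[OF ab(2)])
      fix t
      have "((\<lambda>t. pair2 (a $ 1) t) has_derivative (\<lambda>h. pair2 0 h)) (at t within {a $ 2..b $ 2})"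
        by (rule has_derivative_pair2) auto
      from has_derivative_compose[OF this C1_grad_derivative[OF F, of "pair2 (a $ 1) t" UNIV]]
      show "((\<lambda>t. F (pair2 (a $ 1) t)) has_vector_derivative k (pair2 (a $ 1) t)) (at t within {a $ 2..b $ 2})"
        by (simp add: has_vector_derivative_def inner_2 mult.commute)
    qed
    moreover have "pair2 (a $ 1) (a $ 2) = a" "pair2 (a $ 1) (b $ 2) = b"
      using ab by (auto simp: vec_eq_iff forall_2)
    moreover have "\<theta> a = 1" "\<theta> b = 1" using ab R1 \<theta>(5) by auto
    ultimately show "\<theta> b * F b - \<theta> a * F a = integral {a $ 2..b $ 2} (\<lambda>t. k (pair2 (a $ 1) t))"
      by (simp add: integral_unique)
  qed
qed

section \<open>Null Lagrangians and smooth maps\<close>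

lemma C1_grad_real_polynomial:
  assumes "real_polynomial_function q"
  shows "\<exists>q'. C1_grad q q'"
  using assms
proof induction
  case (linear f)
  have "f h = (\<Sum>i\<in>Basis. f i *\<^sub>R i) \<bullet> h" for h
  proof -
    have "f h = f (\<Sum>i\<in>Basis. (h \<bullet> i) *\<^sub>R i)" by (simp add: euclidean_representation)
    also have "\<dots> = (\<Sum>i\<in>Basis. (h \<bullet> i) * f i)"
      using linear by (simp add: bounded_linear.linear linear_sum linear_scale)
    finally show ?thesis by (simp add: inner_sum_left inner_commute[of h] mult.commute)
  qed
  then have "f = (\<lambda>h. (\<Sum>i\<in>Basis. f i *\<^sub>R i) \<bullet> h)" by (rule ext)
  then have "C1_grad f (\<lambda>_. \<Sum>i\<in>Basis. f i *\<^sub>R i)"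
  proof (intro C1_gradI)
    fix x
    show "(f has_derivative (\<lambda>h. (\<Sum>i\<in>Basis. f i *\<^sub>R i) \<bullet> h)) (at x)"
      using bounded_linear_imp_has_derivative[OF linear, of "at x"] \<open>f = _\<close> by metis
  qed simp
  then show ?case by blast
next
  case (const c)
  show ?case using C1_grad_const by blast
next
  case (add f g)
  then show ?case using C1_grad_add by blast
next
  case (mult f g)
  then show ?case using C1_grad_mult by blast
qed

text \<open>\<open>G\<close> integrates \<open>q\<close> along the horizontal segment from the line
  \<open>y $ 1 = c\<close> to \<open>y\<close>, rescaled to the unit interval. The first component
  of the gradient of the integrand is the derivative in \<open>t\<close> of \<open>t\<close> times
  \<open>q\<close> on the segment.\<close>

lemma horizontal_antiderivative:
  assumes q: "C1_grad q q'"
  obtains G G' where "C1_grad G G'" "\<And>y. G' y $ 1 = q y" "\<And>s. G (pair2 c s) = 0"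
proof
  let ?P = "\<lambda>(y::real^2) t. pair2 (c + t * (y $ 1 - c)) (y $ 2)"
  let ?F' = "\<lambda>(y::real^2) t. (y $ 1 - c) *\<^sub>R (q' (?P y t) $ 1 *\<^sub>R (0 + t *\<^sub>R (axis 1 1 - 0)) + q' (?P y t) $ 2 *\<^sub>R axis 2 1)
      + q (?P y t) *\<^sub>R (axis 1 1 - 0) :: real^2"
  have cP: "continuous_on S (\<lambda>z. h (?P (x z) (t z)))"
    if "continuous_on UNIV h" "continuous_on S t" "continuous_on S x"
    for h :: "real^2 \<Rightarrow> 'b::topological_space" and x t and S :: "'c::topological_space set"
    by (rule continuous_on_compose2[OF that(1)]) (auto intro!: continuous_intros that)
  note cq = cP[OF C1_grad_continuous[OF q]] cP[OF C1_grad_continuous_grad[OF q]]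
  have c': "continuous_on (UNIV \<times> {0..1}) (\<lambda>(y, t). ?F' y t)"
    unfolding case_prod_beta by (intro continuous_intros cq)
  show G: "C1_grad (\<lambda>y. integral {0..1} (\<lambda>t. (y $ 1 - c) * q (?P y t))) (\<lambda>y. integral {0..1} (?F' y))"
  proof (rule C1_grad_integral[OF _ _ c'])
    show "C1_grad (\<lambda>y. (y $ 1 - c) * q (?P y t)) (\<lambda>y. ?F' y t)" for t
      by (intro C1_grad_mult C1_grad_diff C1_grad_component C1_grad_const C1_grad_compose_vec[OF q]
          C1_grad_add C1_grad_cmult)
    show "continuous_on {0..1} (\<lambda>t. (y $ 1 - c) * q (?P y t))" for y
      by (intro continuous_intros cq)
  qed
  show "integral {0..1} (?F' y) $ 1 = q y" for y
  proof -
    have i: "?F' y integrable_on {0..1}"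
      by (rule integrable_continuous_real) (rule continuous_on_section[OF c'])
    have e1: "integral {0..1} (?F' y) $ 1 = integral {0..1} (\<lambda>t. ?F' y t $ 1)"
      by (rule integral_component_eq_cart[OF i, symmetric])
    have e2: "(\<lambda>t. ?F' y t $ 1) = (\<lambda>t. q (?P y t) + t * (q' (?P y t) $ 1 * (y $ 1 - c)))"
      by (simp add: axis_def fun_eq_iff)
    have e3: "((\<lambda>t. q (?P y t) + t * (q' (?P y t) $ 1 * (y $ 1 - c))) has_integral
        1 * q (?P y 1) - 0 * q (?P y 0)) {0..1}"
    proof (rule fundamental_theorem_of_calculus)
      fix t :: real
      have "((\<lambda>t. ?P y t) has_derivative (\<lambda>h. pair2 (h * (y $ 1 - c)) 0)) (at t within {0..1})"
        by (rule has_derivative_pair2) (auto intro!: derivative_eq_intros)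
      from has_derivative_compose[OF this C1_grad_derivative[OF q, of "?P y t" UNIV]]
      have "((\<lambda>t. q (?P y t)) has_real_derivative q' (?P y t) $ 1 * (y $ 1 - c)) (at t within {0..1})"
        by (simp add: has_field_derivative_def inner_2 mult_ac mult_commute_abs)
      then show "((\<lambda>t. t * q (?P y t)) has_vector_derivative
          q (?P y t) + t * (q' (?P y t) $ 1 * (y $ 1 - c))) (at t within {0..1})"
        by (auto simp flip: has_real_derivative_iff_has_vector_derivative intro!: derivative_eq_intros)
    qed simp
    have "?P y 1 = y" by (simp add: vec_eq_iff forall_2)
    then show ?thesis unfolding e1 e2 integral_unique[OF e3] by simp
  qed
  show "integral {0..1} (\<lambda>t. (pair2 c s $ 1 - c) * q (?P (pair2 c s) t)) = 0" for s by simp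
qed

lemma integrable_cutoff_mult:
  fixes h :: "real^2 \<Rightarrow> real"
  assumes "continuous_on UNIV z" "\<And>x. norm x > r \<Longrightarrow> z x = 0" "continuous_on UNIV h"
  shows "integrable lborel (\<lambda>x. z x * h x)"
  by (rule integrable_continuous_compact_support[of _ "cball 0 r"]) (use assms in \<open>auto intro!: continuous_intros\<close>)

lemma integrable_gradient:
  assumes f: "C1_grad f f'" and r: "\<And>x. norm x > r \<Longrightarrow> f x = 0"
  shows "integrable lborel (\<lambda>x. f' x $ i)"
proof (rule integrable_continuous_compact_support[of _ "cball 0 r"])
  show "continuous_on UNIV (\<lambda>x. f' x $ i)"
    by (rule continuous_on_component[OF C1_grad_continuous_grad[OF f]])
  show "f' x $ i = 0" if "x \<notin> cball 0 r" for x
    using C1_grad_outside_support[OF f, of "cball 0 r" x] r that by simp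
qed simp

text \<open>If \<open>\<partial>\<^sub>1 G = g\<close>, then \<open>g(v) det Dv = \<partial>\<^sub>1(G(v) \<partial>\<^sub>2 v\<^sub>2) - \<partial>\<^sub>2(G(v) \<partial>\<^sub>1 v\<^sub>2)\<close>, so that integration by
  parts moves all derivatives of \<open>G(v)\<close> to \<open>z\<close>. Only the bounds on \<open>g\<close> enter, not its modulus of
  continuity, hence \<open>g\<close> may be replaced by a polynomial.\<close>

lemma det_term_bound:
  assumes z: "C1_grad z z'" and zr: "\<And>x. norm x > r \<Longrightarrow> z x = 0"
    and v1: "C1_grad v1 a" and v2: "C1_grad v2 b"
    and b1: "C1_grad (\<lambda>x. b x $ 1) b1'" and b2: "C1_grad (\<lambda>x. b x $ 2) b2'"
    and sym: "\<And>x. b1' x $ 2 = b2' x $ 1"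
    and g: "continuous_on UNIV g" and g1: "\<And>y. \<bar>g y\<bar> \<le> 1" and gR: "\<And>y. \<bar>y $ 1\<bar> \<ge> R \<Longrightarrow> g y = 0" and R: "R > 0"
  shows "\<bar>\<integral>x. z x * (g (pair2 (v1 x) (v2 x)) * (a x $ 1 * b x $ 2 - a x $ 2 * b x $ 1)) \<partial>lborel\<bar>
    \<le> 4 * R * (\<integral>x. norm (z' x) * norm (b x) \<partial>lborel)"
proof -
  define v where "v x = pair2 (v1 x) (v2 x)" for x
  define D where "D x = a x $ 1 * b x $ 2 - a x $ 2 * b x $ 1" for x
  have zc: "continuous_on UNIV z" by (rule C1_grad_continuous[OF z])
  have vc: "continuous_on UNIV v"
    unfolding v_def by (intro continuous_intros C1_grad_continuous[OF v1] C1_grad_continuous[OF v2])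
  have Dc: "continuous_on UNIV D"
    unfolding D_def by (intro continuous_intros C1_grad_continuous_grad[OF v1] C1_grad_continuous_grad[OF v2])
  have z'r: "z' x = 0" if "norm x > r" for x
    by (rule C1_grad_outside_support[OF z, of "cball 0 r"]) (use zr that in auto)
  have "compact (v ` cball 0 r)"
    by (rule compact_continuous_image) (use vc in \<open>auto intro: continuous_on_subset\<close>)
  then obtain M0 where M0: "\<And>x. norm x \<le> r \<Longrightarrow> norm (v x) \<le> M0"
    using compact_imp_bounded by (force simp: bounded_iff)
  define M where "M = max M0 R"
  have M: "\<And>x. norm x \<le> r \<Longrightarrow> norm (v x) \<le> M" "R \<le> M" using M0 by (auto simp: M_def le_max_iff_disj)
  \<comment> \<open>\<open>M\<close> bounds both \<open>R\<close> and the values of \<open>v\<close>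
    on the support of \<open>z\<close>. A ball of radius \<open>2 * M\<close> therefore contains the
    horizontal segments from these values to the lines \<open>y $ 1 = R\<close> and
    \<open>y $ 1 = - R\<close>.\<close>
  define S where "S = cball (0::real^2) (2 * M)"
  let ?J = "\<integral>x. norm (z' x) * norm (b x) \<partial>lborel"
  let ?I = "\<integral>x. z x * (g (v x) * D x) \<partial>lborel"
  have int_zD: "integrable lborel (\<lambda>x. \<bar>z x * D x\<bar>)"
    using integrable_cutoff_mult[OF zc zr Dc] by auto
  have iJ: "integrable lborel (\<lambda>x. norm (z' x) * norm (b x))"
    by (rule integrable_cutoff_mult[of _ r])
     (use z'r in \<open>auto intro!: continuous_intros C1_grad_continuous_grad[OF z] C1_grad_continuous_grad[OF v2]\<close>)
  have main: "\<bar>?I\<bar> \<le> 4 * R * ?J + e * (\<integral>x. \<bar>z x * D x\<bar> \<partial>lborel)"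
    if e: "e > 0" "e \<le> 1 / 2" "e * (M + R) \<le> R" for e
  proof -
    obtain q where q: "real_polynomial_function q" "\<And>y. y \<in> S \<Longrightarrow> \<bar>g y - q y\<bar> < e"
      by (rule Stone_Weierstrass_real_polynomial_function[of S g e])
        (use g e in \<open>auto simp: S_def intro: continuous_on_subset\<close>)
    obtain q' where q': "C1_grad q q'" using C1_grad_real_polynomial[OF q(1)] by blast
    obtain G G' where G: "C1_grad G G'" "\<And>y. G' y $ 1 = q y" "\<And>s. G (pair2 (- R) s) = 0"
      using horizontal_antiderivative[OF q', of "- R"] by blast
    have vS: "v x \<in> S" if "norm x \<le> r" for x
      using M(1)[OF that] M(2) R by (simp add: S_def)
    have hor: "\<bar>G (pair2 s' t) - G (pair2 s t)\<bar> \<le> B * \<bar>s' - s\<bar>"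
      if st: "\<bar>s\<bar> \<le> M" "\<bar>s'\<bar> \<le> M" "\<bar>t\<bar> \<le> M" and B: "\<And>y. y \<in> S \<Longrightarrow> min s s' \<le> y $ 1 \<Longrightarrow> y $ 1 \<le> max s s' \<Longrightarrow> \<bar>q y\<bar> \<le> B" for s s' t B
    proof (rule C1_grad_mvt_directional[OF G(1)])
      fix y assume y: "y \<in> closed_segment (pair2 s t) (pair2 s' t)"
      have n: "norm (pair2 s t) \<le> 2 * M" "norm (pair2 s' t) \<le> 2 * M"
        using norm_le_components_2[of "pair2 s t"] norm_le_components_2[of "pair2 s' t"] st by auto
      have yS: "y \<in> S" using norm_closed_segment_le[OF y n] by (simp add: S_def)
      obtain u where u: "0 \<le> u" "u \<le> 1" "y = (1 - u) *\<^sub>R pair2 s t + u *\<^sub>R pair2 s' t"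
        using y by (auto simp: closed_segment_def)
      have y1: "y $ 1 = (1 - u) * s + u * s'" using u by simp
      have "y $ 1 \<in> closed_segment s s'" unfolding closed_segment_def y1 using u by auto
      then have "min s s' \<le> y $ 1" "y $ 1 \<le> max s s'" by (auto simp: closed_segment_eq_real_ivl split: if_splits)
      then have "\<bar>q y\<bar> \<le> B" using B yS by blast
      then show "\<bar>G' y \<bullet> (pair2 s' t - pair2 s t)\<bar> \<le> B * \<bar>s' - s\<bar>"
        using G(2)[of y] by (simp add: inner_2 abs_mult mult_right_mono)
    qed
    \<comment> \<open>\<open>G\<close> vanishes on the line \<open>y $ 1 = - R\<close>. To the left
      of it \<open>q\<close> is at most \<open>e\<close>; across the strip \<open>q\<close> is at
      most \<open>3 / 2\<close>, which contributes at most \<open>3 * R\<close>; to the right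
      \<open>q\<close> is again at most \<open>e\<close>, and the choice of \<open>e\<close> limits
      this contribution to \<open>R\<close>. The result does not depend on \<open>M\<close>.\<close>
    have Gb: "\<bar>G (v x)\<bar> \<le> 4 * R" if x: "norm x \<le> r" for x
    proof -
      define s where "s = v x $ 1"
      define t where "t = v x $ 2"
      have vx: "v x = pair2 s t" by (simp add: s_def t_def vec_eq_iff forall_2)
      have st: "\<bar>s\<bar> \<le> M" "\<bar>t\<bar> \<le> M"
        using M(1)[OF x] component_le_norm_cart[of "v x" 1] component_le_norm_cart[of "v x" 2]
        by (auto simp: s_def t_def)
      have RM: "\<bar>R\<bar> \<le> M" "\<bar>- R\<bar> \<le> M" using R M(2) by auto
      have qe: "\<bar>q y\<bar> \<le> e" if "y \<in> S" "\<bar>y $ 1\<bar> \<ge> R" for y using q(2)[OF that(1)] gR[OF that(2)] by simp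
      have q2: "\<bar>q y\<bar> \<le> 3 / 2" if "y \<in> S" for y using q(2)[OF that] g1[of y] e by linarith
      consider "s < - R" | "- R \<le> s" "s \<le> R" | "R < s" by linarith
      then show ?thesis
      proof cases
        case 1
        have "\<bar>G (pair2 s t) - G (pair2 (- R) t)\<bar> \<le> e * \<bar>s - - R\<bar>"
          using st RM 1 R by (intro hor qe) auto
        also have "\<dots> \<le> e * (M + R)" using e st R by (intro mult_left_mono) auto
        also have "\<dots> \<le> 4 * R" using e R by linarith
        finally show ?thesis using G(3) vx by simp
      next
        case 2
        have "\<bar>G (pair2 s t) - G (pair2 (- R) t)\<bar> \<le> 3 / 2 * \<bar>s - - R\<bar>"
          using st RM by (intro hor q2) auto
        then show ?thesis using G(3) vx 2 by simp
      next
        case 3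
        have "\<bar>G (pair2 s t) - G (pair2 R t)\<bar> \<le> e * \<bar>s - R\<bar>"
          using st RM 3 R by (intro hor qe) auto
        also have "\<dots> \<le> e * (M + R)" using e st R by (intro mult_left_mono) auto
        also have "\<dots> \<le> R" using e by simp
        finally have "\<bar>G (pair2 s t) - G (pair2 R t)\<bar> \<le> R" .
        moreover have "\<bar>G (pair2 R t) - G (pair2 (- R) t)\<bar> \<le> 3 / 2 * \<bar>R - - R\<bar>"
          using st RM by (intro hor q2) auto
        ultimately show ?thesis using G(3) vx R by simp
      qed
    qed
    have Gv: "C1_grad (\<lambda>x. G (v x)) (\<lambda>x. G' (v x) $ 1 *\<^sub>R a x + G' (v x) $ 2 *\<^sub>R b x)"
      unfolding v_def by (rule C1_grad_compose_vec[OF G(1) v1 v2])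
    note zG = C1_grad_mult[OF z Gv]
    note F1 = C1_grad_mult[OF zG b2]
    note F2 = C1_grad_mult[OF zG b1]
    let ?F1' = "\<lambda>x. (z x * G (v x)) *\<^sub>R b2' x + b x $ 2 *\<^sub>R (z x *\<^sub>R (G' (v x) $ 1 *\<^sub>R a x + G' (v x) $ 2 *\<^sub>R b x) + G (v x) *\<^sub>R z' x)"
    let ?F2' = "\<lambda>x. (z x * G (v x)) *\<^sub>R b1' x + b x $ 1 *\<^sub>R (z x *\<^sub>R (G' (v x) $ 1 *\<^sub>R a x + G' (v x) $ 2 *\<^sub>R b x) + G (v x) *\<^sub>R z' x)"
    have I1: "(\<integral>x. ?F1' x $ 1 \<partial>lborel) = 0"
      by (rule integral_gradient_eq_0[OF F1, of "cball 0 r"]) (use zr in auto)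
    have I2: "(\<integral>x. ?F2' x $ 2 \<partial>lborel) = 0"
      by (rule integral_gradient_eq_0[OF F2, of "cball 0 r"]) (use zr in auto)
    have i1: "integrable lborel (\<lambda>x. ?F1' x $ 1)"
      by (rule integrable_gradient[OF F1]) (use zr in auto)
    have i2: "integrable lborel (\<lambda>x. ?F2' x $ 2)"
      by (rule integrable_gradient[OF F2]) (use zr in auto)
    let ?X = "\<lambda>x. z' x $ 1 * b x $ 2 - z' x $ 2 * b x $ 1"
    \<comment> \<open>The second derivatives of \<open>v2\<close> cancel by \<open>sym\<close>, and
      the terms with \<open>G' (v x) $ 2\<close> cancel because both carry the factor
      \<open>b x $ 1 * b x $ 2\<close>.\<close>
    have id: "?F1' x $ 1 - ?F2' x $ 2 = z x * (q (v x) * D x) + G (v x) * ?X x" for x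
      by (simp add: sym G(2) D_def algebra_simps)
    have qc: "continuous_on UNIV (\<lambda>x. q (v x))"
      by (rule continuous_on_compose2[OF C1_grad_continuous[OF q'] vc]) auto
    have iq: "integrable lborel (\<lambda>x. z x * (q (v x) * D x))"
      by (rule integrable_cutoff_mult[OF zc zr]) (auto intro!: continuous_intros qc Dc)
    have iG: "integrable lborel (\<lambda>x. G (v x) * ?X x)"
    proof -
      have "integrable lborel (\<lambda>x. (?F1' x $ 1 - ?F2' x $ 2) - z x * (q (v x) * D x))"
        by (intro Bochner_Integration.integrable_diff i1 i2 iq)
      then show ?thesis unfolding id by simp
    qed
    have "0 = (\<integral>x. ?F1' x $ 1 - ?F2' x $ 2 \<partial>lborel)"
      using I1 I2 Bochner_Integration.integral_diff[OF i1 i2] by simp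
    also have "\<dots> = (\<integral>x. z x * (q (v x) * D x) \<partial>lborel) + (\<integral>x. G (v x) * ?X x \<partial>lborel)"
      unfolding id by (rule Bochner_Integration.integral_add[OF iq iG])
    finally have "(\<integral>x. z x * (q (v x) * D x) \<partial>lborel) = - (\<integral>x. G (v x) * ?X x \<partial>lborel)" by simp
    moreover have "\<bar>\<integral>x. G (v x) * ?X x \<partial>lborel\<bar> \<le> (\<integral>x. 4 * R * (norm (z' x) * norm (b x)) \<partial>lborel)"
    proof (rule integral_norm_bound[THEN order_trans, of lborel "\<lambda>x. G (v x) * ?X x", unfolded real_norm_def], rule integral_mono)
      show "integrable lborel (\<lambda>x. \<bar>G (v x) * ?X x\<bar>)" using iG by auto
      show "integrable lborel (\<lambda>x. 4 * R * (norm (z' x) * norm (b x)))" using iJ by auto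
      fix x
      have "\<bar>z' x \<bullet> pair2 (b x $ 2) (- b x $ 1)\<bar> \<le> norm (z' x) * norm (pair2 (b x $ 2) (- b x $ 1))"
        by (rule Cauchy_Schwarz_ineq2)
      also have "norm (pair2 (b x $ 2) (- b x $ 1)) = norm (b x)"
        by (simp add: norm_eq_sqrt_inner inner_2 add.commute)
      finally have X: "\<bar>?X x\<bar> \<le> norm (z' x) * norm (b x)" by (simp add: inner_2)
      show "\<bar>G (v x) * ?X x\<bar> \<le> 4 * R * (norm (z' x) * norm (b x))"
      proof (cases "norm x \<le> r")
        case True
        show ?thesis unfolding abs_mult using Gb[OF True] X R by (intro mult_mono) auto
      next
        case False then show ?thesis using z'r[of x] by simp
      qed
    qed
    ultimately have A: "\<bar>\<integral>x. z x * (q (v x) * D x) \<partial>lborel\<bar> \<le> 4 * R * ?J" by simp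
    have gc: "continuous_on UNIV (\<lambda>x. g (v x))" by (rule continuous_on_compose2[OF g vc]) auto
    have ig: "integrable lborel (\<lambda>x. z x * (g (v x) * D x))"
      by (rule integrable_cutoff_mult[OF zc zr]) (auto intro!: continuous_intros gc Dc)
    have "?I - (\<integral>x. z x * (q (v x) * D x) \<partial>lborel) = (\<integral>x. z x * (g (v x) * D x) - z x * (q (v x) * D x) \<partial>lborel)"
      by (rule Bochner_Integration.integral_diff[OF ig iq, symmetric])
    also have "\<bar>\<dots>\<bar> \<le> (\<integral>x. e * \<bar>z x * D x\<bar> \<partial>lborel)"
    proof (rule integral_norm_bound[THEN order_trans, of lborel "\<lambda>x. z x * (g (v x) * D x) - z x * (q (v x) * D x)", unfolded real_norm_def], rule integral_mono)
      show "integrable lborel (\<lambda>x. \<bar>z x * (g (v x) * D x) - z x * (q (v x) * D x)\<bar>)"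
        using Bochner_Integration.integrable_diff[OF ig iq] by auto
      show "integrable lborel (\<lambda>x. e * \<bar>z x * D x\<bar>)" using int_zD by auto
      fix x
      have "\<bar>z x * (g (v x) * D x) - z x * (q (v x) * D x)\<bar> = \<bar>g (v x) - q (v x)\<bar> * \<bar>z x * D x\<bar>"
        by (simp flip: abs_mult add: algebra_simps)
      also have "\<dots> \<le> e * \<bar>z x * D x\<bar>"
        using q(2)[OF vS, of x] zr[of x] by (cases "norm x \<le> r") (auto intro!: mult_right_mono)
      finally show "\<bar>z x * (g (v x) * D x) - z x * (q (v x) * D x)\<bar> \<le> e * \<bar>z x * D x\<bar>" .
    qed
    finally show ?thesis using A by simp
  qed
  have "\<bar>?I\<bar> \<le> 4 * R * ?J"
  proof (rule field_le_epsilon)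
    fix \<eta> :: real assume \<eta>: "\<eta> > 0"
    define L where "L = (\<integral>x. \<bar>z x * D x\<bar> \<partial>lborel)"
    have L: "L \<ge> 0" by (simp add: L_def)
    \<comment> \<open>The three entries bound \<open>q\<close> by \<open>3 / 2\<close>, limit the
      contribution from outside the strip to \<open>R\<close>, and make the approximation error at
      most \<open>\<eta>\<close>.\<close>
    define e where "e = min (1 / 2) (min (R / (M + R)) (\<eta> / (L + 1)))"
    have MR: "M + R > 0" using M R by simp
    have "e > 0" unfolding e_def using MR R L \<eta> by (simp add: add_nonneg_pos)
    moreover have "e \<le> 1 / 2" unfolding e_def by (rule min.cobounded1)
    moreover have "e \<le> R / (M + R)" unfolding e_def by (intro min.coboundedI2 min.cobounded1)
    then have "e * (M + R) \<le> R" using MR by (simp add: pos_le_divide_eq)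
    ultimately have "\<bar>?I\<bar> \<le> 4 * R * ?J + e * L" unfolding L_def by (rule main)
    moreover have "e \<le> \<eta> / (L + 1)" unfolding e_def by (intro min.coboundedI2 min.cobounded2)
    then have "e * (L + 1) \<le> \<eta>" using L by (simp add: pos_le_divide_eq add_nonneg_pos)
    then have "e * L \<le> \<eta>" using \<open>e > 0\<close> by (simp add: distrib_left)
    ultimately show "\<bar>?I\<bar> \<le> 4 * R * ?J + \<eta>" by linarith
  qed
  then show ?thesis by (simp add: v_def D_def)
qed


text \<open>The divergence of \<open>z \<Phi>(v)\<close> has integral zero, so the left side is the
  integral of \<open>z div \<Phi>(v)\<close>, to which the pointwise inequality applies. The trace
  of the derivative of \<open>\<Phi>\<close> meets only \<open>div v\<close> and yields the term
  with \<open>A\<close>; the determinant term is left to \<open>det_term_bound\<close>, which asks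
  nothing of its coefficient beyond continuity, size and support.\<close>

lemma smooth_energy_bound:
  assumes f: "C1_grad f f'" and g: "C1_grad g g'" and R: "R > 0"
    and fR: "\<And>y. norm y > R \<Longrightarrow> f y = 0" and gR: "\<And>y. norm y > R \<Longrightarrow> g y = 0"
    and V: "continuous_on UNIV V" "\<And>y. 0 \<le> V y"
    and quad: "\<And>y a b. \<bar>f' y $ 2 * a\<^sup>2 - (f' y $ 1 - g' y $ 2) * a * b - g' y $ 1 * b\<^sup>2\<bar> \<le> sqrt (V y) * (a\<^sup>2 + b\<^sup>2)"
    and A: "\<And>y. \<bar>f' y $ 1 + g' y $ 2\<bar> \<le> 2 * A"
    and z: "C1_grad z z'" and zr: "\<And>x. norm x > r \<Longrightarrow> z x = 0" and z0: "\<And>x. 0 \<le> z x"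
    and v1: "C1_grad v1 a" and v2: "C1_grad v2 b"
    and b1: "C1_grad (\<lambda>x. b x $ 1) b1'" and b2: "C1_grad (\<lambda>x. b x $ 2) b2'"
    and sym: "\<And>x. b1' x $ 2 = b2' x $ 1"
    and \<epsilon>: "\<epsilon> > 0"
  shows "- (\<integral>x. f (pair2 (v1 x) (v2 x)) * z' x $ 1 + g (pair2 (v1 x) (v2 x)) * z' x $ 2 \<partial>lborel)
    \<le> (\<integral>x. z x * (V (pair2 (v1 x) (v2 x)) / \<epsilon> + \<epsilon> * ((norm (a x))\<^sup>2 + (norm (b x))\<^sup>2)) \<partial>lborel) / 2
      + A * (\<integral>x. z x * \<bar>a x $ 1 + b x $ 2\<bar> \<partial>lborel)
      + \<epsilon> * (4 * (R + 1) * (\<integral>x. norm (z' x) * norm (b x) \<partial>lborel))"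
    (is "?L \<le> ?E / 2 + A * ?T + \<epsilon> * ?J")
proof (rule field_le_epsilon)
  fix \<eta>0 :: real assume \<eta>0: "\<eta>0 > 0"
  define v where "v x = pair2 (v1 x) (v2 x)" for x
  have zc: "continuous_on UNIV z" by (rule C1_grad_continuous[OF z])
  have vc: "continuous_on UNIV v"
    unfolding v_def by (intro continuous_intros C1_grad_continuous[OF v1] C1_grad_continuous[OF v2])
  note ac = C1_grad_continuous_grad[OF v1, of UNIV]
  note bc = C1_grad_continuous_grad[OF v2, of UNIV]
  have comp: "continuous_on UNIV (\<lambda>x. h (v x))" if "continuous_on UNIV h" for h :: "real^2 \<Rightarrow> 'b::topological_space"
    by (rule continuous_on_compose2[OF that vc]) auto
  define Z where "Z = (\<integral>x. z x \<partial>lborel)"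
  have zi: "integrable lborel z"
    by (rule integrable_continuous_compact_support[OF zc, of "cball 0 r"]) (use zr in auto)
  have Z: "Z \<ge> 0" unfolding Z_def using z0 by (intro integral_nonneg_AE) auto
  define Y where "Y = Z + 1"
  have Y: "Y > 0" "Z \<le> Y" using Z by (auto simp: Y_def)
  \<comment> \<open>\<open>V\<close> may vanish. Adding \<open>\<eta>\<close> makes the denominator
    of \<open>c0\<close> positive, hence \<open>c0\<close> continuous, and supplies the strict
    inequality that \<open>pointwise_calibration\<close> requires. The price is
    \<open>\<eta> / \<epsilon> / 2 * Z\<close>, which is at most \<open>\<eta>0\<close>.\<close>
  define \<eta> where "\<eta> = \<eta>0 * \<epsilon> * 2 / Y"
  have \<eta>: "\<eta> > 0" unfolding \<eta>_def using \<eta>0 \<epsilon> Y by (auto intro!: divide_pos_pos)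
  define \<Omega> where "\<Omega> y = V y + \<eta>" for y
  have \<Omega>: "\<Omega> y > 0" "(sqrt (V y))\<^sup>2 < \<Omega> y" for y using V(2)[of y] \<eta> by (auto simp: \<Omega>_def)
  define k where "k y = f' y $ 2" for y
  define l where "l y = g' y $ 1" for y
  define m where "m y = (f' y $ 1 - g' y $ 2) / 2" for y
  define c0 where "c0 y = - (k y * l y + (m y)\<^sup>2) / \<Omega> y" for y
  have c0c: "continuous_on UNIV c0"
    unfolding c0_def k_def l_def m_def \<Omega>_def
    by (intro continuous_intros C1_grad_continuous_grad[OF f] C1_grad_continuous_grad[OF g] V(1))
      (use \<Omega>(1) in \<open>auto simp: \<Omega>_def less_imp_neq[symmetric]\<close>)
  have quad': "\<bar>k y * a\<^sup>2 - 2 * m y * a * b - l y * b\<^sup>2\<bar> \<le> sqrt (V y) * (a\<^sup>2 + b\<^sup>2)" for y a b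
  proof -
    have "2 * m y = f' y $ 1 - g' y $ 2" by (simp add: m_def)
    then show ?thesis using quad[of y a b] unfolding k_def l_def by (simp only:)
  qed
  have c01: "\<bar>c0 y\<bar> \<le> 1" for y
    unfolding c0_def by (rule pointwise_calibration(2)[OF quad' \<Omega>(2) \<epsilon>])
  have f'0: "f' y = 0" "g' y = 0" if "norm y > R" for y
    using C1_grad_outside_support[OF f, of "cball 0 R" y] C1_grad_outside_support[OF g, of "cball 0 R" y] fR gR that
    by auto
  \<comment> \<open>The radius is \<open>R + 1\<close> since \<open>f'0\<close> holds for norms
    strictly above \<open>R\<close>, while \<open>det_term_bound\<close> asks for vanishing on a set
    given by a weak inequality.\<close>
  have c0R: "c0 y = 0" if "\<bar>y $ 1\<bar> \<ge> R + 1" for y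
    using f'0[of y] component_le_norm_cart[of y 1] that by (simp add: c0_def k_def l_def m_def)
  let ?D = "\<lambda>x. a x $ 1 * b x $ 2 - a x $ 2 * b x $ 1"
  let ?N = "\<lambda>x. (norm (a x))\<^sup>2 + (norm (b x))\<^sup>2"
  have det: "\<bar>\<integral>x. z x * (c0 (v x) * ?D x) \<partial>lborel\<bar> \<le> ?J"
    unfolding v_def using R by (intro det_term_bound[OF z zr v1 v2 b1 b2 sym c0c c01 c0R]) auto
  have Dc: "continuous_on UNIV (\<lambda>x. c0 (v x) * ?D x)"
    by (intro continuous_on_mult comp[OF c0c] continuous_on_diff continuous_on_component ac bc)
  have Nc: "continuous_on UNIV ?N" by (intro continuous_intros ac bc)
  have Tc: "continuous_on UNIV (\<lambda>x. \<bar>a x $ 1 + b x $ 2\<bar>)" by (intro continuous_intros ac bc)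
  have iz: "integrable lborel (\<lambda>x. z x * h x)" if "continuous_on UNIV h" for h :: "real^2 \<Rightarrow> real"
    by (rule integrable_cutoff_mult[of z r h]) (use zc zr that in auto)
  have iE: "integrable lborel (\<lambda>x. z x * (V (v x) / \<epsilon> + \<epsilon> * ?N x))"
  proof (rule iz)
    show "continuous_on UNIV (\<lambda>x. V (v x) / \<epsilon> + \<epsilon> * ?N x)"
      by (intro continuous_on_add continuous_on_divide continuous_on_mult continuous_on_const comp[OF V(1)] Nc)
        (use \<epsilon> in auto)
  qed
  have iD: "integrable lborel (\<lambda>x. z x * (c0 (v x) * ?D x))" by (rule iz[OF Dc])
  have iT: "integrable lborel (\<lambda>x. z x * \<bar>a x $ 1 + b x $ 2\<bar>)" by (rule iz[OF Tc])

  have fv: "C1_grad (\<lambda>x. f (v x)) (\<lambda>x. f' (v x) $ 1 *\<^sub>R a x + f' (v x) $ 2 *\<^sub>R b x)"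
    unfolding v_def by (rule C1_grad_compose_vec[OF f v1 v2])
  have gv: "C1_grad (\<lambda>x. g (v x)) (\<lambda>x. g' (v x) $ 1 *\<^sub>R a x + g' (v x) $ 2 *\<^sub>R b x)"
    unfolding v_def by (rule C1_grad_compose_vec[OF g v1 v2])
  let ?fv' = "\<lambda>x. f' (v x) $ 1 *\<^sub>R a x + f' (v x) $ 2 *\<^sub>R b x"
  let ?gv' = "\<lambda>x. g' (v x) $ 1 *\<^sub>R a x + g' (v x) $ 2 *\<^sub>R b x"
  have S1: "(\<integral>x. (z x *\<^sub>R ?fv' x + f (v x) *\<^sub>R z' x) $ 1 \<partial>lborel) = 0"
    by (rule integral_gradient_eq_0[OF C1_grad_mult[OF z fv], of "cball 0 r"]) (use zr in auto)
  have S2: "(\<integral>x. (z x *\<^sub>R ?gv' x + g (v x) *\<^sub>R z' x) $ 2 \<partial>lborel) = 0"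
    by (rule integral_gradient_eq_0[OF C1_grad_mult[OF z gv], of "cball 0 r"]) (use zr in auto)
  have j1: "integrable lborel (\<lambda>x. (z x *\<^sub>R ?fv' x + f (v x) *\<^sub>R z' x) $ 1)"
    by (rule integrable_gradient[OF C1_grad_mult[OF z fv]]) (use zr in auto)
  have j2: "integrable lborel (\<lambda>x. (z x *\<^sub>R ?gv' x + g (v x) *\<^sub>R z' x) $ 2)"
    by (rule integrable_gradient[OF C1_grad_mult[OF z gv]]) (use zr in auto)
  have j3: "integrable lborel (\<lambda>x. z x * (?fv' x $ 1 + ?gv' x $ 2))"
    by (intro iz continuous_intros C1_grad_continuous_grad[OF fv] C1_grad_continuous_grad[OF gv])
  have "?L = (\<integral>x. z x * (?fv' x $ 1 + ?gv' x $ 2) \<partial>lborel)"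
  proof -
    have eq: "f (v x) * z' x $ 1 + g (v x) * z' x $ 2 = ((z x *\<^sub>R ?fv' x + f (v x) *\<^sub>R z' x) $ 1
      + (z x *\<^sub>R ?gv' x + g (v x) *\<^sub>R z' x) $ 2) - z x * (?fv' x $ 1 + ?gv' x $ 2)" for x
      by (simp add: algebra_simps)
    have "(\<integral>x. f (v x) * z' x $ 1 + g (v x) * z' x $ 2 \<partial>lborel) = - (\<integral>x. z x * (?fv' x $ 1 + ?gv' x $ 2) \<partial>lborel)"
      unfolding eq Bochner_Integration.integral_diff[OF Bochner_Integration.integrable_add[OF j1 j2] j3]
        Bochner_Integration.integral_add[OF j1 j2] S1 S2 by simp
    then show ?thesis by (simp add: v_def)
  qed
  also have "\<dots> \<le> (\<integral>x. (z x * (V (v x) / \<epsilon> + \<epsilon> * ?N x)) / 2 + \<eta> / \<epsilon> / 2 * z x + \<epsilon> * (z x * (c0 (v x) * ?D x))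
      + A * (z x * \<bar>a x $ 1 + b x $ 2\<bar>) \<partial>lborel)"
  proof (rule integral_mono[OF j3])
    show "integrable lborel (\<lambda>x. (z x * (V (v x) / \<epsilon> + \<epsilon> * ?N x)) / 2 + \<eta> / \<epsilon> / 2 * z x + \<epsilon> * (z x * (c0 (v x) * ?D x))
      + A * (z x * \<bar>a x $ 1 + b x $ 2\<bar>))"
      by (intro Bochner_Integration.integrable_add integrable_mult_right integrable_divide_zero iE iD iT zi)
    fix x
    let ?y = "v x"
    have "2 * (m ?y * (a x $ 1 - b x $ 2) + k ?y * b x $ 1 + l ?y * a x $ 2)
      \<le> \<Omega> ?y / \<epsilon> + \<epsilon> * ((a x $ 1)\<^sup>2 + (a x $ 2)\<^sup>2 + (b x $ 1)\<^sup>2 + (b x $ 2)\<^sup>2 + 2 * c0 ?y * (a x $ 1 * b x $ 2 - a x $ 2 * b x $ 1))"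
      unfolding c0_def by (rule pointwise_calibration(1)[OF quad' \<Omega>(2) \<epsilon>])
    also have "(a x $ 1)\<^sup>2 + (a x $ 2)\<^sup>2 + (b x $ 1)\<^sup>2 + (b x $ 2)\<^sup>2 = ?N x" by (simp add: norm_sq_2)
    finally have p: "2 * (m ?y * (a x $ 1 - b x $ 2) + k ?y * b x $ 1 + l ?y * a x $ 2)
      \<le> \<Omega> ?y / \<epsilon> + \<epsilon> * (?N x + 2 * c0 ?y * ?D x)" .
    have "(f' ?y $ 1 + g' ?y $ 2) / 2 * (a x $ 1 + b x $ 2) \<le> \<bar>(f' ?y $ 1 + g' ?y $ 2) / 2\<bar> * \<bar>a x $ 1 + b x $ 2\<bar>"
      by (metis abs_ge_self abs_mult)
    also have "\<dots> \<le> A * \<bar>a x $ 1 + b x $ 2\<bar>" using A[of ?y] by (intro mult_right_mono) auto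
    finally have t: "(f' ?y $ 1 + g' ?y $ 2) / 2 * (a x $ 1 + b x $ 2) \<le> A * \<bar>a x $ 1 + b x $ 2\<bar>" .
    have d: "?fv' x $ 1 + ?gv' x $ 2 = (m ?y * (a x $ 1 - b x $ 2) + k ?y * b x $ 1 + l ?y * a x $ 2)
        + (f' ?y $ 1 + g' ?y $ 2) / 2 * (a x $ 1 + b x $ 2)"
      by (simp add: m_def k_def l_def field_simps)
    have "?fv' x $ 1 + ?gv' x $ 2 \<le> (\<Omega> ?y / \<epsilon> + \<epsilon> * (?N x + 2 * c0 ?y * ?D x)) / 2 + A * \<bar>a x $ 1 + b x $ 2\<bar>"
    proof -
      have "P + u \<le> X / 2 + U" if "2 * P \<le> X" "u \<le> U" for P u X U :: real using that by linarith
      from this[OF p t] show ?thesis unfolding d .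
    qed
    then have "z x * (?fv' x $ 1 + ?gv' x $ 2)
        \<le> z x * ((\<Omega> ?y / \<epsilon> + \<epsilon> * (?N x + 2 * c0 ?y * ?D x)) / 2 + A * \<bar>a x $ 1 + b x $ 2\<bar>)"
      using z0 by (intro mult_left_mono) auto
    also have "\<dots> = (z x * (V (v x) / \<epsilon> + \<epsilon> * ?N x)) / 2 + \<eta> / \<epsilon> / 2 * z x + \<epsilon> * (z x * (c0 (v x) * ?D x))
      + A * (z x * \<bar>a x $ 1 + b x $ 2\<bar>)"
      using \<epsilon> by (simp add: \<Omega>_def field_simps)
    finally show "z x * (?fv' x $ 1 + ?gv' x $ 2) \<le> (z x * (V (v x) / \<epsilon> + \<epsilon> * ?N x)) / 2 + \<eta> / \<epsilon> / 2 * z x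
      + \<epsilon> * (z x * (c0 (v x) * ?D x)) + A * (z x * \<bar>a x $ 1 + b x $ 2\<bar>)" .
  qed
  also have "\<dots> = (\<integral>x. z x * (V (v x) / \<epsilon> + \<epsilon> * ?N x) \<partial>lborel) / 2 + \<eta> / \<epsilon> / 2 * Z
      + \<epsilon> * (\<integral>x. z x * (c0 (v x) * ?D x) \<partial>lborel) + A * ?T"
  proof -
    have i1: "integrable lborel (\<lambda>x. (z x * (V (v x) / \<epsilon> + \<epsilon> * ?N x)) / 2)"
      and i2: "integrable lborel (\<lambda>x. \<eta> / \<epsilon> / 2 * z x)"
      and i3: "integrable lborel (\<lambda>x. \<epsilon> * (z x * (c0 (v x) * ?D x)))"
      and i4: "integrable lborel (\<lambda>x. A * (z x * \<bar>a x $ 1 + b x $ 2\<bar>))"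
      by (intro integrable_mult_right integrable_divide_zero iE iD iT zi)+
    show ?thesis
      unfolding Bochner_Integration.integral_add[OF Bochner_Integration.integrable_add[OF Bochner_Integration.integrable_add[OF i1 i2] i3] i4]
        Bochner_Integration.integral_add[OF Bochner_Integration.integrable_add[OF i1 i2] i3]
        Bochner_Integration.integral_add[OF i1 i2] integral_mult_right_zero integral_divide_zero Z_def by simp
  qed
  also have "\<dots> \<le> ?E / 2 + \<eta>0 + \<epsilon> * ?J + A * ?T"
  proof -
    have q: "\<eta> / \<epsilon> / 2 = \<eta>0 / Y" using \<epsilon> by (simp add: \<eta>_def)
    have "\<eta>0 / Y * Z \<le> \<eta>0" using Y \<eta>0 by (simp add: field_simps)
    then have "\<eta> / \<epsilon> / 2 * Z \<le> \<eta>0" unfolding q .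
    moreover have "\<epsilon> * (\<integral>x. z x * (c0 (v x) * ?D x) \<partial>lborel) \<le> \<epsilon> * ?J"
      using det \<epsilon> by (intro mult_left_mono) auto
    ultimately show ?thesis by (simp add: v_def)
  qed
  finally show "?L \<le> ?E / 2 + A * ?T + \<epsilon> * ?J + \<eta>0" by simp
qed

section \<open>Flux through the diameter\<close>

text \<open>A shift by \<open>h\<close> along the first axis reduces the integral of
  \<open>z\<close> over the half plane by its integral over a strip of width \<open>h\<close>. If
  \<open>h + L < r1\<close>, the box of width \<open>h\<close> and height \<open>2 * L\<close> in
  this strip lies where \<open>z\<close> is \<open>1\<close>, so the difference quotient is at most
  \<open>- 2 * L\<close>. Shifts along the second axis preserve the half plane.\<close>

lemma half_plane_cutoff:
  assumes z: "C1_grad z z'" and zr: "\<And>x. norm x > r \<Longrightarrow> z x = 0" and z0: "\<And>x. 0 \<le> z x"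
    and z1: "\<And>x. norm x \<le> r1 \<Longrightarrow> z x = 1" and L: "0 < L" "L < r1"
  shows "(\<integral>x. indicator {x. x $ 1 > 0} x * z' x $ 1 \<partial>lborel) \<le> - 2 * L"
    and "(\<integral>x. indicator {x. x $ 1 > 0} x * z' x $ 2 \<partial>lborel) = 0"
proof -
  let ?H = "{x::real^2. x $ 1 > 0}"
  have H: "?H \<in> sets borel"
    by (intro borel_open open_Collect_less continuous_intros)
  have zi: "integrable lborel z"
    by (rule integrable_continuous_compact_support[OF C1_grad_continuous[OF z], of "cball 0 r"]) (use zr in auto)
  have iA: "integrable lborel (\<lambda>x. indicator A x * z x)" if "A \<in> sets borel" for A
    using that by (intro integrable_real_mult_indicator[OF _ zi, unfolded mult.commute[of "z _"]]) auto
  have zm: "z \<in> borel_measurable borel" using zi by auto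
  note H[measurable] zm[measurable]
  have "compact (cball (0::real^2) r)" by simp
  have out: "z x = 0" if "x \<notin> cball 0 r" for x using zr that by auto
  note lim = difference_quotient_integral[OF z \<open>compact (cball 0 r)\<close> out H]
  have shift: "(\<integral>x. indicator ?H x * (z (x + h *\<^sub>R axis i 1) - z x) \<partial>lborel)
      = (\<integral>x. indicator {x. x - h *\<^sub>R axis i 1 \<in> ?H} x * z x \<partial>lborel) - (\<integral>x. indicator ?H x * z x \<partial>lborel)" for h i
  proof -
    let ?c = "h *\<^sub>R axis i 1 :: real^2"
    have mS: "{x. x - ?c \<in> ?H} \<in> sets borel"
      by (simp only: mem_Collect_eq) (intro borel_open open_Collect_less continuous_intros)
    have i1: "integrable lborel (\<lambda>x. indicator {x. x - ?c \<in> ?H} (?c + x) * z (?c + x))"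
      by (rule lborel_integrable_translate[OF iA[OF mS]])
    have e: "(\<lambda>x. indicator {x. x - ?c \<in> ?H} (?c + x) * z (?c + x)) = (\<lambda>x. indicator ?H x * z (x + ?c))"
      by (auto simp: fun_eq_iff indicator_def add.commute)
    have "(\<integral>x. indicator {x. x - ?c \<in> ?H} (?c + x) * z (?c + x) \<partial>lborel) = (\<integral>x. indicator {x. x - ?c \<in> ?H} x * z x \<partial>lborel)"
      by (rule lborel_integral_translate[of "\<lambda>x. indicator {x. x - ?c \<in> ?H} x * z x"]) (use mS in measurable)
    then show ?thesis
      using Bochner_Integration.integral_diff[OF i1[unfolded e] iA[OF H]] unfolding e by (simp add: right_diff_distrib)
  qed
  have "(\<integral>x. indicator ?H x * (z (x + (1 / real (Suc n)) *\<^sub>R axis 2 1) - z x) * real (Suc n) \<partial>lborel) = 0" for n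
    using shift[of "1 / real (Suc n)" 2] by (simp add: axis_def)
  then show "(\<integral>x. indicator ?H x * z' x $ 2 \<partial>lborel) = 0"
    using lim[of 2] by (simp add: LIMSEQ_const_iff)
  have "\<forall>\<^sub>F n in sequentially. (\<integral>x. indicator ?H x * (z (x + (1 / real (Suc n)) *\<^sub>R axis 1 1) - z x) * real (Suc n) \<partial>lborel) \<le> - 2 * L"
  proof -
    have "(\<lambda>n. 1 / real (Suc n)) \<longlonglongrightarrow> 0" using LIMSEQ_Suc[OF lim_1_over_n[where ?'a=real]] by simp
    then have "\<forall>\<^sub>F n in sequentially. 1 / real (Suc n) < r1 - L" by (rule order_tendstoD) (use L in simp)
    then show ?thesis
    proof eventually_elim
      case (elim n)
      define h where "h = 1 / real (Suc n)"
      have h: "h > 0" "h + L < r1" using elim by (auto simp: h_def)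
      let ?S = "{x::real^2. 0 < x $ 1 \<and> x $ 1 \<le> h}"
      have mS: "?S \<in> sets borel" "{x::real^2. h < x $ 1} \<in> sets borel"
        by measurable
      let ?B = "box (pair2 0 (- L)) (pair2 h L)"
      have B: "measure lborel ?B = 2 * L * h"
      proof -
        have "measure lborel ?B = measure lborel (cbox (pair2 0 (- L)) (pair2 h L))"
          by (simp add: measure_lborel_box_eq measure_lborel_cbox_eq)
        also have "\<dots> = (\<Prod>i\<in>UNIV. pair2 h L $ i - pair2 0 (- L) $ i)"
          using h L by (subst content_cbox_cart[symmetric]) (auto simp: interval_ne_empty_cart(1) forall_2 box_ne_empty)
        also have "\<dots> = 2 * L * h" unfolding UNIV_2 by simp
        finally show ?thesis .
      qed
      have Bz: "indicator ?B x \<le> indicator ?S x * z x" for x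
      proof (cases "x \<in> ?B")
        case True
        then have "0 < x $ 1" "x $ 1 < h" "\<bar>x $ 2\<bar> < L" by (auto simp: mem_box_cart forall_2)
        moreover from this have "norm x \<le> r1" using norm_le_components_2[of x] h by auto
        ultimately show ?thesis using z1[of x] by simp
      qed (use z0 in auto)
      have "2 * L * h = (\<integral>x. indicator ?B x \<partial>lborel)" using B by simp
      also have "\<dots> \<le> (\<integral>x. indicator ?S x * z x \<partial>lborel)"
        by (intro integral_mono Bz iA mS integrable_real_indicator emeasure_lborel_box_finite) auto
      also have "\<dots> = (\<integral>x. indicator ?H x * z x - indicator {x. h < x $ 1} x * z x \<partial>lborel)"
        using h by (intro Bochner_Integration.integral_cong) (auto simp: indicator_def)
      also have "\<dots> = (\<integral>x. indicator ?H x * z x \<partial>lborel) - (\<integral>x. indicator {x. h < x $ 1} x * z x \<partial>lborel)"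
        by (rule Bochner_Integration.integral_diff[OF iA[OF H] iA[OF mS(2)]])
      finally have "(\<integral>x. indicator ?H x * (z (x + h *\<^sub>R axis 1 1) - z x) \<partial>lborel) \<le> - (2 * L * h)"
        using shift[of h 1] by (simp add: axis_def)
      then have "(\<integral>x. indicator ?H x * (z (x + h *\<^sub>R axis 1 1) - z x) \<partial>lborel) * real (Suc n) \<le> - (2 * L * h) * real (Suc n)"
        by (intro mult_right_mono) auto
      also have "- (2 * L * h) * real (Suc n) = - 2 * L" by (simp add: h_def)
      finally show ?case unfolding h_def by simp
    qed
  qed
  with lim[of 1] show "(\<integral>x. indicator ?H x * z' x $ 1 \<partial>lborel) \<le> - 2 * L"
    by (rule tendsto_upperbound) (assumption | rule sequentially_bot)+
qed

section \<open>Mollification\<close>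

lemma pderiv_at_C1_grad: "C1_grad f f' \<Longrightarrow> pderiv_at i f = (\<lambda>x. f' x $ i)"
  unfolding pderiv_at_def
  by (rule ext, subst frechet_derivative_at[OF C1_grad_derivative, symmetric]) (auto simp: inner_axis)

text \<open>The link between the recursive smoothness classes and \<open>C1_grad\<close>: a Frechet
  derivative is recovered by linearity from its values on the two axis vectors.\<close>

lemma C_space_Suc_imp_C1_grad:
  assumes "f \<in> C_space (Suc j)"
  shows "C1_grad f (\<lambda>x. \<chi> i. pderiv_at i f x)"
proof (rule C1_gradI)
  have cont: "g \<in> C_space j \<Longrightarrow> continuous_on UNIV g" for g
    by (cases j) (auto intro!: continuous_at_imp_continuous_on differentiable_imp_continuous_within)
  show "continuous_on UNIV (\<lambda>x. \<chi> i. pderiv_at i f x)"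
    using assms by (intro continuous_on_vec_lambda cont) auto
  fix x
  have "(f has_derivative frechet_derivative f (at x)) (at x)"
    using assms by (simp add: frechet_derivative_works)
  moreover have "frechet_derivative f (at x) = (\<lambda>h. (\<chi> i. pderiv_at i f x) \<bullet> h)"
  proof (rule ext)
    fix h :: "real^2"
    have lin: "linear (frechet_derivative f (at x))"
      using assms by (intro linear_frechet_derivative) auto
    have "h = h $ 1 *\<^sub>R axis 1 1 + h $ 2 *\<^sub>R axis 2 1"
      by (simp add: vec_eq_iff forall_2 axis_def)
    then have "frechet_derivative f (at x) h
        = frechet_derivative f (at x) (h $ 1 *\<^sub>R axis 1 1 + h $ 2 *\<^sub>R axis 2 1)" by simp
    then show "frechet_derivative f (at x) h = (\<chi> i. pderiv_at i f x) \<bullet> h"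
      using lin by (simp add: linear_add linear_scale inner_2 pderiv_at_def)
  qed
  ultimately show "(f has_derivative (\<lambda>h. (\<chi> i. pderiv_at i f x) \<bullet> h)) (at x)" by simp
qed

lemma C_space_add: "f \<in> C_space j \<Longrightarrow> g \<in> C_space j \<Longrightarrow> (\<lambda>x. f x + g x) \<in> C_space j"
proof (induction j arbitrary: f g)
  case (Suc j)
  have "pderiv_at i (\<lambda>x. f x + g x) = (\<lambda>x. pderiv_at i f x + pderiv_at i g x)" for i
    using pderiv_at_C1_grad[OF C1_grad_add[OF C_space_Suc_imp_C1_grad[OF Suc.prems(1)] C_space_Suc_imp_C1_grad[OF Suc.prems(2)]]]
    by simp
  then show ?case using Suc by simp
qed (auto intro: continuous_intros)

lemma C_space_cmult: "f \<in> C_space j \<Longrightarrow> (\<lambda>x. c * f x) \<in> C_space j"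
proof (induction j arbitrary: f)
  case (Suc j)
  have "pderiv_at i (\<lambda>x. c * f x) = (\<lambda>x. c * pderiv_at i f x)" for i
    using pderiv_at_C1_grad[OF C1_grad_cmult[OF C_space_Suc_imp_C1_grad[OF Suc.prems]], of i c] by simp
  then show ?case using Suc by simp
qed (auto intro: continuous_intros)

section \<open>Smooth bump functions\<close>

text \<open>The denominators \<open>t ^ k\<close> are included so that the derivative of a member is
  a linear combination of members; smoothness then follows by induction.\<close>

definition flat_exp :: "nat \<Rightarrow> real \<Rightarrow> real" where
  "flat_exp k t = (if t > 0 then exp (- 1 / t) / t ^ k else 0)"

text \<open>Raise \<open>exp x \<ge> x\<close> at \<open>x = 1 / (n t)\<close> to the power
  \<open>n = k + 2\<close>. A quadratic bound for every \<open>k\<close> gives the derivative zero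
  at \<open>0\<close>, where the two formulas meet.\<close>

lemma flat_exp_le: "\<exists>C\<ge>0. \<forall>t. \<bar>flat_exp k t\<bar> \<le> C * t\<^sup>2"
proof (intro exI conjI allI)
  define n where "n = k + 2"
  show "0 \<le> real n ^ n" by simp
  fix t
  show "\<bar>flat_exp k t\<bar> \<le> real n ^ n * t\<^sup>2"
  proof (cases "t > 0")
    case True
    have n: "real n > 0" by (simp add: n_def)
    have "(1 / t / n) ^ n \<le> exp (1 / t / n) ^ n"
    proof (rule power_mono)
      show "1 / t / n \<le> exp (1 / t / n)" using exp_ge_add_one_self[of "1 / t / n"] by linarith
    qed (use True in auto)
    also have "\<dots> = exp (1 / t)" using n by (simp flip: exp_of_nat_mult)
    finally have "inverse (exp (1 / t)) \<le> inverse ((1 / t / n) ^ n)"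
      using True n by (intro le_imp_inverse_le) auto
    also have "inverse ((1 / t / n) ^ n) = (real n * t) ^ n"
      by (simp flip: power_inverse add: mult.commute)
    also have "\<dots> = real n ^ n * t ^ n" by (rule power_mult_distrib)
    also have "t ^ n = t ^ k * t\<^sup>2" unfolding n_def by (rule power_add)
    finally have "exp (- 1 / t) \<le> real n ^ n * t\<^sup>2 * t ^ k" by (simp add: exp_minus mult_ac)
    then show ?thesis using True by (simp add: flat_exp_def field_simps)
  qed (simp add: flat_exp_def)
qed

lemma flat_exp_derivative:
  "(flat_exp k has_real_derivative flat_exp (k + 2) t - real k * flat_exp (k + 1) t) (at t)"
proof -
  consider "t > 0" | "t < 0" | "t = 0" by linarith
  then show ?thesis
  proof cases
    case 1
    have "((\<lambda>t. exp (- 1 / t) / t ^ k) has_real_derivative flat_exp (k + 2) t - real k * flat_exp (k + 1) t) (at t)"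
    proof -
      have "((\<lambda>t. exp (- 1 / t)) has_real_derivative exp (- 1 / t) / t\<^sup>2) (at t)"
        using 1 by (auto intro!: derivative_eq_intros simp: field_simps power2_eq_square)
      from DERIV_divide[OF this DERIV_pow[of k t UNIV]] show ?thesis
        by (rule DERIV_cong) (use 1 in \<open>cases k; simp add: flat_exp_def field_simps power2_eq_square\<close>)+
    qed
    then show ?thesis
      by (rule has_field_derivative_transform_within_open[where S="{0<..}"]) (use 1 in \<open>auto simp: flat_exp_def\<close>)
  next
    case 2
    have "((\<lambda>t. 0) has_real_derivative flat_exp (k + 2) t - real k * flat_exp (k + 1) t) (at t)"
      using 2 by (simp add: flat_exp_def)
    then show ?thesis
      by (rule has_field_derivative_transform_within_open[where S="{..<0}"]) (use 2 in \<open>auto simp: flat_exp_def\<close>)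
  next
    case 3
    obtain C where C: "C \<ge> 0" "\<And>t. \<bar>flat_exp k t\<bar> \<le> C * t\<^sup>2" using flat_exp_le by blast
    have "((\<lambda>h. flat_exp k h / h) \<longlongrightarrow> 0) (at 0)"
    proof (rule Lim_null_comparison)
      show "\<forall>\<^sub>F h in at 0. norm (flat_exp k h / h) \<le> C * \<bar>h\<bar>"
        unfolding eventually_at_filter
      proof (intro always_eventually allI impI)
        fix h :: real assume "h \<noteq> 0"
        then show "norm (flat_exp k h / h) \<le> C * \<bar>h\<bar>"
          using C(2)[of h] by (simp add: abs_divide divide_le_eq mult.assoc flip: power2_eq_square)
      qed
      show "((\<lambda>h::real. C * \<bar>h\<bar>) \<longlongrightarrow> 0) (at 0)" by (intro tendsto_eq_intros) auto
    qed
    then show ?thesis using 3 by (simp add: DERIV_def flat_exp_def)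
  qed
qed

lemma continuous_on_flat_exp: "continuous_on UNIV (flat_exp k)"
  by (rule DERIV_continuous_on) (rule flat_exp_derivative)

text \<open>Differentiating the squared distance produces factors of coordinates. With monomials in
  \<open>x - c\<close> included, all partial derivatives stay in the span of the family.\<close>

definition bump :: "nat \<Rightarrow> nat \<Rightarrow> nat \<Rightarrow> real \<Rightarrow> real^2 \<Rightarrow> real^2 \<Rightarrow> real" where
  "bump k a b r c x = flat_exp k (r\<^sup>2 - (norm (x - c))\<^sup>2) * (((x - c) $ 1) ^ a * ((x - c) $ 2) ^ b)"

lemma C1_grad_shift: "C1_grad f f' \<Longrightarrow> C1_grad (\<lambda>x. f (x - c)) (\<lambda>x. f' (x - c))"
proof (rule C1_gradI)
  fix x assume f: "C1_grad f f'"
  have "((\<lambda>x. x - c) has_derivative (\<lambda>h. h)) (at x)" by (auto intro!: derivative_eq_intros)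
  from has_derivative_compose[OF this C1_grad_derivative[OF f, of "x - c" UNIV]]
  show "((\<lambda>x. f (x - c)) has_derivative (\<lambda>h. f' (x - c) \<bullet> h)) (at x)" .
next
  assume f: "C1_grad f f'"
  show "continuous_on UNIV (\<lambda>x. f' (x - c))"
    by (rule continuous_on_compose2[OF C1_grad_continuous_grad[OF f, of UNIV]]) (auto intro!: continuous_intros)
qed

text \<open>For \<open>a = 0\<close> the truncated difference \<open>a - 1\<close> does no harm,
  since its term carries the factor \<open>real a\<close>; likewise for \<open>b\<close>.\<close>

lemma C1_grad_bump:
  "C1_grad (bump k a b r c) (\<lambda>x. pair2
     (real a * bump k (a - 1) b r c x - 2 * bump (k + 2) (a + 1) b r c x + 2 * real k * bump (k + 1) (a + 1) b r c x)
     (real b * bump k a (b - 1) r c x - 2 * bump (k + 2) a (b + 1) r c x + 2 * real k * bump (k + 1) a (b + 1) r c x))"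
  (is "C1_grad _ ?B'")
proof -
  have pw: "((\<lambda>t::real. t ^ n) has_real_derivative real n * t ^ (n - 1)) (at t)" "continuous_on UNIV (\<lambda>t::real. real n * t ^ (n - 1))" for n t
    by (auto intro!: derivative_eq_intros continuous_intros)
  have fl: "continuous_on UNIV (\<lambda>t. flat_exp (k + 2) t - real k * flat_exp (k + 1) t)"
    using continuous_on_flat_exp by (intro continuous_intros)
  let ?q = "\<lambda>x::real^2. r\<^sup>2 - (norm (x - c))\<^sup>2"
  let ?x = "\<lambda>x::real^2. (x - c) $ 1" and ?y = "\<lambda>x::real^2. (x - c) $ 2"
  have q: "C1_grad ?q (\<lambda>x. 0 - 2 *\<^sub>R (x - c))"
    by (intro C1_grad_diff C1_grad_const C1_grad_shift[OF C1_grad_norm_sq])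
  note g = C1_grad_mult[OF C1_grad_real_compose[OF q flat_exp_derivative[of k] fl]
    C1_grad_mult[OF C1_grad_real_compose[OF C1_grad_shift[OF C1_grad_component[of 1]] pw[of a]]
      C1_grad_real_compose[OF C1_grad_shift[OF C1_grad_component[of 2]] pw[of b]]], of c c]
  show ?thesis
  proof (rule C1_gradI)
    fix x
    have "(\<lambda>h. ?B' x \<bullet> h) = (\<lambda>h. (flat_exp k (?q x) *\<^sub>R ((?x x ^ a) *\<^sub>R ((real b * ?y x ^ (b - 1)) *\<^sub>R axis 2 1)
        + (?y x ^ b) *\<^sub>R ((real a * ?x x ^ (a - 1)) *\<^sub>R axis 1 1))
      + (?x x ^ a * ?y x ^ b) *\<^sub>R ((flat_exp (k + 2) (?q x) - real k * flat_exp (k + 1) (?q x)) *\<^sub>R (0 - 2 *\<^sub>R (x - c)))) \<bullet> h)"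
      by (rule ext) (simp add: inner_2 bump_def axis_def algebra_simps)
    then show "(bump k a b r c has_derivative (\<lambda>h. ?B' x \<bullet> h)) (at x)"
      using C1_grad_derivative[OF g, of x UNIV] unfolding bump_def[abs_def] by simp
  next
    have "continuous_on UNIV (bump k a b r c)" for k a b
      unfolding bump_def[abs_def]
      by (intro continuous_intros continuous_on_compose2[OF continuous_on_flat_exp]) auto
    then show "continuous_on UNIV ?B'" by (intro continuous_intros)
  qed
qed

lemma bump_in_C_space: "bump k a b r c \<in> C_space j"
proof (induction j arbitrary: k a b)
  case 0
  then show ?case using C1_grad_continuous[OF C1_grad_bump] by simp
next
  case (Suc j)
  have d: "(\<lambda>x. real a * bump k (a - 1) b r c x + (- 2) * bump (k + 2) (a + 1) b r c x + (2 * real k) * bump (k + 1) (a + 1) b r c x) \<in> C_space j"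
    "(\<lambda>x. real b * bump k a (b - 1) r c x + (- 2) * bump (k + 2) a (b + 1) r c x + (2 * real k) * bump (k + 1) a (b + 1) r c x) \<in> C_space j"
    by (intro C_space_add C_space_cmult Suc)+
  have "\<forall>x. bump k a b r c differentiable at x"
    using C1_grad_derivative[OF C1_grad_bump] by (metis differentiable_def)
  moreover have "pderiv_at i (bump k a b r c) \<in> C_space j" for i
    using exhaust_2[of i] d by (auto simp: pderiv_at_C1_grad[OF C1_grad_bump])
  ultimately show ?case by simp
qed

lemma bump_outside: "norm (x - c) \<ge> r \<Longrightarrow> r \<ge> 0 \<Longrightarrow> bump k a b r c x = 0"
proof -
  assume "norm (x - c) \<ge> r" "r \<ge> 0"
  then have "r\<^sup>2 \<le> (norm (x - c))\<^sup>2" by (rule power_mono)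
  then have "\<not> 0 < r\<^sup>2 - (norm (x - c))\<^sup>2" by linarith
  then show ?thesis unfolding bump_def flat_exp_def by (simp only: if_False mult_zero_left)
qed

lemma bump_test_function:
  assumes "0 < r" "cball c r \<subseteq> S"
  shows "(\<lambda>x. C * bump 0 0 0 r c x) \<in> test_functions S"
proof -
  have "closure {x. C * bump 0 0 0 r c x \<noteq> 0} \<subseteq> cball c r"
    by (rule closure_minimal)
     (use assms bump_outside[of r _ c] in \<open>auto simp: dist_norm norm_minus_commute intro: ccontr\<close>)
  moreover from this have "compact (closure {x. C * bump 0 0 0 r c x \<noteq> 0})"
    by (meson bounded_cball bounded_subset closed_closure compact_eq_bounded_closed)
  ultimately show ?thesis
    using assms by (auto simp: test_functions_def intro!: C_space_cmult bump_in_C_space)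
qed

lemma uniformly_continuous_compact_support:
  fixes f :: "real^2 \<Rightarrow> 'b::real_normed_vector"
  assumes c: "continuous_on UNIV f" and K: "\<And>x. norm x > R \<Longrightarrow> f x = 0" and e: "e > 0"
  obtains d where "d > 0" "\<And>x y. norm (x - y) < d \<Longrightarrow> norm (f x - f y) < e"
proof -
  have "uniformly_continuous_on (cball 0 (R + 1)) f"
    by (rule compact_uniformly_continuous) (use c in \<open>auto intro: continuous_on_subset\<close>)
  then obtain d where d: "d > 0" "\<And>x y. x \<in> cball 0 (R + 1) \<Longrightarrow> y \<in> cball 0 (R + 1) \<Longrightarrow> dist x y < d \<Longrightarrow> dist (f x) (f y) < e"
    using e by (auto simp: uniformly_continuous_on_def)
  have "norm (f x - f y) < e" if xy: "norm (x - y) < min d 1" for x y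
  proof (cases "norm x > R \<and> norm y > R")
    case True then show ?thesis using K e by simp
  next
    case False
    then have "norm x \<le> R + 1" "norm y \<le> R + 1"
      using xy norm_triangle_sub[of x y] norm_triangle_sub[of y x] norm_minus_commute[of x y] by auto
    then show ?thesis using d(2)[of x y] xy by (simp add: dist_norm)
  qed
  then show ?thesis using d(1) that[of "min d 1"] by auto
qed

section \<open>Convolution\<close>

text \<open>The kernel may be vector-valued, so that the gradient of a convolution is again a
  convolution, with the gradient of the kernel.\<close>

definition conv :: "(real^2 \<Rightarrow> 'b::{banach, second_countable_topology}) \<Rightarrow> (real^2 \<Rightarrow> real) \<Rightarrow> real^2 \<Rightarrow> 'b" where
  "conv \<rho> U x = (\<integral>z. U z *\<^sub>R \<rho> (x - z) \<partial>lborel)"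

lemma integrable_conv:
  fixes \<rho> :: "real^2 \<Rightarrow> 'b::{banach, second_countable_topology}"
  assumes U: "integrable lborel U" and \<rho>: "continuous_on UNIV \<rho>" and B: "\<And>x. norm (\<rho> x) \<le> B"
  shows "integrable lborel (\<lambda>z. U z *\<^sub>R \<rho> (x - z))"
proof -
  have [measurable]: "U \<in> borel_measurable lborel" using U by auto
  have [measurable]: "(\<lambda>z. \<rho> (x - z)) \<in> borel_measurable borel"
    by (intro borel_measurable_continuous_onI continuous_on_compose2[OF \<rho>]) (auto intro!: continuous_intros)
  show ?thesis
  proof (rule Bochner_Integration.integrable_bound)
    show "integrable lborel (\<lambda>z. B * \<bar>U z\<bar>)" using U by auto
    show "AE z in lborel. norm (U z *\<^sub>R \<rho> (x - z)) \<le> norm (B * \<bar>U z\<bar>)"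
    proof (rule AE_I2)
      fix z
      have "\<bar>U z\<bar> * norm (\<rho> (x - z)) \<le> \<bar>U z\<bar> * B" using B by (intro mult_left_mono) auto
      also have "\<dots> \<le> norm (B * \<bar>U z\<bar>)" using mult_right_mono[OF abs_ge_self[of B], of "\<bar>U z\<bar>"] by (simp add: mult.commute abs_mult)
      finally show "norm (U z *\<^sub>R \<rho> (x - z)) \<le> norm (B * \<bar>U z\<bar>)" by simp
    qed
  qed measurable
qed

text \<open>Differentiation under the integral for a merely integrable \<open>U\<close>: the
  gradient of the kernel is uniformly continuous, so the first-order remainder of the kernel is
  small uniformly in \<open>z\<close> and integrates against \<open>U\<close> to something
  small.\<close>

lemma C1_grad_conv:
  assumes \<rho>: "C1_grad \<rho> \<rho>'" and R: "\<And>x. norm x > R \<Longrightarrow> \<rho> x = 0" and U: "integrable lborel U"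
  shows "C1_grad (conv \<rho> U) (conv \<rho>' U)"
proof -
  have R': "\<rho>' x = 0" if "norm x > R" for x
    by (rule C1_grad_outside_support[OF \<rho>, of "cball 0 R"]) (use R that in auto)
  obtain B where B: "B > 0" "\<And>x. norm (\<rho> x) \<le> B"
    by (rule continuous_compact_support_bounded[OF C1_grad_continuous[OF \<rho>], of "cball 0 R"]) (use R in auto)
  obtain B' where B': "B' > 0" "\<And>x. norm (\<rho>' x) \<le> B'"
    by (rule continuous_compact_support_bounded[OF C1_grad_continuous_grad[OF \<rho>], of "cball 0 R"]) (use R' in auto)
  note i = integrable_conv[OF U C1_grad_continuous[OF \<rho>] B(2)]
  note i' = integrable_conv[OF U C1_grad_continuous_grad[OF \<rho>] B'(2)]
  define I where "I = (\<integral>z. \<bar>U z\<bar> \<partial>lborel)"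
  have I0: "I \<ge> 0" by (simp add: I_def)
  have uc: "\<exists>d>0. \<forall>x y. norm (x - y) < d \<longrightarrow> norm (\<rho>' x - \<rho>' y) * (I + 1) \<le> e" if e: "e > 0" for e
  proof -
    obtain d where "d > 0" "\<And>x y. norm (x - y) < d \<Longrightarrow> norm (\<rho>' x - \<rho>' y) < e / (I + 1)"
      by (rule uniformly_continuous_compact_support[where R=R, OF C1_grad_continuous_grad[OF \<rho>], of "e / (I + 1)"])
        (use R' e I0 in \<open>auto intro!: divide_pos_pos\<close>)
    then show ?thesis using I0 by (intro exI[of _ d]) (auto simp: field_simps less_imp_le)
  qed
  show ?thesis
  proof (rule C1_gradI)
    fix x
    show "(conv \<rho> U has_derivative (\<lambda>h. conv \<rho>' U x \<bullet> h)) (at x)"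
      unfolding has_derivative_at_alt
    proof (intro conjI allI impI)
      show "bounded_linear (\<lambda>h. conv \<rho>' U x \<bullet> h)" by (rule bounded_linear_inner_right)
      fix e :: real assume "e > 0"
      then obtain d where d: "d > 0" "\<And>x y. norm (x - y) < d \<Longrightarrow> norm (\<rho>' x - \<rho>' y) * (I + 1) \<le> e"
        using uc by blast
      show "\<exists>d>0. \<forall>y. norm (y - x) < d \<longrightarrow> norm (conv \<rho> U y - conv \<rho> U x - conv \<rho>' U x \<bullet> (y - x)) \<le> e * norm (y - x)"
      proof (intro exI[of _ d] conjI d(1) allI impI)
        fix y assume y: "norm (y - x) < d"
        let ?E = "\<lambda>z. \<rho> (y - z) - \<rho> (x - z) - \<rho>' (x - z) \<bullet> (y - x)"
        have E: "\<bar>?E z\<bar> * (I + 1) \<le> e * norm (y - x)" for z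
        proof -
          \<comment> \<open>Subtracting the linear part turns the remainder into an increment of a
            function whose gradient is small on the segment.\<close>
          have lin: "C1_grad (\<lambda>u. \<rho> u - \<rho>' (x - z) \<bullet> u) (\<lambda>u. \<rho>' u - \<rho>' (x - z))"
            by (rule C1_grad_diff[OF \<rho>]) (auto intro!: C1_gradI bounded_linear_imp_has_derivative bounded_linear_inner_right)
          have "\<bar>(\<rho> (y - z) - \<rho>' (x - z) \<bullet> (y - z)) - (\<rho> (x - z) - \<rho>' (x - z) \<bullet> (x - z))\<bar>
              \<le> e / (I + 1) * norm ((y - z) - (x - z))"
          proof (rule C1_grad_mvt[OF lin])
            fix u assume "u \<in> closed_segment (x - z) (y - z)"
            then have "norm (u - (x - z)) \<le> norm ((y - z) - (x - z))"
              by (metis dist_in_closed_segment dist_norm norm_minus_commute)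
            then show "norm (\<rho>' u - \<rho>' (x - z)) \<le> e / (I + 1)"
              using d(2)[of u "x - z"] y I0 by (simp add: field_simps)
          qed
          also have "(\<rho> (y - z) - \<rho>' (x - z) \<bullet> (y - z)) - (\<rho> (x - z) - \<rho>' (x - z) \<bullet> (x - z)) = ?E z"
            by (simp add: inner_diff_right)
          finally show ?thesis using I0 by (simp add: field_simps)
        qed
        have "conv \<rho>' U x \<bullet> (y - x) = (\<integral>z. (U z *\<^sub>R \<rho>' (x - z)) \<bullet> (y - x) \<partial>lborel)"
          unfolding conv_def using i' by (intro integral_inner_left[symmetric]) auto
        moreover have ci: "integrable lborel (\<lambda>z. (U z *\<^sub>R \<rho>' (x - z)) \<bullet> (y - x))"
          by (rule integrable_inner_left) (rule i')
        ultimately have "conv \<rho> U y - conv \<rho> U x - conv \<rho>' U x \<bullet> (y - x)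
            = (\<integral>z. U z *\<^sub>R \<rho> (y - z) - U z *\<^sub>R \<rho> (x - z) - (U z *\<^sub>R \<rho>' (x - z)) \<bullet> (y - x) \<partial>lborel)"
          unfolding conv_def using Bochner_Integration.integral_diff[OF Bochner_Integration.integrable_diff[OF i i] ci]
            Bochner_Integration.integral_diff[OF i i] by simp
        also have "\<dots> = (\<integral>z. U z * ?E z \<partial>lborel)"
          by (rule Bochner_Integration.integral_cong) (auto simp: algebra_simps)
        finally have "conv \<rho> U y - conv \<rho> U x - conv \<rho>' U x \<bullet> (y - x) = (\<integral>z. U z * ?E z \<partial>lborel)" .
        also have "\<bar>\<integral>z. U z * ?E z \<partial>lborel\<bar> \<le> (\<integral>z. \<bar>U z\<bar> * (e * norm (y - x) / (I + 1)) \<partial>lborel)"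
        proof (rule integral_norm_bound[THEN order_trans, of lborel "\<lambda>z. U z * ?E z", unfolded real_norm_def], rule integral_mono)
          have "(\<lambda>z. U z *\<^sub>R \<rho> (y - z) - U z *\<^sub>R \<rho> (x - z) - (U z *\<^sub>R \<rho>' (x - z)) \<bullet> (y - x)) = (\<lambda>z. U z * ?E z)"
            by (simp add: algebra_simps)
          moreover have "integrable lborel (\<lambda>z. U z *\<^sub>R \<rho> (y - z) - U z *\<^sub>R \<rho> (x - z) - (U z *\<^sub>R \<rho>' (x - z)) \<bullet> (y - x))"
            by (rule Bochner_Integration.integrable_diff[OF Bochner_Integration.integrable_diff[OF i i] ci])
          ultimately show "integrable lborel (\<lambda>z. \<bar>U z * ?E z\<bar>)" by simp
          show "integrable lborel (\<lambda>z. \<bar>U z\<bar> * (e * norm (y - x) / (I + 1)))" using U by auto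
          show "\<bar>U z * ?E z\<bar> \<le> \<bar>U z\<bar> * (e * norm (y - x) / (I + 1))" for z
            unfolding abs_mult using E[of z] I0 by (intro mult_left_mono) (auto simp: field_simps)
        qed
        also have "\<dots> = I * (e * norm (y - x) / (I + 1))" by (simp add: I_def)
        also have "\<dots> \<le> e * norm (y - x)" using I0 \<open>e > 0\<close> by (simp add: field_simps)
        finally show "norm (conv \<rho> U y - conv \<rho> U x - conv \<rho>' U x \<bullet> (y - x)) \<le> e * norm (y - x)" by simp
      qed
    qed
  next
    show "continuous_on UNIV (conv \<rho>' U)"
      unfolding continuous_on_iff
    proof (intro ballI allI impI)
      fix x and e :: real assume "e > 0"
      then obtain d where d: "d > 0" "\<And>x y. norm (x - y) < d \<Longrightarrow> norm (\<rho>' x - \<rho>' y) * (I + 1) \<le> e / 2"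
        using uc[of "e / 2"] by auto
      show "\<exists>d>0. \<forall>x'\<in>UNIV. dist x' x < d \<longrightarrow> dist (conv \<rho>' U x') (conv \<rho>' U x) < e"
      proof (intro exI[of _ d] conjI d(1) ballI impI)
        fix y assume y: "dist y x < d"
        have "conv \<rho>' U y - conv \<rho>' U x = (\<integral>z. U z *\<^sub>R (\<rho>' (y - z) - \<rho>' (x - z)) \<partial>lborel)"
          unfolding conv_def using i' by (simp flip: Bochner_Integration.integral_diff add: algebra_simps)
        also have "norm \<dots> \<le> (\<integral>z. \<bar>U z\<bar> * (e / 2 / (I + 1)) \<partial>lborel)"
        proof (rule integral_norm_bound[THEN order_trans], rule integral_mono)
          have "(\<lambda>z. U z *\<^sub>R \<rho>' (y - z) - U z *\<^sub>R \<rho>' (x - z)) = (\<lambda>z. U z *\<^sub>R (\<rho>' (y - z) - \<rho>' (x - z)))"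
            by (simp add: algebra_simps)
          moreover have "integrable lborel (\<lambda>z. U z *\<^sub>R \<rho>' (y - z) - U z *\<^sub>R \<rho>' (x - z))"
            using i' by auto
          ultimately show "integrable lborel (\<lambda>z. norm (U z *\<^sub>R (\<rho>' (y - z) - \<rho>' (x - z))))"
            by (intro integrable_norm) simp
          show "integrable lborel (\<lambda>z. \<bar>U z\<bar> * (e / 2 / (I + 1)))" using U by auto
          show "norm (U z *\<^sub>R (\<rho>' (y - z) - \<rho>' (x - z))) \<le> \<bar>U z\<bar> * (e / 2 / (I + 1))" for z
            unfolding norm_scaleR using d(2)[of "y - z" "x - z"] y I0
            by (intro mult_left_mono) (auto simp: field_simps dist_norm)
        qed
        also have "\<dots> = I * (e / 2 / (I + 1))" by (simp add: I_def)
        also have "\<dots> < e" using I0 \<open>e > 0\<close> by (simp add: field_simps add_nonneg_pos)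
        finally show "dist (conv \<rho>' U y) (conv \<rho>' U x) < e" by (simp add: dist_norm)
      qed
    qed
  qed
qed


section \<open>Density of continuous functions\<close>

text \<open>A Urysohn function between a closed set inside \<open>A\<close> and an open set around
  it differs from the indicator only on the gap between them. The set \<open>A\<close> may have
  infinite measure, so integrability is claimed for the difference only.\<close>

lemma indicator_L1_continuous_approx:
  fixes A :: "(real^2) set"
  assumes A: "A \<in> sets lborel" and e: "e > 0"
  obtains g :: "real^2 \<Rightarrow> real" where "continuous_on UNIV g"
    "integrable lborel (\<lambda>x. indicator A x - g x)" "(\<integral>x. \<bar>indicator A x - g x\<bar> \<partial>lborel) \<le> e"
proof -
  have AL: "A \<in> sets lebesgue" using A by simp
  obtain T where T: "closed T" "T \<subseteq> A" "emeasure lebesgue (A - T) < ennreal (e / 2)"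
    by (rule sets_lebesgue_inner_closed[OF AL, of "e / 2"]) (use e in simp)
  obtain S where S: "open S" "A \<subseteq> S" "emeasure lebesgue (S - A) < ennreal (e / 2)"
    by (rule sets_lebesgue_outer_open[OF AL, of "e / 2"]) (use e in simp)
  have ST: "S - T \<in> sets borel" using S T by auto
  have "emeasure lborel (S - T) = emeasure lborel ((S - A) \<union> (A - T))"
    using S T by (intro arg_cong[where f="emeasure lborel"]) auto
  also have "\<dots> \<le> emeasure lborel (S - A) + emeasure lborel (A - T)"
    using S T A by (intro emeasure_subadditive) auto
  also have "\<dots> \<le> ennreal (e / 2) + ennreal (e / 2)"
    using S T A by (intro add_mono less_imp_le) (auto simp: emeasure_completion)
  also have "\<dots> = ennreal e" using e by (simp flip: ennreal_plus)
  finally have m: "emeasure lborel (S - T) \<le> ennreal e" .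
  then have fin: "emeasure lborel (S - T) < \<infinity>" by (simp add: order_le_less_trans)
  have me: "measure lborel (S - T) \<le> e" using m e by (simp add: measure_def enn2real_leI)
  obtain g :: "real^2 \<Rightarrow> real" where g: "continuous_on UNIV g" "\<And>x. g x \<in> closed_segment 1 0"
    "\<And>x. x \<in> T \<Longrightarrow> g x = 1" "\<And>x. x \<in> - S \<Longrightarrow> g x = 0"
    by (rule Urysohn_local[of UNIV T "-S" "1::real" 0]) (use S T in auto)
  have g01: "0 \<le> g x" "g x \<le> 1" for x using g(2)[of x] by (auto simp: closed_segment_eq_real_ivl split: if_splits)
  have bd: "\<bar>indicator A x - g x\<bar> \<le> indicator (S - T) x" for x
    using g01[of x] g(3,4)[of x] S(2) T(2) by (auto simp: indicator_def)
  have [measurable]: "g \<in> borel_measurable borel" by (rule borel_measurable_continuous_onI[OF g(1)])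
  note A[measurable]
  have iST: "integrable lborel (indicator (S - T) :: _ \<Rightarrow> real)"
    using ST fin by (intro integrable_real_indicator) auto
  have int: "integrable lborel (\<lambda>x. indicator A x - g x)"
    by (rule Bochner_Integration.integrable_bound[OF iST]) (use bd in auto)
  have "(\<integral>x. \<bar>indicator A x - g x\<bar> \<partial>lborel) \<le> (\<integral>x. indicator (S - T) x \<partial>lborel)"
    using int bd by (intro integral_mono iST) auto
  also have "\<dots> = measure lborel (S - T)" using ST by simp
  finally show ?thesis using that[OF g(1) int] me by linarith
qed

text \<open>The claim is made for all \<open>e\<close> at once, because the sum and limit cases of
  the induction use the hypothesis with \<open>e / 2\<close>, and the base case uses a rescaled
  tolerance.\<close>

lemma L1_continuous_approx:
  fixes f :: "real^2 \<Rightarrow> real"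
  assumes "integrable lborel f"
  shows "\<forall>e>0. \<exists>g. continuous_on UNIV g \<and> integrable lborel (\<lambda>x. f x - g x) \<and> (\<integral>x. \<bar>f x - g x\<bar> \<partial>lborel) \<le> e"
  using assms
proof (induction rule: integrable_induct)
  case (base A c)
  show ?case
  proof (intro allI impI)
    fix e :: real assume e: "e > 0"
    obtain g where g: "continuous_on UNIV g" "integrable lborel (\<lambda>x. indicator A x - g x)"
      "(\<integral>x. \<bar>indicator A x - g x\<bar> \<partial>lborel) \<le> e / (\<bar>c\<bar> + 1)"
      using indicator_L1_continuous_approx[OF base(1), of "e / (\<bar>c\<bar> + 1)"] e by (auto simp: add_nonneg_pos)
    have eq: "(\<lambda>x. indicator A x *\<^sub>R c - c * g x) = (\<lambda>x. c * (indicator A x - g x))"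
      by (simp add: fun_eq_iff algebra_simps)
    have "(\<integral>x. \<bar>c * (indicator A x - g x)\<bar> \<partial>lborel) = \<bar>c\<bar> * (\<integral>x. \<bar>indicator A x - g x\<bar> \<partial>lborel)"
      by (simp add: abs_mult)
    also have "\<dots> \<le> \<bar>c\<bar> * (e / (\<bar>c\<bar> + 1))" using g by (intro mult_left_mono) auto
    also have "\<dots> \<le> e" using e by (simp add: field_simps)
    finally have "(\<integral>x. \<bar>indicator A x *\<^sub>R c - c * g x\<bar> \<partial>lborel) \<le> e" using eq by metis
    then show "\<exists>g. continuous_on UNIV g \<and> integrable lborel (\<lambda>x. indicator A x *\<^sub>R c - g x)
        \<and> (\<integral>x. \<bar>indicator A x *\<^sub>R c - g x\<bar> \<partial>lborel) \<le> e"
      using g eq by (intro exI[of _ "\<lambda>x. c * g x"]) (auto intro!: continuous_intros)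
  qed
next
  case (add f g)
  show ?case
  proof (intro allI impI)
    fix e :: real assume "e > 0"
    then have "e / 2 > 0" by simp
    obtain f' where f': "continuous_on UNIV f'" "integrable lborel (\<lambda>x. f x - f' x)" "(\<integral>x. \<bar>f x - f' x\<bar> \<partial>lborel) \<le> e / 2"
      using add \<open>e / 2 > 0\<close> by blast
    obtain g' where g': "continuous_on UNIV g'" "integrable lborel (\<lambda>x. g x - g' x)" "(\<integral>x. \<bar>g x - g' x\<bar> \<partial>lborel) \<le> e / 2"
      using add \<open>e / 2 > 0\<close> by blast
    have eq: "(\<lambda>x. (f x + g x) - (f' x + g' x)) = (\<lambda>x. (f x - f' x) + (g x - g' x))" by auto
    have i: "integrable lborel (\<lambda>x. (f x + g x) - (f' x + g' x))" unfolding eq using f' g' by auto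
    have "(\<integral>x. \<bar>(f x + g x) - (f' x + g' x)\<bar> \<partial>lborel) \<le> (\<integral>x. \<bar>f x - f' x\<bar> + \<bar>g x - g' x\<bar> \<partial>lborel)"
      using f' g' i by (intro integral_mono) auto
    also have "\<dots> \<le> e" using f' g' by simp
    finally show "\<exists>h. continuous_on UNIV h \<and> integrable lborel (\<lambda>x. f x + g x - h x)
        \<and> (\<integral>x. \<bar>f x + g x - h x\<bar> \<partial>lborel) \<le> e"
      using i f' g' by (intro exI[of _ "\<lambda>x. f' x + g' x"]) (auto intro!: continuous_intros)
  qed
next
  case (lim f s)
  show ?case
  proof (intro allI impI)
    fix e :: real assume e: "e > 0"
    have "(\<lambda>i. \<integral>x. \<bar>f x - s i x\<bar> \<partial>lborel) \<longlonglongrightarrow> (\<integral>x. 0 \<partial>(lborel :: (real^2) measure))"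
    proof (rule integral_dominated_convergence[where w="\<lambda>x. 3 * \<bar>f x\<bar>" and f="\<lambda>_. 0"])
      show "AE x in lborel. (\<lambda>i. \<bar>f x - s i x\<bar>) \<longlonglongrightarrow> 0"
      proof (rule AE_I2)
        fix x :: "real^2"
        have "(\<lambda>i. s i x) \<longlonglongrightarrow> f x" using lim.hyps(2)[of x] by simp
        then show "(\<lambda>i. \<bar>f x - s i x\<bar>) \<longlonglongrightarrow> 0" by (auto intro!: tendsto_eq_intros)
      qed
      show "AE x in lborel. norm \<bar>f x - s i x\<bar> \<le> 3 * \<bar>f x\<bar>" for i
      proof (rule AE_I2)
        fix x :: "real^2"
        have "\<bar>s i x\<bar> \<le> 2 * \<bar>f x\<bar>" using lim.hyps(3)[of x i] by simp
        then show "norm \<bar>f x - s i x\<bar> \<le> 3 * \<bar>f x\<bar>" unfolding real_norm_def by linarith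
      qed
    qed (use lim in auto)
    then have "\<forall>\<^sub>F i in sequentially. (\<integral>x. \<bar>f x - s i x\<bar> \<partial>lborel) < e / 2"
      using e by (intro order_tendstoD) auto
    then obtain i where i: "(\<integral>x. \<bar>f x - s i x\<bar> \<partial>lborel) < e / 2" by (auto simp: eventually_sequentially)
    obtain g where g: "continuous_on UNIV g" "integrable lborel (\<lambda>x. s i x - g x)" "(\<integral>x. \<bar>s i x - g x\<bar> \<partial>lborel) \<le> e / 2"
      using lim.IH[of i] e by (meson half_gt_zero)
    have eq: "(\<lambda>x. f x - g x) = (\<lambda>x. (f x - s i x) + (s i x - g x))" by auto
    have ii: "integrable lborel (\<lambda>x. f x - g x)" 
      unfolding eq by (intro Bochner_Integration.integrable_add Bochner_Integration.integrable_diff lim.hyps g(2))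
    have "(\<integral>x. \<bar>f x - g x\<bar> \<partial>lborel) \<le> (\<integral>x. \<bar>f x - s i x\<bar> + \<bar>s i x - g x\<bar> \<partial>lborel)"
      using g lim ii by (intro integral_mono) auto
    also have "\<dots> = (\<integral>x. \<bar>f x - s i x\<bar> \<partial>lborel) + (\<integral>x. \<bar>s i x - g x\<bar> \<partial>lborel)"
      using g lim by (intro Bochner_Integration.integral_add) auto
    also have "\<dots> \<le> e" using i g by simp
    finally show "\<exists>g. continuous_on UNIV g \<and> integrable lborel (\<lambda>x. f x - g x) \<and> (\<integral>x. \<bar>f x - g x\<bar> \<partial>lborel) \<le> e"
      using g ii by blast
  qed
qed

lemma L1_compact_support_approx:
  fixes f :: "real^2 \<Rightarrow> real"
  assumes f: "integrable lborel f" and e: "e > 0"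
  obtains g R where "continuous_on UNIV g" "\<And>x. norm x > R \<Longrightarrow> g x = 0" "R > 0" "(\<integral>x. \<bar>f x - g x\<bar> \<partial>lborel) \<le> e"
proof -
  obtain g where g: "continuous_on UNIV g" "integrable lborel (\<lambda>x. f x - g x)" "(\<integral>x. \<bar>f x - g x\<bar> \<partial>lborel) \<le> e / 2"
    using L1_continuous_approx[OF f] e by (meson half_gt_zero)
  have "(\<lambda>x. g x) = (\<lambda>x. f x - (f x - g x))" by auto
  then have gi: "integrable lborel g" using Bochner_Integration.integrable_diff[OF f g(2)] by simp
  define z where "z n x = max 0 (min 1 (real n + 1 - norm x))" for n and x :: "real^2"
  have zc: "continuous_on UNIV (z n)" for n unfolding z_def by (intro continuous_intros)
  have z01: "0 \<le> z n x" "z n x \<le> 1" for n x by (auto simp: z_def)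
  have [measurable]: "z n \<in> borel_measurable borel" for n by (rule borel_measurable_continuous_onI[OF zc])
  have [measurable]: "g \<in> borel_measurable borel" using gi by auto
  have "(\<lambda>n. \<integral>x. \<bar>g x - z n x * g x\<bar> \<partial>lborel) \<longlonglongrightarrow> (\<integral>x. 0 \<partial>(lborel :: (real^2) measure))"
  proof (rule integral_dominated_convergence[where w="\<lambda>x. \<bar>g x\<bar>" and f="\<lambda>_. 0"])
    show "AE x in lborel. (\<lambda>n. \<bar>g x - z n x * g x\<bar>) \<longlonglongrightarrow> 0"
    proof (rule AE_I2)
      fix x :: "real^2"
      have "\<forall>\<^sub>F n in sequentially. norm x \<le> real n"
        using filterlim_real_sequentially by (simp add: filterlim_at_top)
      then have "\<forall>\<^sub>F n in sequentially. \<bar>g x - z n x * g x\<bar> = 0"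
        by eventually_elim (simp add: z_def)
      then show "(\<lambda>n. \<bar>g x - z n x * g x\<bar>) \<longlonglongrightarrow> 0" by (rule tendsto_eventually)
    qed
    show "AE x in lborel. norm \<bar>g x - z n x * g x\<bar> \<le> \<bar>g x\<bar>" for n
    proof (rule AE_I2)
      fix x :: "real^2"
      have "\<bar>g x - z n x * g x\<bar> = \<bar>1 - z n x\<bar> * \<bar>g x\<bar>" by (simp flip: abs_mult add: algebra_simps)
      also have "\<dots> \<le> 1 * \<bar>g x\<bar>" using z01[of n x] by (intro mult_right_mono) auto
      finally show "norm \<bar>g x - z n x * g x\<bar> \<le> \<bar>g x\<bar>" by simp
    qed
  qed (use gi in auto)
  then have "\<forall>\<^sub>F n in sequentially. (\<integral>x. \<bar>g x - z n x * g x\<bar> \<partial>lborel) < e / 2"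
    using e by (intro order_tendstoD) auto
  then obtain n where n: "(\<integral>x. \<bar>g x - z n x * g x\<bar> \<partial>lborel) < e / 2" by (auto simp: eventually_sequentially)
  have zgi: "integrable lborel (\<lambda>x. z n x * g x)"
    by (rule Bochner_Integration.integrable_bound[OF gi])
      (use z01 in \<open>auto simp: abs_mult mult_left_le_one_le\<close>)
  show ?thesis
  proof (rule that)
    show "continuous_on UNIV (\<lambda>x. z n x * g x)" using zc g by (intro continuous_intros)
    show "z n x * g x = 0" if "norm x > real n + 1" for x using that by (simp add: z_def)
    have "(\<integral>x. \<bar>f x - z n x * g x\<bar> \<partial>lborel) \<le> (\<integral>x. \<bar>f x - g x\<bar> + \<bar>g x - z n x * g x\<bar> \<partial>lborel)"
      using f gi zgi by (intro integral_mono) auto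
    also have "\<dots> = (\<integral>x. \<bar>f x - g x\<bar> \<partial>lborel) + (\<integral>x. \<bar>g x - z n x * g x\<bar> \<partial>lborel)"
      using f gi zgi by (intro Bochner_Integration.integral_add) auto
    also have "\<dots> \<le> e" using n g by simp
    finally show "(\<integral>x. \<bar>f x - z n x * g x\<bar> \<partial>lborel) \<le> e" .
  qed simp
qed

section \<open>Mollifiers\<close>

text \<open>By evenness \<open>\<rho> (x - z)\<close> has integral one in \<open>z\<close> as well
  as in \<open>x\<close>: the first makes a convolution an average, the second makes it preserve
  integrals.\<close>

locale mollifier =
  fixes \<rho> :: "real^2 \<Rightarrow> real" and \<delta> :: real
  assumes cont: "continuous_on UNIV \<rho>" and nonneg: "\<And>x. 0 \<le> \<rho> x" and even: "\<And>x. \<rho> (- x) = \<rho> x"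
    and support: "\<And>x. norm x > \<delta> \<Longrightarrow> \<rho> x = 0" and total: "(\<integral>x. \<rho> x \<partial>lborel) = 1"
begin

lemma integrable: "integrable lborel \<rho>"
  by (rule integrable_continuous_compact_support[OF cont, of "cball 0 \<delta>"]) (use support in auto)

lemma integrable_shift: "integrable lborel (\<lambda>z. \<rho> (x - z))" "integrable lborel (\<lambda>x. \<rho> (x - z))"
proof -
  have e: "(\<lambda>z. \<rho> (- x + z)) = (\<lambda>z. \<rho> (x - z))" for x using even[of "x - _"] by (simp add: fun_eq_iff)
  have e': "(\<lambda>x. \<rho> (- z + x)) = (\<lambda>x. \<rho> (x - z))" for z by (simp add: fun_eq_iff)
  show "integrable lborel (\<lambda>z. \<rho> (x - z))"
    using lborel_integrable_translate[OF integrable, of "- x"] unfolding e .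
  show "integrable lborel (\<lambda>x. \<rho> (x - z))"
    using lborel_integrable_translate[OF integrable, of "- z"] unfolding e' .
qed

lemma integral_shift: "(\<integral>z. \<rho> (x - z) \<partial>lborel) = 1" "(\<integral>x. \<rho> (x - z) \<partial>lborel) = 1"
proof -
  have e: "(\<lambda>z. \<rho> (- x + z)) = (\<lambda>z. \<rho> (x - z))" for x using even[of "x - _"] by (simp add: fun_eq_iff)
  have e': "(\<lambda>x. \<rho> (- z + x)) = (\<lambda>x. \<rho> (x - z))" for z by (simp add: fun_eq_iff)
  have m: "\<rho> \<in> borel_measurable borel" using integrable by auto
  show "(\<integral>z. \<rho> (x - z) \<partial>lborel) = 1"
    using lborel_integral_translate[OF m, of "- x"] unfolding e total .
  show "(\<integral>x. \<rho> (x - z) \<partial>lborel) = 1"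
    using lborel_integral_translate[OF m, of "- z"] unfolding e' total .
qed

lemma bounded: obtains B where "B > 0" "\<And>x. norm (\<rho> x) \<le> B"
  by (rule continuous_compact_support_bounded[OF cont, of "cball 0 \<delta>"]) (use support in auto)

lemma integrable_conv_integrand: "integrable lborel U \<Longrightarrow> integrable lborel (\<lambda>z. U z * \<rho> (x - z))"
proof -
  assume U: "integrable lborel U"
  obtain B where "\<And>x. norm (\<rho> x) \<le> B" using bounded by blast
  from integrable_conv[OF U cont this, of x] show ?thesis by simp
qed

lemma integrable_pair:
  assumes U: "integrable lborel U"
  shows "integrable (lborel \<Otimes>\<^sub>M lborel) (\<lambda>(z, x). U z * \<rho> (x - z))"
proof (rule lborel_pair.Fubini_integrable)
  have [measurable]: "U \<in> borel_measurable borel" using U by auto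
  have "continuous_on UNIV (\<lambda>p. \<rho> (snd p - fst p))"
    by (rule continuous_on_compose2[OF cont]) (auto intro!: continuous_intros)
  then have "(\<lambda>p. \<rho> (snd p - fst p)) \<in> borel_measurable borel" by (rule borel_measurable_continuous_onI)
  then have [measurable]: "(\<lambda>p. \<rho> (snd p - fst p)) \<in> borel_measurable (borel \<Otimes>\<^sub>M borel)"
    by (simp add: borel_prod)
  show "(\<lambda>(z, x). U z * \<rho> (x - z)) \<in> borel_measurable (lborel \<Otimes>\<^sub>M lborel)"
    by (simp add: case_prod_beta)
  show "integrable lborel (\<lambda>z. \<integral>x. norm (case (z, x) of (z, x) \<Rightarrow> U z * \<rho> (x - z)) \<partial>lborel)"
    using U nonneg by (simp add: abs_mult integral_shift)
  show "AE z in lborel. integrable lborel (\<lambda>x. case (z, x) of (z, x) \<Rightarrow> U z * \<rho> (x - z))"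
    using integrable_shift by auto
qed

lemma conv_integrable:
  assumes U: "integrable lborel U"
  shows "integrable lborel (conv \<rho> U)" "(\<integral>x. conv \<rho> U x \<partial>lborel) = (\<integral>x. U x \<partial>lborel)"
proof -
  have "integrable lborel (\<lambda>x. \<integral>z. U z * \<rho> (x - z) \<partial>lborel)"
    by (rule lborel_pair.integrable_snd) (rule integrable_pair[OF U])
  then show "integrable lborel (conv \<rho> U)" by (simp add: conv_def[abs_def])
  have "(\<integral>x. conv \<rho> U x \<partial>lborel) = (\<integral>z. \<integral>x. U z * \<rho> (x - z) \<partial>lborel \<partial>lborel)"
    unfolding conv_def using lborel_pair.Fubini_integral[OF integrable_pair[OF U]] by simp
  then show "(\<integral>x. conv \<rho> U x \<partial>lborel) = (\<integral>x. U x \<partial>lborel)" by (simp add: integral_shift)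
qed

lemma abs_conv_le:
  assumes U: "integrable lborel U"
  shows "\<bar>conv \<rho> U x\<bar> \<le> conv \<rho> (\<lambda>x. \<bar>U x\<bar>) x"
  using integral_norm_bound[of lborel "\<lambda>z. U z * \<rho> (x - z)"] nonneg
  by (simp add: conv_def abs_mult)

lemma conv_L1_le:
  assumes U: "integrable lborel U"
  shows "(\<integral>x. \<bar>conv \<rho> U x\<bar> \<partial>lborel) \<le> (\<integral>x. \<bar>U x\<bar> \<partial>lborel)"
proof -
  have Ua: "integrable lborel (\<lambda>x. \<bar>U x\<bar>)" using U by auto
  have "(\<integral>x. \<bar>conv \<rho> U x\<bar> \<partial>lborel) \<le> (\<integral>x. conv \<rho> (\<lambda>x. \<bar>U x\<bar>) x \<partial>lborel)"
    using conv_integrable[OF U] conv_integrable[OF Ua] abs_conv_le[OF U] by (intro integral_mono) auto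
  then show ?thesis using conv_integrable[OF Ua] by simp
qed

text \<open>Jensen's inequality for the probability density \<open>\<rho> (x - z)\<close> in
  \<open>z\<close>, obtained from the non-negativity of the variance.\<close>

lemma conv_sq_le:
  assumes U: "integrable lborel U" and U2: "integrable lborel (\<lambda>x. (U x)\<^sup>2)"
  shows "(conv \<rho> U x)\<^sup>2 \<le> conv \<rho> (\<lambda>x. (U x)\<^sup>2) x"
proof -
  define c where "c = conv \<rho> U x"
  have "0 \<le> (\<integral>z. (U z - c)\<^sup>2 * \<rho> (x - z) \<partial>lborel)" using nonneg by (intro integral_nonneg_AE) auto
  also have "\<dots> = (\<integral>z. (U z)\<^sup>2 * \<rho> (x - z) - 2 * c * (U z * \<rho> (x - z)) + c\<^sup>2 * \<rho> (x - z) \<partial>lborel)"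
    by (rule Bochner_Integration.integral_cong) (auto simp: power2_eq_square algebra_simps)
  also have "\<dots> = conv \<rho> (\<lambda>x. (U x)\<^sup>2) x - 2 * c * c + c\<^sup>2"
    using integrable_conv_integrand[OF U, of x] integrable_conv_integrand[OF U2, of x] integrable_shift(1)[of x]
    by (simp add: conv_def c_def integral_shift)
  finally show ?thesis by (simp add: c_def power2_eq_square)
qed

lemma conv_L2_le:
  assumes U: "integrable lborel U" and U2: "integrable lborel (\<lambda>x. (U x)\<^sup>2)"
  shows "integrable lborel (\<lambda>x. (conv \<rho> U x)\<^sup>2)"
    "(\<integral>x. (conv \<rho> U x)\<^sup>2 \<partial>lborel) \<le> (\<integral>x. (U x)\<^sup>2 \<partial>lborel)"
proof -
  have [measurable]: "conv \<rho> U \<in> borel_measurable lborel" using conv_integrable[OF U] by auto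
  show 1: "integrable lborel (\<lambda>x. (conv \<rho> U x)\<^sup>2)"
  proof (rule Bochner_Integration.integrable_bound[OF conv_integrable(1)[OF U2]])
    show "AE x in lborel. norm ((conv \<rho> U x)\<^sup>2) \<le> norm (conv \<rho> (\<lambda>x. (U x)\<^sup>2) x)"
    proof (rule AE_I2)
      fix x
      show "norm ((conv \<rho> U x)\<^sup>2) \<le> norm (conv \<rho> (\<lambda>x. (U x)\<^sup>2) x)"
        using conv_sq_le[OF U U2, of x] by simp
    qed
  qed measurable
  have "(\<integral>x. (conv \<rho> U x)\<^sup>2 \<partial>lborel) \<le> (\<integral>x. conv \<rho> (\<lambda>x. (U x)\<^sup>2) x \<partial>lborel)"
    using conv_sq_le[OF U U2] conv_integrable[OF U2] by (intro integral_mono 1) auto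
  then show "(\<integral>x. (conv \<rho> U x)\<^sup>2 \<partial>lborel) \<le> (\<integral>x. (U x)\<^sup>2 \<partial>lborel)" using conv_integrable[OF U2] by simp
qed

lemma conv_uniform_close:
  assumes g: "integrable lborel g" and d: "\<And>z. norm (x - z) \<le> \<delta> \<Longrightarrow> \<bar>g z - g x\<bar> \<le> e"
  shows "\<bar>conv \<rho> g x - g x\<bar> \<le> e"
proof -
  have i: "integrable lborel (\<lambda>z. (g z - g x) * \<rho> (x - z))"
    using integrable_conv_integrand[OF g, of x] integrable_shift(1)[of x] by (simp add: left_diff_distrib)
  have "conv \<rho> g x - g x = (\<integral>z. g z * \<rho> (x - z) - g x * \<rho> (x - z) \<partial>lborel)"
    using integrable_conv_integrand[OF g, of x] integrable_shift(1)[of x] by (simp add: conv_def integral_shift)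
  also have "\<dots> = (\<integral>z. (g z - g x) * \<rho> (x - z) \<partial>lborel)" by (simp add: left_diff_distrib)
  also have "\<bar>\<dots>\<bar> \<le> (\<integral>z. e * \<rho> (x - z) \<partial>lborel)"
  proof (rule integral_norm_bound[THEN order_trans, of lborel "\<lambda>z. (g z - g x) * \<rho> (x - z)", unfolded real_norm_def], rule integral_mono)
    show "integrable lborel (\<lambda>z. \<bar>(g z - g x) * \<rho> (x - z)\<bar>)" using i by auto
    show "integrable lborel (\<lambda>z. e * \<rho> (x - z))" using integrable_shift(1) by auto
    show "\<bar>(g z - g x) * \<rho> (x - z)\<bar> \<le> e * \<rho> (x - z)" for z
      using d[of z] support[of "x - z"] nonneg[of "x - z"]
      by (cases "norm (x - z) \<le> \<delta>") (auto simp: abs_mult mult_right_mono)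
  qed
  also have "\<dots> = e" by (simp add: integral_shift)
  finally show ?thesis by simp
qed

end

text \<open>The threshold depends on \<open>U\<close> alone, not on the kernel. A continuous
  \<open>g\<close> with compact support replaces \<open>U\<close>; as mollification does not
  increase the \<open>L^1\<close> norm, this replacement costs a third of \<open>e\<close> before
  and a third after mollification.\<close>

lemma conv_L1_approx:
  assumes U: "integrable lborel U" and e: "e > 0"
  obtains d where "d > 0" "\<And>\<rho> \<delta>. mollifier \<rho> \<delta> \<Longrightarrow> \<delta> < d \<Longrightarrow> (\<integral>x. \<bar>conv \<rho> U x - U x\<bar> \<partial>lborel) \<le> e"
proof -
  obtain g R where g: "continuous_on UNIV g" "\<And>x. norm x > R \<Longrightarrow> g x = 0" "R > 0" "(\<integral>x. \<bar>U x - g x\<bar> \<partial>lborel) \<le> e / 3"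
    using L1_compact_support_approx[OF U, of "e / 3"] e by auto
  have gi: "integrable lborel g"
    by (rule integrable_continuous_compact_support[OF g(1), of "cball 0 R"]) (use g in auto)
  let ?K = "cball 0 (R + 1) :: (real^2) set"
  define v where "v = measure lborel ?K"
  have v: "v \<ge> 0" by (simp add: v_def)
  obtain d where d: "d > 0" "\<And>x y. norm (x - y) < d \<Longrightarrow> norm (g x - g y) < e / (3 * (v + 1))"
    by (rule uniformly_continuous_compact_support[where R=R, OF g(1), of "e / (3 * (v + 1))"])
      (use g e v in \<open>auto intro!: divide_pos_pos\<close>)
  show ?thesis
  proof (rule that[of "min d 1"])
    show "min d 1 > 0" using d by simp
    fix \<rho> \<delta> assume m: "mollifier \<rho> \<delta>" and \<delta>: "\<delta> < min d 1"
    interpret mollifier \<rho> \<delta> by (rule m)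
    have dg: "integrable lborel (\<lambda>x. U x - g x)" using U gi by auto
    have iK: "integrable lborel (\<lambda>x. e / (3 * (v + 1)) * indicator ?K x)"
      by (intro integrable_mult_right integrable_real_indicator emeasure_lborel_cball_finite) auto
    have pt: "\<bar>conv \<rho> g x - g x\<bar> \<le> e / (3 * (v + 1)) * indicator ?K x" for x
    proof (cases "x \<in> ?K")
      case True
      have "\<bar>conv \<rho> g x - g x\<bar> \<le> e / (3 * (v + 1))"
      proof (rule conv_uniform_close[OF gi])
        fix z assume "norm (x - z) \<le> \<delta>"
        then show "\<bar>g z - g x\<bar> \<le> e / (3 * (v + 1))"
          using d(2)[of z x] \<delta> by (simp add: norm_minus_commute)
      qed
      then show ?thesis using True by simp
    next
      case False
      have "\<bar>conv \<rho> g x - g x\<bar> \<le> 0"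
      proof (rule conv_uniform_close[OF gi])
        fix z assume z: "norm (x - z) \<le> \<delta>"
        have "norm x > R + 1" using False by simp
        moreover have "norm x \<le> norm z + norm (x - z)" by (metis norm_triangle_sub add.commute)
        ultimately have "norm z > R" "norm x > R" using z \<delta> by auto
        then show "\<bar>g z - g x\<bar> \<le> 0" using g(2) by simp
      qed
      then show ?thesis using False by simp
    qed
    have i1: "integrable lborel (\<lambda>x. \<bar>conv \<rho> g x - g x\<bar>)" using conv_integrable[OF gi] gi by auto
    have i2: "integrable lborel (\<lambda>x. \<bar>conv \<rho> (\<lambda>x. U x - g x) x\<bar>)" using conv_integrable[OF dg] by auto
    have i3: "integrable lborel (\<lambda>x. \<bar>U x - g x\<bar>)" using dg by auto
    have I1: "(\<integral>x. \<bar>conv \<rho> g x - g x\<bar> \<partial>lborel) \<le> e / 3"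
    proof -
      have "(\<integral>x. \<bar>conv \<rho> g x - g x\<bar> \<partial>lborel) \<le> (\<integral>x. e / (3 * (v + 1)) * indicator ?K x \<partial>lborel)"
        by (rule integral_mono[OF i1 iK pt])
      also have "\<dots> = e / (3 * (v + 1)) * v" by (simp add: v_def)
      also have "\<dots> \<le> e / 3" using e v by (simp add: field_simps)
      finally show ?thesis .
    qed
    have "\<bar>conv \<rho> U x - U x\<bar> \<le> \<bar>conv \<rho> (\<lambda>x. U x - g x) x\<bar> + \<bar>conv \<rho> g x - g x\<bar> + \<bar>U x - g x\<bar>" for x
    proof -
      have "conv \<rho> (\<lambda>x. U x - g x) x = conv \<rho> U x - conv \<rho> g x"
        using integrable_conv_integrand[OF U, of x] integrable_conv_integrand[OF gi, of x]
        by (simp add: conv_def left_diff_distrib)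
      then show ?thesis by linarith
    qed
    then have "(\<integral>x. \<bar>conv \<rho> U x - U x\<bar> \<partial>lborel)
        \<le> (\<integral>x. \<bar>conv \<rho> (\<lambda>x. U x - g x) x\<bar> + \<bar>conv \<rho> g x - g x\<bar> + \<bar>U x - g x\<bar> \<partial>lborel)"
      using i1 i2 i3 conv_integrable[OF U] U by (intro integral_mono) auto
    also have "\<dots> = (\<integral>x. \<bar>conv \<rho> (\<lambda>x. U x - g x) x\<bar> \<partial>lborel) + (\<integral>x. \<bar>conv \<rho> g x - g x\<bar> \<partial>lborel) + (\<integral>x. \<bar>U x - g x\<bar> \<partial>lborel)"
      using Bochner_Integration.integral_add[OF Bochner_Integration.integrable_add[OF i2 i1] i3]
        Bochner_Integration.integral_add[OF i2 i1] by simp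
    also have "\<dots> \<le> e" using conv_L1_le[OF dg] I1 g(4) by linarith
    finally show "(\<integral>x. \<bar>conv \<rho> U x - U x\<bar> \<partial>lborel) \<le> e" .
  qed
qed

section \<open>Maps with a weak Jacobian\<close>

lemma C1_grad_reflect:
  assumes f: "C1_grad f f'" shows "C1_grad (\<lambda>z. f (x - z)) (\<lambda>z. - f' (x - z))"
proof (rule C1_gradI)
  fix z
  have "((\<lambda>z. x - z) has_derivative (\<lambda>h. - h)) (at z)" by (auto intro!: derivative_eq_intros)
  from has_derivative_compose[OF this C1_grad_derivative[OF f, of "x - z" UNIV]]
  show "((\<lambda>z. f (x - z)) has_derivative (\<lambda>h. (- f' (x - z)) \<bullet> h)) (at z)" by simp
next
  show "continuous_on UNIV (\<lambda>z. - f' (x - z))"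
    by (intro continuous_on_minus continuous_on_compose2[OF C1_grad_continuous_grad[OF f, of UNIV]])
      (auto intro!: continuous_intros)
qed

lemma conv_component:
  fixes F :: "real^2 \<Rightarrow> real^2"
  assumes "integrable lborel U" "continuous_on UNIV F" "\<And>x. norm (F x) \<le> B"
  shows "conv F U x $ j = conv (\<lambda>x. F x $ j) U x"
  unfolding conv_def
  using integral_bounded_linear[OF bounded_linear_vec_nth[of j] integrable_conv[OF assms, of x]] by simp

text \<open>Two orders of derivatives are recorded because \<open>smooth_energy_bound\<close> needs
  second derivatives of the second component of a map, and their symmetry. The last property allows
  the kernel centred at \<open>x\<close> to be tested against a weak derivative.\<close>

lemma smooth_mollifier_exists:
  fixes \<delta> :: real
  assumes \<delta>: "\<delta> > 0"
  obtains \<rho> \<rho>' \<rho>1 \<rho>2 where "mollifier \<rho> \<delta>" "C1_grad \<rho> \<rho>'"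
    "C1_grad (\<lambda>x. \<rho>' x $ 1) \<rho>1" "C1_grad (\<lambda>x. \<rho>' x $ 2) \<rho>2" "\<And>x. \<rho>1 x $ 2 = \<rho>2 x $ 1"
    "\<And>x S. cball x \<delta> \<subseteq> S \<Longrightarrow> (\<lambda>z. \<rho> (x - z)) \<in> test_functions S"
proof -
  define \<beta> where "\<beta> = bump 0 0 0 \<delta> 0"
  have \<beta>: "\<beta> x = flat_exp 0 (\<delta>\<^sup>2 - (norm x)\<^sup>2)" for x by (simp add: \<beta>_def bump_def)
  have \<beta>0: "\<beta> x = 0" if "norm x \<ge> \<delta>" for x unfolding \<beta>_def using that \<delta> by (intro bump_outside) auto
  have \<beta>nn: "\<beta> x \<ge> 0" for x by (simp add: \<beta> flat_exp_def)
  have \<beta>c: "continuous_on UNIV \<beta>" unfolding \<beta>_def by (rule C1_grad_continuous[OF C1_grad_bump])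
  have \<beta>i: "integrable lborel \<beta>"
    by (rule integrable_continuous_compact_support[OF \<beta>c, of "cball 0 \<delta>"]) (use \<beta>0 in auto)
  define I where "I = (\<integral>x. \<beta> x \<partial>lborel)"
  have "I \<noteq> 0"
  proof
    assume "I = 0"
    then have "AE x in lborel. \<beta> x = 0"
      using integral_nonneg_eq_0_iff_AE[OF \<beta>i] \<beta>nn by (simp add: I_def)
    then have "AE x in lborel. x \<notin> ball (0::real^2) \<delta>"
    proof eventually_elim
      case (elim x)
      then have "\<not> 0 < \<delta>\<^sup>2 - (norm x)\<^sup>2" by (auto simp: \<beta> flat_exp_def)
      then show ?case using \<delta> by (auto simp: power_strict_mono)
    qed
    then have "ball (0::real^2) \<delta> \<in> null_sets lborel" by (subst AE_iff_null_sets) auto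
    then have "measure lborel (ball (0::real^2) \<delta>) = 0" by (simp add: measure_eq_0_null_sets)
    moreover have "measure lborel (ball (0::real^2) \<delta>) > 0" by (rule content_ball_pos[OF \<delta>])
    ultimately show False by simp
  qed
  moreover have "I \<ge> 0" unfolding I_def using \<beta>nn by (intro integral_nonneg_AE) auto
  ultimately have I: "I > 0" by simp
  define \<rho> where "\<rho> x = 1 / I * \<beta> x" for x
  let ?b = "\<lambda>k a b. bump k a b \<delta> 0"
  define \<rho>' where "\<rho>' x = (1 / I) *\<^sub>R pair2 (- 2 * ?b 2 1 0 x) (- 2 * ?b 2 0 1 x)" for x
  define B where "B k a b x = pair2 (real a * ?b k (a - 1) b x - 2 * ?b (k + 2) (a + 1) b x + 2 * real k * ?b (k + 1) (a + 1) b x)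
     (real b * ?b k a (b - 1) x - 2 * ?b (k + 2) a (b + 1) x + 2 * real k * ?b (k + 1) a (b + 1) x)" for k a b x
  have B: "C1_grad (?b k a b) (B k a b)" for k a b unfolding B_def[abs_def] by (rule C1_grad_bump)
  show ?thesis
  proof (rule that)
    show "mollifier \<rho> \<delta>"
    proof
      show "continuous_on UNIV \<rho>" unfolding \<rho>_def by (intro continuous_on_mult continuous_on_const \<beta>c)
      show "0 \<le> \<rho> x" for x using \<beta>nn I by (simp add: \<rho>_def)
      show "\<rho> (- x) = \<rho> x" for x by (simp add: \<rho>_def \<beta>)
      show "\<rho> x = 0" if "norm x > \<delta>" for x using \<beta>0[of x] that by (simp add: \<rho>_def)
      show "(\<integral>x. \<rho> x \<partial>lborel) = 1" unfolding \<rho>_def using I by (simp add: I_def)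
    qed
    have "(\<lambda>x. (1 / I) *\<^sub>R B 0 0 0 x) = \<rho>'" by (simp add: \<rho>'_def B_def fun_eq_iff numeral_2_eq_2)
    then show "C1_grad \<rho> \<rho>'"
      using C1_grad_cmult[OF B[of 0 0 0], of "1 / I"] by (simp add: \<rho>_def[abs_def] \<beta>_def)
    have "(\<lambda>x. \<rho>' x $ 1) = (\<lambda>x. - 2 / I * ?b 2 1 0 x)" "(\<lambda>x. \<rho>' x $ 2) = (\<lambda>x. - 2 / I * ?b 2 0 1 x)"
      by (simp_all add: \<rho>'_def)
    then show "C1_grad (\<lambda>x. \<rho>' x $ 1) (\<lambda>x. (- 2 / I) *\<^sub>R B 2 1 0 x)"
      "C1_grad (\<lambda>x. \<rho>' x $ 2) (\<lambda>x. (- 2 / I) *\<^sub>R B 2 0 1 x)"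
      using C1_grad_cmult[OF B[of 2 1 0], of "- 2 / I"] C1_grad_cmult[OF B[of 2 0 1], of "- 2 / I"] by simp_all
    show "((- 2 / I) *\<^sub>R B 2 1 0 x) $ 2 = ((- 2 / I) *\<^sub>R B 2 0 1 x) $ 1" for x
      by (simp add: B_def)
    fix x and S :: "(real^2) set" assume "cball x \<delta> \<subseteq> S"
    moreover have "(\<lambda>z. \<rho> (x - z)) = (\<lambda>z. 1 / I * bump 0 0 0 \<delta> x z)"
      by (simp add: fun_eq_iff \<rho>_def \<beta>_def bump_def norm_minus_commute)
    ultimately show "(\<lambda>z. \<rho> (x - z)) \<in> test_functions S"
      using bump_test_function[OF \<delta>, of x S "1 / I"] by (simp only:)
  qed
qed

text \<open>The smooth bound is applied to mollified maps. As mollification does not increase the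
  norms of the Jacobian, its terms are replaced by those of the given map before the limit is taken.
  Only the left side and the integral of \<open>V\<close> have to converge, and there
  \<open>f\<close>, \<open>g\<close> and \<open>V\<close> are bounded.\<close>

lemma weak_energy_bound_borel:
  fixes U1 U2 :: "real^2 \<Rightarrow> real" and H1 H2 :: "2 \<Rightarrow> real^2 \<Rightarrow> real"
  assumes f: "C1_grad f f'" and g: "C1_grad g g'" and R: "R > 0"
    and fR: "\<And>y. norm y > R \<Longrightarrow> f y = 0" and gR: "\<And>y. norm y > R \<Longrightarrow> g y = 0"
    and V: "continuous_on UNIV V" "\<And>y. 0 \<le> V y" "\<And>y. V y \<le> K"
    and quad: "\<And>y a b. \<bar>f' y $ 2 * a\<^sup>2 - (f' y $ 1 - g' y $ 2) * a * b - g' y $ 1 * b\<^sup>2\<bar> \<le> sqrt (V y) * (a\<^sup>2 + b\<^sup>2)"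
    and A: "\<And>y. \<bar>f' y $ 1 + g' y $ 2\<bar> \<le> 2 * A"
    and z: "C1_grad z z'" and zr: "\<And>x. norm x > r \<Longrightarrow> z x = 0" and r: "r < 1"
    and z0: "\<And>x. 0 \<le> z x" and z1: "\<And>x. z x \<le> 1" and Z: "\<And>x. norm (z' x) \<le> Z"
    and \<epsilon>: "\<epsilon> > 0"
    and U: "integrable lborel U1" "integrable lborel U2"
    and H: "\<And>j. integrable lborel (H1 j)" "\<And>j. integrable lborel (H2 j)"
    and H_sq: "\<And>j. integrable lborel (\<lambda>x. (H1 j x)\<^sup>2)" "\<And>j. integrable lborel (\<lambda>x. (H2 j x)\<^sup>2)"
    and weak1: "\<And>\<phi> j. \<phi> \<in> test_functions unit_disc \<Longrightarrow>
      (\<integral>x. U1 x * pderiv_at j \<phi> x \<partial>lborel) = - (\<integral>x. H1 j x * \<phi> x \<partial>lborel)"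
    and weak2: "\<And>\<phi> j. \<phi> \<in> test_functions unit_disc \<Longrightarrow>
      (\<integral>x. U2 x * pderiv_at j \<phi> x \<partial>lborel) = - (\<integral>x. H2 j x * \<phi> x \<partial>lborel)"
  shows "- (\<integral>x. f (pair2 (U1 x) (U2 x)) * z' x $ 1 + g (pair2 (U1 x) (U2 x)) * z' x $ 2 \<partial>lborel)
    \<le> (1 / \<epsilon> * (\<integral>x. z x * V (pair2 (U1 x) (U2 x)) \<partial>lborel)
        + \<epsilon> * (\<Sum>j\<in>UNIV. (\<integral>x. (H1 j x)\<^sup>2 \<partial>lborel) + (\<integral>x. (H2 j x)\<^sup>2 \<partial>lborel))) / 2
      + A * (\<integral>x. \<bar>H1 1 x + H2 2 x\<bar> \<partial>lborel)
      + \<epsilon> * (4 * (R + 1) * (Z * (\<integral>x. \<bar>H2 1 x\<bar> + \<bar>H2 2 x\<bar> \<partial>lborel)))"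
    (is "- ?L U1 U2 \<le> (1 / \<epsilon> * ?V U1 U2 + \<epsilon> * ?H) / 2 + A * ?T + \<epsilon> * ?J")
proof -
  have A0: "A \<ge> 0" using A[of 0] by linarith
  have Z0: "Z \<ge> 0" using Z[of 0] norm_ge_zero[of "z' 0"] by linarith
  have zc: "continuous_on UNIV z" by (rule C1_grad_continuous[OF z])
  have zi: "integrable lborel z"
    by (rule integrable_continuous_compact_support[OF zc, of "cball 0 r"]) (use zr in auto)
  have iz: "integrable lborel (\<lambda>x. z x * h x)" if "continuous_on UNIV h" for h :: "real^2 \<Rightarrow> real"
    by (rule integrable_cutoff_mult[of z r h]) (use zc zr that in auto)
  have z'i: "integrable lborel (\<lambda>x. z' x $ i)" for i
    by (rule integrable_gradient[OF z zr])
  have z'0: "z' x = 0" if "norm x > r" for x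
    by (rule C1_grad_outside_support[OF z, of "cball 0 r"]) (use zr that in auto)

  have step: "\<exists>v1 v2. continuous_on UNIV v1 \<and> continuous_on UNIV v2 \<and>
      integrable lborel (\<lambda>x. \<bar>v1 x - U1 x\<bar> + \<bar>v2 x - U2 x\<bar>) \<and>
      (\<integral>x. \<bar>v1 x - U1 x\<bar> + \<bar>v2 x - U2 x\<bar> \<partial>lborel) \<le> e \<and>
      - ?L v1 v2 \<le> (1 / \<epsilon> * ?V v1 v2 + \<epsilon> * ?H) / 2 + A * ?T + \<epsilon> * ?J" if e: "e > 0" for e
  proof -
    obtain d1 where d1: "d1 > 0" "\<And>\<rho> \<delta>. mollifier \<rho> \<delta> \<Longrightarrow> \<delta> < d1 \<Longrightarrow> (\<integral>x. \<bar>conv \<rho> U1 x - U1 x\<bar> \<partial>lborel) \<le> e / 2"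
      by (rule conv_L1_approx[OF U(1), of "e / 2"]) (use e in auto)
    obtain d2 where d2: "d2 > 0" "\<And>\<rho> \<delta>. mollifier \<rho> \<delta> \<Longrightarrow> \<delta> < d2 \<Longrightarrow> (\<integral>x. \<bar>conv \<rho> U2 x - U2 x\<bar> \<partial>lborel) \<le> e / 2"
      by (rule conv_L1_approx[OF U(2), of "e / 2"]) (use e in auto)
    \<comment> \<open>A radius below \<open>1 - r\<close> keeps each kernel centred in the ball of
      radius \<open>r\<close> inside the disc. Only for such centres is the gradient of the
      mollified map known to be the mollified weak Jacobian; elsewhere \<open>z\<close>
      vanishes.\<close>
    define \<delta> where "\<delta> = min (1 - r) (min d1 d2) / 2"
    have \<delta>: "\<delta> > 0" "\<delta> < 1 - r" "\<delta> < d1" "\<delta> < d2" using d1(1) d2(1) r by (auto simp: \<delta>_def min_def)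
    obtain \<rho> \<rho>' \<rho>1 \<rho>2 where m: "mollifier \<rho> \<delta>" and \<rho>: "C1_grad \<rho> \<rho>'"
      and \<rho>1: "C1_grad (\<lambda>x. \<rho>' x $ 1) \<rho>1" and \<rho>2: "C1_grad (\<lambda>x. \<rho>' x $ 2) \<rho>2" and \<rho>s: "\<And>x. \<rho>1 x $ 2 = \<rho>2 x $ 1"
      and test: "\<And>x S. cball x \<delta> \<subseteq> S \<Longrightarrow> (\<lambda>z. \<rho> (x - z)) \<in> test_functions S"
      using smooth_mollifier_exists[OF \<delta>(1)] by blast
    interpret mollifier \<rho> \<delta> by (rule m)
    have \<rho>'0: "\<rho>' x = 0" if "norm x > \<delta>" for x
      by (rule C1_grad_outside_support[OF \<rho>, of "cball 0 \<delta>"]) (use support that in auto)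
    have \<rho>10: "\<rho>1 x = 0" "\<rho>2 x = 0" if "norm x > \<delta>" for x
      using C1_grad_outside_support[OF \<rho>1, of "cball 0 \<delta>" x] C1_grad_outside_support[OF \<rho>2, of "cball 0 \<delta>" x] \<rho>'0 that
      by auto
    obtain B' where B': "\<And>x. norm (\<rho>' x) \<le> B'"
      by (rule continuous_compact_support_bounded[OF C1_grad_continuous_grad[OF \<rho>], of "cball 0 \<delta>"]) (use \<rho>'0 in auto)
    obtain B1 where B1: "\<And>x. norm (\<rho>1 x) \<le> B1"
      by (rule continuous_compact_support_bounded[OF C1_grad_continuous_grad[OF \<rho>1], of "cball 0 \<delta>"]) (use \<rho>10 in auto)
    obtain B2 where B2: "\<And>x. norm (\<rho>2 x) \<le> B2"
      by (rule continuous_compact_support_bounded[OF C1_grad_continuous_grad[OF \<rho>2], of "cball 0 \<delta>"]) (use \<rho>10 in auto)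
    note cc = conv_component[OF _ C1_grad_continuous_grad[OF \<rho>] B']
    have v1: "C1_grad (conv \<rho> U1) (conv \<rho>' U1)" and v2: "C1_grad (conv \<rho> U2) (conv \<rho>' U2)"
      using C1_grad_conv[OF \<rho> support U(1)] C1_grad_conv[OF \<rho> support U(2)] by auto
    have b1: "C1_grad (\<lambda>x. conv \<rho>' U2 x $ 1) (conv \<rho>1 U2)"
      unfolding cc[OF U(2)] by (rule C1_grad_conv[OF \<rho>1 _ U(2), where R=\<delta>]) (use \<rho>'0 in simp)
    have b2: "C1_grad (\<lambda>x. conv \<rho>' U2 x $ 2) (conv \<rho>2 U2)"
      unfolding cc[OF U(2)] by (rule C1_grad_conv[OF \<rho>2 _ U(2), where R=\<delta>]) (use \<rho>'0 in simp)
    have sym: "conv \<rho>1 U2 x $ 2 = conv \<rho>2 U2 x $ 1" for x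
      unfolding conv_component[OF U(2) C1_grad_continuous_grad[OF \<rho>1] B1]
        conv_component[OF U(2) C1_grad_continuous_grad[OF \<rho>2] B2] by (simp add: \<rho>s)
    \<comment> \<open>The minus sign in the definition of the weak derivative cancels the one from
      differentiating the reflected kernel \<open>\<rho> (x - z)\<close> in
      \<open>z\<close>.\<close>
    have weak: "conv \<rho>' u x $ j = conv \<rho> h x"
      if x: "norm x \<le> r" and u: "integrable lborel u"
        and w: "\<And>\<phi>. \<phi> \<in> test_functions unit_disc \<Longrightarrow> (\<integral>x. u x * pderiv_at j \<phi> x \<partial>lborel) = - (\<integral>x. h x * \<phi> x \<partial>lborel)"
      for u h x j
    proof -
      have "cball x \<delta> \<subseteq> unit_disc"
      proof
        fix y assume "y \<in> cball x \<delta>"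
        then have "norm (y - x) \<le> \<delta>" by (simp add: dist_norm norm_minus_commute)
        then have "norm y < 1" using norm_triangle_sub[of y x] x \<delta>(2) by linarith
        then show "y \<in> unit_disc" by simp
      qed
      from w[OF test[OF this]] show ?thesis
        unfolding cc[OF u] pderiv_at_C1_grad[OF C1_grad_reflect[OF \<rho>]] by (simp add: conv_def)
    qed
    have comp: "conv \<rho>' U1 x $ j = conv \<rho> (H1 j) x" "conv \<rho>' U2 x $ j = conv \<rho> (H2 j) x" if "norm x \<le> r" for x j
      using weak[OF that U(1) weak1, of j] weak[OF that U(2) weak2, of j] by auto
    note ci = conv_integrable(1)
    let ?a = "conv \<rho>' U1" and ?b = "conv \<rho>' U2"
    have E: "- ?L (conv \<rho> U1) (conv \<rho> U2)
      \<le> (\<integral>x. z x * (V (pair2 (conv \<rho> U1 x) (conv \<rho> U2 x)) / \<epsilon> + \<epsilon> * ((norm (?a x))\<^sup>2 + (norm (?b x))\<^sup>2)) \<partial>lborel) / 2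
      + A * (\<integral>x. z x * \<bar>?a x $ 1 + ?b x $ 2\<bar> \<partial>lborel)
      + \<epsilon> * (4 * (R + 1) * (\<integral>x. norm (z' x) * norm (?b x) \<partial>lborel))"
      by (rule smooth_energy_bound[OF f g R fR gR V(1,2) quad A z zr z0 v1 v2 b1 b2 sym \<epsilon>])
    have vc: "continuous_on UNIV (\<lambda>x. V (pair2 (conv \<rho> U1 x) (conv \<rho> U2 x)))"
      by (rule continuous_on_compose2[OF V(1)])
        (auto intro!: continuous_on_pair2 C1_grad_continuous[OF v1] C1_grad_continuous[OF v2])
    have nc: "continuous_on UNIV (\<lambda>x. (norm (?a x))\<^sup>2 + (norm (?b x))\<^sup>2)"
      by (intro continuous_intros C1_grad_continuous_grad[OF v1] C1_grad_continuous_grad[OF v2])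
    have E1: "(\<integral>x. z x * (V (pair2 (conv \<rho> U1 x) (conv \<rho> U2 x)) / \<epsilon> + \<epsilon> * ((norm (?a x))\<^sup>2 + (norm (?b x))\<^sup>2)) \<partial>lborel)
      \<le> 1 / \<epsilon> * ?V (conv \<rho> U1) (conv \<rho> U2) + \<epsilon> * ?H"
    proof -
      have "(\<integral>x. z x * (V (pair2 (conv \<rho> U1 x) (conv \<rho> U2 x)) / \<epsilon> + \<epsilon> * ((norm (?a x))\<^sup>2 + (norm (?b x))\<^sup>2)) \<partial>lborel)
        = (\<integral>x. 1 / \<epsilon> * (z x * V (pair2 (conv \<rho> U1 x) (conv \<rho> U2 x))) + \<epsilon> * (z x * ((norm (?a x))\<^sup>2 + (norm (?b x))\<^sup>2)) \<partial>lborel)"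
        by (rule Bochner_Integration.integral_cong) (auto simp: algebra_simps)
      also have "\<dots> = 1 / \<epsilon> * ?V (conv \<rho> U1) (conv \<rho> U2) + \<epsilon> * (\<integral>x. z x * ((norm (?a x))\<^sup>2 + (norm (?b x))\<^sup>2) \<partial>lborel)"
        unfolding Bochner_Integration.integral_add[OF integrable_mult_right[OF iz[OF vc]] integrable_mult_right[OF iz[OF nc]]] by simp
      also have "(\<integral>x. z x * ((norm (?a x))\<^sup>2 + (norm (?b x))\<^sup>2) \<partial>lborel)
        \<le> (\<integral>x. (\<Sum>j\<in>UNIV. (conv \<rho> (H1 j) x)\<^sup>2 + (conv \<rho> (H2 j) x)\<^sup>2) \<partial>lborel)"
      proof (rule integral_mono[OF iz[OF nc]])
        show "integrable lborel (\<lambda>x. \<Sum>j\<in>UNIV. (conv \<rho> (H1 j) x)\<^sup>2 + (conv \<rho> (H2 j) x)\<^sup>2)"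
          by (intro Bochner_Integration.integrable_sum Bochner_Integration.integrable_add conv_L2_le(1) H H_sq)
        fix x
        show "z x * ((norm (?a x))\<^sup>2 + (norm (?b x))\<^sup>2) \<le> (\<Sum>j\<in>UNIV. (conv \<rho> (H1 j) x)\<^sup>2 + (conv \<rho> (H2 j) x)\<^sup>2)"
        proof (cases "norm x \<le> r")
          case True
          have "z x * ((norm (?a x))\<^sup>2 + (norm (?b x))\<^sup>2) \<le> (norm (?a x))\<^sup>2 + (norm (?b x))\<^sup>2"
            using z0 z1 by (intro mult_left_le_one_le) auto
          also have "\<dots> = (\<Sum>j\<in>UNIV. (conv \<rho> (H1 j) x)\<^sup>2 + (conv \<rho> (H2 j) x)\<^sup>2)"
            using comp[OF True] by (simp add: norm_sq_2 sum_2)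
          finally show ?thesis .
        qed (use zr in \<open>auto intro: sum_nonneg\<close>)
      qed
      also have "\<dots> = (\<Sum>j\<in>UNIV. (\<integral>x. (conv \<rho> (H1 j) x)\<^sup>2 \<partial>lborel) + (\<integral>x. (conv \<rho> (H2 j) x)\<^sup>2 \<partial>lborel))"
        by (simp add: Bochner_Integration.integral_sum Bochner_Integration.integral_add
            Bochner_Integration.integrable_add conv_L2_le(1) H H_sq)
      also have "\<dots> \<le> ?H" by (intro sum_mono add_mono conv_L2_le(2) H H_sq)
      finally show ?thesis using \<epsilon> by simp
    qed
    have E2: "(\<integral>x. z x * \<bar>?a x $ 1 + ?b x $ 2\<bar> \<partial>lborel) \<le> ?T"
    proof -
      have Ti: "integrable lborel (\<lambda>x. H1 1 x + H2 2 x)" using H by auto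
      have "(\<integral>x. z x * \<bar>?a x $ 1 + ?b x $ 2\<bar> \<partial>lborel) \<le> (\<integral>x. \<bar>conv \<rho> (\<lambda>x. H1 1 x + H2 2 x) x\<bar> \<partial>lborel)"
      proof (rule integral_mono)
        show "integrable lborel (\<lambda>x. z x * \<bar>?a x $ 1 + ?b x $ 2\<bar>)"
          by (intro iz continuous_intros C1_grad_continuous_grad[OF v1] C1_grad_continuous_grad[OF v2])
        show "integrable lborel (\<lambda>x. \<bar>conv \<rho> (\<lambda>x. H1 1 x + H2 2 x) x\<bar>)" using ci[OF Ti] by auto
        fix x
        show "z x * \<bar>?a x $ 1 + ?b x $ 2\<bar> \<le> \<bar>conv \<rho> (\<lambda>x. H1 1 x + H2 2 x) x\<bar>"
        proof (cases "norm x \<le> r")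
          case True
          have "conv \<rho> (\<lambda>x. H1 1 x + H2 2 x) x = conv \<rho> (H1 1) x + conv \<rho> (H2 2) x"
            using integrable_conv_integrand[OF H(1), of 1 x] integrable_conv_integrand[OF H(2), of 2 x]
            by (simp add: conv_def distrib_right)
          then show ?thesis using comp[OF True] z0 z1 by (simp add: mult_left_le_one_le)
        qed (use zr in auto)
      qed
      also have "\<dots> \<le> ?T" by (rule conv_L1_le[OF Ti])
      finally show ?thesis .
    qed
    have E3: "(\<integral>x. norm (z' x) * norm (?b x) \<partial>lborel) \<le> Z * (\<integral>x. \<bar>H2 1 x\<bar> + \<bar>H2 2 x\<bar> \<partial>lborel)"
    proof -
      have i: "integrable lborel (\<lambda>x. \<bar>conv \<rho> (H2 j) x\<bar>)" for j using ci[OF H(2)] by auto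
      have "(\<integral>x. norm (z' x) * norm (?b x) \<partial>lborel) \<le> (\<integral>x. Z * (\<bar>conv \<rho> (H2 1) x\<bar> + \<bar>conv \<rho> (H2 2) x\<bar>) \<partial>lborel)"
      proof (rule integral_mono)
        show "integrable lborel (\<lambda>x. norm (z' x) * norm (?b x))"
          by (rule integrable_cutoff_mult[of _ r])
            (use z'0 in \<open>auto intro!: continuous_intros C1_grad_continuous_grad[OF z] C1_grad_continuous_grad[OF v2]\<close>)
        show "integrable lborel (\<lambda>x. Z * (\<bar>conv \<rho> (H2 1) x\<bar> + \<bar>conv \<rho> (H2 2) x\<bar>))" using i by auto
        fix x
        show "norm (z' x) * norm (?b x) \<le> Z * (\<bar>conv \<rho> (H2 1) x\<bar> + \<bar>conv \<rho> (H2 2) x\<bar>)"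
        proof (cases "norm x \<le> r")
          case True
          show ?thesis using norm_le_components_2[of "?b x"] comp[OF True] Z Z0 by (intro mult_mono) auto
        qed (use z'0 Z0 in auto)
      qed
      also have "\<dots> = Z * ((\<integral>x. \<bar>conv \<rho> (H2 1) x\<bar> \<partial>lborel) + (\<integral>x. \<bar>conv \<rho> (H2 2) x\<bar> \<partial>lborel))"
        using Bochner_Integration.integral_add[OF i i] by simp
      also have "\<dots> \<le> Z * ((\<integral>x. \<bar>H2 1 x\<bar> \<partial>lborel) + (\<integral>x. \<bar>H2 2 x\<bar> \<partial>lborel))"
        using Z0 by (intro mult_left_mono add_mono conv_L1_le H)
      also have "\<dots> = Z * (\<integral>x. \<bar>H2 1 x\<bar> + \<bar>H2 2 x\<bar> \<partial>lborel)"
        using H by (subst Bochner_Integration.integral_add) auto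
      finally show ?thesis .
    qed
    have "- ?L (conv \<rho> U1) (conv \<rho> U2) \<le> (1 / \<epsilon> * ?V (conv \<rho> U1) (conv \<rho> U2) + \<epsilon> * ?H) / 2 + A * ?T + \<epsilon> * ?J"
    proof -
      note E
      also have "(\<integral>x. z x * (V (pair2 (conv \<rho> U1 x) (conv \<rho> U2 x)) / \<epsilon> + \<epsilon> * ((norm (?a x))\<^sup>2 + (norm (?b x))\<^sup>2)) \<partial>lborel) / 2
          + A * (\<integral>x. z x * \<bar>?a x $ 1 + ?b x $ 2\<bar> \<partial>lborel)
          + \<epsilon> * (4 * (R + 1) * (\<integral>x. norm (z' x) * norm (?b x) \<partial>lborel))
        \<le> (1 / \<epsilon> * ?V (conv \<rho> U1) (conv \<rho> U2) + \<epsilon> * ?H) / 2 + A * ?T + \<epsilon> * ?J"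
        using E1 E2 E3 A0 \<epsilon> R by (intro add_mono divide_right_mono mult_left_mono) auto
      finally show ?thesis .
    qed
    moreover have "integrable lborel (\<lambda>x. \<bar>conv \<rho> U1 x - U1 x\<bar>)" "integrable lborel (\<lambda>x. \<bar>conv \<rho> U2 x - U2 x\<bar>)"
      using ci[OF U(1)] ci[OF U(2)] U by auto
    moreover from this have "(\<integral>x. \<bar>conv \<rho> U1 x - U1 x\<bar> + \<bar>conv \<rho> U2 x - U2 x\<bar> \<partial>lborel) \<le> e"
      using d1(2)[OF m \<delta>(3)] d2(2)[OF m \<delta>(4)] by (subst Bochner_Integration.integral_add) auto
    ultimately show ?thesis
      using C1_grad_continuous[OF v1, of UNIV] C1_grad_continuous[OF v2, of UNIV]
      by (intro exI[of _ "conv \<rho> U1"] exI[of _ "conv \<rho> U2"]) auto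
  qed
  define P where "P e v1 v2 \<longleftrightarrow> continuous_on UNIV v1 \<and> continuous_on UNIV v2 \<and>
      integrable lborel (\<lambda>x. \<bar>v1 x - U1 x\<bar> + \<bar>v2 x - U2 x\<bar>) \<and>
      (\<integral>x. \<bar>v1 x - U1 x\<bar> + \<bar>v2 x - U2 x\<bar> \<partial>lborel) \<le> e \<and>
      - ?L v1 v2 \<le> (1 / \<epsilon> * ?V v1 v2 + \<epsilon> * ?H) / 2 + A * ?T + \<epsilon> * ?J" for e v1 v2
  have "\<exists>v1 v2. P (1 / real (Suc n)) v1 v2" for n
    unfolding P_def by (rule step) simp
  then obtain v1 v2 where P: "\<And>n. P (1 / real (Suc n)) (v1 n) (v2 n)" by metis
  note v = P[unfolded P_def, THEN conjunct1] P[unfolded P_def, THEN conjunct2, THEN conjunct1]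
    P[unfolded P_def, THEN conjunct2, THEN conjunct2, THEN conjunct1]
    P[unfolded P_def, THEN conjunct2, THEN conjunct2, THEN conjunct2, THEN conjunct1]
    P[unfolded P_def, THEN conjunct2, THEN conjunct2, THEN conjunct2, THEN conjunct2]
  have "(\<lambda>n. \<integral>x. norm (\<bar>v1 n x - U1 x\<bar> + \<bar>v2 n x - U2 x\<bar>) \<partial>lborel) \<longlonglongrightarrow> 0"
  proof (rule tendsto_sandwich[OF _ _ tendsto_const])
    show "\<forall>\<^sub>F n in sequentially. 0 \<le> (\<integral>x. norm (\<bar>v1 n x - U1 x\<bar> + \<bar>v2 n x - U2 x\<bar>) \<partial>lborel)" by simp
    show "\<forall>\<^sub>F n in sequentially. (\<integral>x. norm (\<bar>v1 n x - U1 x\<bar> + \<bar>v2 n x - U2 x\<bar>) \<partial>lborel) \<le> 1 / real (Suc n)"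
      using v(4) by (intro always_eventually) (simp add: abs_of_nonneg)
    show "(\<lambda>n. 1 / real (Suc n)) \<longlonglongrightarrow> 0" using LIMSEQ_Suc[OF lim_1_over_n[where ?'a=real]] by simp
  qed
  \<comment> \<open>Along a subsequence the \<open>L^1\<close> convergence becomes convergence
    almost everywhere, so that continuity of \<open>f\<close>, \<open>g\<close> and \<open>V\<close>
    together with their bounds suffices for dominated convergence.\<close>
  from tendsto_L1_AE_subseq[OF v(3) this] obtain s :: "nat \<Rightarrow> nat" where s: "strict_mono s"
    "AE x in lborel. (\<lambda>n. \<bar>v1 (s n) x - U1 x\<bar> + \<bar>v2 (s n) x - U2 x\<bar>) \<longlonglongrightarrow> 0" by blast
  have cv: "(\<lambda>n. F (pair2 (v1 (s n) x) (v2 (s n) x))) \<longlonglongrightarrow> F (pair2 (U1 x) (U2 x))"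
    if F: "continuous_on UNIV F" and x: "(\<lambda>n. \<bar>v1 (s n) x - U1 x\<bar> + \<bar>v2 (s n) x - U2 x\<bar>) \<longlonglongrightarrow> 0" for F :: "real^2 \<Rightarrow> real" and x
  proof -
    have "(\<lambda>n. v1 (s n) x - U1 x) \<longlonglongrightarrow> 0" "(\<lambda>n. v2 (s n) x - U2 x) \<longlonglongrightarrow> 0"
      by (rule Lim_null_comparison[OF _ x]; simp)+
    then have "(\<lambda>n. v1 (s n) x) \<longlonglongrightarrow> U1 x" "(\<lambda>n. v2 (s n) x) \<longlonglongrightarrow> U2 x"
      by (simp_all add: LIM_zero_cancel)
    then have "(\<lambda>n. pair2 (v1 (s n) x) (v2 (s n) x)) \<longlonglongrightarrow> pair2 (U1 x) (U2 x)"
      unfolding pair2_eq by (intro tendsto_intros)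
    from continuous_on_tendsto_compose[OF F this] show ?thesis by simp
  qed
  have meas: "(\<lambda>x. F (pair2 (u1 x) (u2 x))) \<in> borel_measurable lborel"
    if "continuous_on UNIV F" "u1 \<in> borel_measurable borel" "u2 \<in> borel_measurable borel" for F :: "real^2 \<Rightarrow> real" and u1 u2
  proof -
    have "(\<lambda>x. pair2 (u1 x) (u2 x)) \<in> borel_measurable borel"
      unfolding pair2_eq using that by measurable
    from measurable_compose[OF this borel_measurable_continuous_onI[OF that(1)]] show ?thesis by simp
  qed
  note mU = borel_measurable_integrable[OF U(1)] borel_measurable_integrable[OF U(2)]
  note mv = borel_measurable_continuous_onI[OF v(1)] borel_measurable_continuous_onI[OF v(2)]
  note fc = C1_grad_continuous[OF f, of UNIV] and gc = C1_grad_continuous[OF g, of UNIV]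
  obtain Bf where Bf: "Bf > 0" "\<And>y. norm (f y) \<le> Bf"
    by (rule continuous_compact_support_bounded[OF fc, of "cball 0 R"]) (use fR in auto)
  obtain Bg where Bg: "Bg > 0" "\<And>y. norm (g y) \<le> Bg"
    by (rule continuous_compact_support_bounded[OF gc, of "cball 0 R"]) (use gR in auto)
  have lim_L: "(\<lambda>n. ?L (v1 (s n)) (v2 (s n))) \<longlonglongrightarrow> ?L U1 U2"
  proof (rule integral_dominated_convergence[where w="\<lambda>x. Bf * \<bar>z' x $ 1\<bar> + Bg * \<bar>z' x $ 2\<bar>"])
    have [measurable]: "(\<lambda>x. z' x $ i) \<in> borel_measurable lborel" for i using z'i by auto
    have [measurable]: "(\<lambda>x. F (pair2 (U1 x) (U2 x))) \<in> borel_measurable lborel"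
      "(\<lambda>x. F (pair2 (v1 n x) (v2 n x))) \<in> borel_measurable lborel" if "continuous_on UNIV F" for F :: "real^2 \<Rightarrow> real" and n
      by (rule meas[OF that]; use mU mv in simp)+
    show "(\<lambda>x. f (pair2 (U1 x) (U2 x)) * z' x $ 1 + g (pair2 (U1 x) (U2 x)) * z' x $ 2) \<in> borel_measurable lborel"
      "(\<lambda>x. f (pair2 (v1 (s n) x) (v2 (s n) x)) * z' x $ 1 + g (pair2 (v1 (s n) x) (v2 (s n) x)) * z' x $ 2) \<in> borel_measurable lborel" for n
      using fc gc by measurable
    show "integrable lborel (\<lambda>x. Bf * \<bar>z' x $ 1\<bar> + Bg * \<bar>z' x $ 2\<bar>)"
      by (intro Bochner_Integration.integrable_add integrable_mult_right integrable_abs z'i)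
    show "AE x in lborel. (\<lambda>n. f (pair2 (v1 (s n) x) (v2 (s n) x)) * z' x $ 1 + g (pair2 (v1 (s n) x) (v2 (s n) x)) * z' x $ 2)
        \<longlonglongrightarrow> f (pair2 (U1 x) (U2 x)) * z' x $ 1 + g (pair2 (U1 x) (U2 x)) * z' x $ 2"
      using s(2) by eventually_elim (intro tendsto_intros cv fc gc)
    show "AE x in lborel. norm (f (pair2 (v1 (s n) x) (v2 (s n) x)) * z' x $ 1 + g (pair2 (v1 (s n) x) (v2 (s n) x)) * z' x $ 2)
       \<le> Bf * \<bar>z' x $ 1\<bar> + Bg * \<bar>z' x $ 2\<bar>" for n
    proof (rule AE_I2)
      fix x
      let ?y = "pair2 (v1 (s n) x) (v2 (s n) x)"
      have "norm (f ?y * z' x $ 1 + g ?y * z' x $ 2) \<le> \<bar>f ?y\<bar> * \<bar>z' x $ 1\<bar> + \<bar>g ?y\<bar> * \<bar>z' x $ 2\<bar>"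
        by (metis abs_mult abs_triangle_ineq real_norm_def)
      also have "\<dots> \<le> Bf * \<bar>z' x $ 1\<bar> + Bg * \<bar>z' x $ 2\<bar>"
        using Bf(2)[of ?y] Bg(2)[of ?y] by (intro add_mono mult_right_mono) auto
      finally show "norm (f ?y * z' x $ 1 + g ?y * z' x $ 2) \<le> Bf * \<bar>z' x $ 1\<bar> + Bg * \<bar>z' x $ 2\<bar>" .
    qed
  qed
  have lim_V: "(\<lambda>n. ?V (v1 (s n)) (v2 (s n))) \<longlonglongrightarrow> ?V U1 U2"
  proof (rule integral_dominated_convergence[where w="\<lambda>x. K * z x"])
    have [measurable]: "z \<in> borel_measurable lborel" using zi by auto
    have [measurable]: "(\<lambda>x. V (pair2 (U1 x) (U2 x))) \<in> borel_measurable lborel"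
      "(\<lambda>x. V (pair2 (v1 n x) (v2 n x))) \<in> borel_measurable lborel" for n
      by (rule meas[OF V(1)]; use mU mv in simp)+
    show "(\<lambda>x. z x * V (pair2 (U1 x) (U2 x))) \<in> borel_measurable lborel"
      "(\<lambda>x. z x * V (pair2 (v1 (s n) x) (v2 (s n) x))) \<in> borel_measurable lborel" for n
      by measurable
    show "integrable lborel (\<lambda>x. K * z x)" using zi by simp
    show "AE x in lborel. (\<lambda>n. z x * V (pair2 (v1 (s n) x) (v2 (s n) x))) \<longlonglongrightarrow> z x * V (pair2 (U1 x) (U2 x))"
      using s(2) by eventually_elim (intro tendsto_intros cv V(1))
    show "AE x in lborel. norm (z x * V (pair2 (v1 (s n) x) (v2 (s n) x))) \<le> K * z x" for n
      using z0 V(2,3) by (intro AE_I2) (simp add: abs_mult mult.commute[of K] mult_left_mono)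
  qed
  show ?thesis
  proof (rule LIMSEQ_le)
    show "(\<lambda>n. - ?L (v1 (s n)) (v2 (s n))) \<longlonglongrightarrow> - ?L U1 U2" by (intro tendsto_minus lim_L)
    show "(\<lambda>n. (1 / \<epsilon> * ?V (v1 (s n)) (v2 (s n)) + \<epsilon> * ?H) / 2 + A * ?T + \<epsilon> * ?J)
      \<longlonglongrightarrow> (1 / \<epsilon> * ?V U1 U2 + \<epsilon> * ?H) / 2 + A * ?T + \<epsilon> * ?J"
      by (rule tendsto_add[OF tendsto_add[OF tendsto_divide[OF tendsto_add[OF tendsto_mult_left[OF lim_V] tendsto_const] tendsto_const] tendsto_const] tendsto_const]) simp
    show "\<exists>N. \<forall>n\<ge>N. - ?L (v1 (s n)) (v2 (s n)) \<le> (1 / \<epsilon> * ?V (v1 (s n)) (v2 (s n)) + \<epsilon> * ?H) / 2 + A * ?T + \<epsilon> * ?J"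
      using v(5) by blast
  qed
qed


section \<open>From Lebesgue measurable to Borel measurable maps\<close>

text \<open>Translation invariance and Fubini's theorem are used for \<open>lborel\<close>, while
  admissible maps are only Lebesgue measurable on the disc. Hence they are exchanged for Borel
  functions that vanish outside it.\<close>

lemma borel_representative:
  fixes h :: "real^2 \<Rightarrow> real"
  assumes h: "h \<in> borel_measurable (lebesgue_on D)" and D: "D \<in> sets borel"
  obtains h' where "h' \<in> borel_measurable borel" "\<And>x. x \<notin> D \<Longrightarrow> h' x = 0"
    "AE x in lebesgue. x \<in> D \<longrightarrow> h x = h' x"
proof -
  have "(\<lambda>x. indicator D x *\<^sub>R h x) \<in> borel_measurable lebesgue"
    using h D by (subst (asm) borel_measurable_restrict_space_iff) auto
  then obtain g where g: "g \<in> borel_measurable lborel" "AE x in lborel. indicator D x *\<^sub>R h x = g x"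
    using completion_ex_borel_measurable_real by blast
  show ?thesis
  proof (rule that[of "\<lambda>x. indicator D x * g x"])
    show "(\<lambda>x. indicator D x * g x) \<in> borel_measurable borel" using g(1) D by auto
    show "AE x in lebesgue. x \<in> D \<longrightarrow> h x = indicator D x * g x"
      using g(2) by (auto simp: AE_completion_iff elim: AE_mp)
  qed simp
qed

lemma lebesgue_on_transfer:
  fixes F H :: "real^2 \<Rightarrow> real"
  assumes F: "F \<in> borel_measurable (lebesgue_on D)" and D: "D \<in> sets borel"
    and H: "H \<in> borel_measurable borel" "\<And>x. x \<notin> D \<Longrightarrow> H x = 0"
    and FH: "AE x in lebesgue. x \<in> D \<longrightarrow> F x = H x"
  shows "integrable (lebesgue_on D) F \<longleftrightarrow> integrable lborel H"
    and "(LINT x|lebesgue_on D. F x) = (\<integral>x. H x \<partial>lborel)"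
proof -
  have DL: "D \<inter> space lebesgue \<in> sets lebesgue" using D by simp
  have m: "(\<lambda>x. indicator D x *\<^sub>R F x) \<in> borel_measurable lebesgue"
    using F D by (subst (asm) borel_measurable_restrict_space_iff) auto
  have mH: "H \<in> borel_measurable lborel" using H by simp
  have mH': "H \<in> borel_measurable lebesgue" using mH by (rule measurable_completion)
  have ae: "AE x in lebesgue. indicator D x *\<^sub>R F x = H x"
    using FH H(2) by (auto elim!: AE_mp intro!: AE_I2 simp: indicator_def)
  show "integrable (lebesgue_on D) F \<longleftrightarrow> integrable lborel H"
    unfolding integrable_restrict_space[OF DL] integrable_cong_AE[OF m mH' ae]
    by (rule integrable_completion[OF mH])
  show "(LINT x|lebesgue_on D. F x) = (\<integral>x. H x \<partial>lborel)"
    unfolding integral_restrict_space[OF DL] integral_cong_AE[OF m mH' ae]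
    by (rule integral_completion[OF mH])
qed

lemma borel_measurable_component:
  fixes f :: "'a \<Rightarrow> 'b::euclidean_space ^ 2"
  assumes "f \<in> borel_measurable M"
  shows "(\<lambda>x. f x $ i) \<in> borel_measurable M"
proof -
  have "continuous_on UNIV (\<lambda>y::'b^2. y $ i)" by (intro continuous_on_component continuous_on_id)
  from measurable_compose[OF assms borel_measurable_continuous_onI[OF this]] show ?thesis .
qed

lemma norm_sq_matrix_2: "(norm (M :: real^2^2))\<^sup>2 = (\<Sum>j\<in>UNIV. (M $ 1 $ j)\<^sup>2 + (M $ 2 $ j)\<^sup>2)"
  unfolding power2_norm_eq_inner by (simp add: inner_vec_def sum_2 power2_eq_square)

lemma component_le_norm_matrix: "\<bar>(M :: real^2^2) $ i $ j\<bar> \<le> norm M"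
  using component_le_norm_cart[of "M $ i" j] Finite_Cartesian_Product.norm_nth_le[of M i] by linarith

lemma finite_measure_disc: "finite_measure (lebesgue_on unit_disc)"
  by (rule finite_measure_lebesgue_on) (simp add: lmeasurable_ball)

text \<open>Each integral is rewritten for Borel representatives \<open>U\<close> and
  \<open>H\<close> of the components. The transfer requires integrands that vanish off the disc;
  this is provided by \<open>z\<close>, by \<open>z'\<close> or by the representatives
  themselves.\<close>

lemma weak_energy_bound:
  fixes u :: "real^2 \<Rightarrow> real^2"
  assumes f: "C1_grad f f'" and g: "C1_grad g g'" and R: "R > 0"
    and fR: "\<And>y. norm y > R \<Longrightarrow> f y = 0" and gR: "\<And>y. norm y > R \<Longrightarrow> g y = 0"
    and V: "continuous_on UNIV V" "\<And>y. 0 \<le> V y" "\<And>y. V y \<le> K"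
    and quad: "\<And>y a b. \<bar>f' y $ 2 * a\<^sup>2 - (f' y $ 1 - g' y $ 2) * a * b - g' y $ 1 * b\<^sup>2\<bar> \<le> sqrt (V y) * (a\<^sup>2 + b\<^sup>2)"
    and A: "\<And>y. \<bar>f' y $ 1 + g' y $ 2\<bar> \<le> 2 * A"
    and z: "C1_grad z z'" and zr: "\<And>x. norm x > r \<Longrightarrow> z x = 0" and r: "r < 1"
    and z0: "\<And>x. 0 \<le> z x" and z1: "\<And>x. z x \<le> 1" and Z: "\<And>x. norm (z' x) \<le> Z"
    and \<epsilon>: "\<epsilon> > 0"
    and u: "integrable (lebesgue_on unit_disc) u"
    and G: "has_weak_jacobian unit_disc u G"
    and Gm: "G \<in> borel_measurable (lebesgue_on unit_disc)"
    and G_sq: "integrable (lebesgue_on unit_disc) (\<lambda>x. (norm (G x))\<^sup>2)"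
  shows "- (LINT x|lebesgue_on unit_disc. f (u x) * z' x $ 1 + g (u x) * z' x $ 2)
    \<le> (1 / \<epsilon> * (LINT x|lebesgue_on unit_disc. z x * V (u x))
        + \<epsilon> * (LINT x|lebesgue_on unit_disc. (norm (G x))\<^sup>2)) / 2
      + A * (LINT x|lebesgue_on unit_disc. \<bar>trace (G x)\<bar>)
      + \<epsilon> * (4 * (R + 1) * (Z * (LINT x|lebesgue_on unit_disc. \<bar>G x $ 2 $ 1\<bar> + \<bar>G x $ 2 $ 2\<bar>)))"
proof -
  let ?D = "unit_disc" let ?M = "lebesgue_on unit_disc"
  interpret finite_measure ?M by (rule finite_measure_disc)
  have D: "?D \<in> sets borel" by simp
  have um: "(\<lambda>x. u x $ i) \<in> borel_measurable ?M" for i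
    using u by (intro borel_measurable_component) auto
  have Gm': "(\<lambda>x. G x $ i $ j) \<in> borel_measurable ?M" for i j
    by (intro borel_measurable_component Gm)
  have "\<exists>U. \<forall>i. U i \<in> borel_measurable borel \<and> (\<forall>x. x \<notin> ?D \<longrightarrow> U i x = 0) \<and> (AE x in lebesgue. x \<in> ?D \<longrightarrow> u x $ i = U i x)"
  proof (rule choice, rule allI)
    fix i
    obtain h where "h \<in> borel_measurable borel" "\<And>x. x \<notin> ?D \<Longrightarrow> h x = 0" "AE x in lebesgue. x \<in> ?D \<longrightarrow> u x $ i = h x"
      using borel_representative[OF um[of i] D] by blast
    then show "\<exists>h. h \<in> borel_measurable borel \<and> (\<forall>x. x \<notin> ?D \<longrightarrow> h x = 0) \<and> (AE x in lebesgue. x \<in> ?D \<longrightarrow> u x $ i = h x)"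
      by blast
  qed
  then obtain U where U: "\<And>i. U i \<in> borel_measurable borel" "\<And>i x. x \<notin> ?D \<Longrightarrow> U i x = 0"
    "\<And>i. AE x in lebesgue. x \<in> ?D \<longrightarrow> u x $ i = U i x" by blast
  have "\<forall>i. \<exists>H. \<forall>j. H j \<in> borel_measurable borel \<and> (\<forall>x. x \<notin> ?D \<longrightarrow> H j x = 0) \<and> (AE x in lebesgue. x \<in> ?D \<longrightarrow> G x $ i $ j = H j x)"
  proof (rule allI, rule choice, rule allI)
    fix i j
    obtain h where "h \<in> borel_measurable borel" "\<And>x. x \<notin> ?D \<Longrightarrow> h x = 0" "AE x in lebesgue. x \<in> ?D \<longrightarrow> G x $ i $ j = h x"
      using borel_representative[OF Gm'[of i j] D] by blast
    then show "\<exists>h. h \<in> borel_measurable borel \<and> (\<forall>x. x \<notin> ?D \<longrightarrow> h x = 0) \<and> (AE x in lebesgue. x \<in> ?D \<longrightarrow> G x $ i $ j = h x)"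
      by blast
  qed
  from choice[OF this] obtain H where H: "\<And>i j. H i j \<in> borel_measurable borel" "\<And>i j x. x \<notin> ?D \<Longrightarrow> H i j x = 0"
    "\<And>i j. AE x in lebesgue. x \<in> ?D \<longrightarrow> G x $ i $ j = H i j x" by blast
  have uU: "AE x in lebesgue. x \<in> ?D \<longrightarrow> u x = pair2 (U 1 x) (U 2 x)"
    using U(3)[of 1] U(3)[of 2] by eventually_elim (auto simp: vec_eq_iff forall_2)
  have GH: "AE x in lebesgue. x \<in> ?D \<longrightarrow> (\<forall>i j. G x $ i $ j = H i j x)"
    using H(3)[of 1 1] H(3)[of 1 2] H(3)[of 2 1] H(3)[of 2 2] by eventually_elim (auto simp: forall_2)
  have Ui: "integrable lborel (U i)" for i
    using lebesgue_on_transfer(1)[OF um D U(1) U(2) U(3), of i] integrable_bounded_linear[OF bounded_linear_vec_nth u, of i]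
    by auto
  have G1: "integrable ?M (\<lambda>x. G x $ i $ j)" for i j
  proof (rule Bochner_Integration.integrable_bound[of _ "\<lambda>x. 1 + (norm (G x))\<^sup>2"])
    show "AE x in ?M. norm (G x $ i $ j) \<le> norm (1 + (norm (G x))\<^sup>2)"
    proof (rule AE_I2)
      fix x
      have "\<bar>G x $ i $ j\<bar> \<le> norm (G x)" by (rule component_le_norm_matrix)
      also have "\<dots> \<le> 1 + (norm (G x))\<^sup>2"
      proof -
        have "2 * norm (G x) \<le> 1 + (norm (G x))\<^sup>2"
          using zero_le_power2[of "norm (G x) - 1"] by (simp add: power2_diff)
        then show ?thesis using norm_ge_zero[of "G x"] by linarith
      qed
      finally show "norm (G x $ i $ j) \<le> norm (1 + (norm (G x))\<^sup>2)" by simp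
    qed
  qed (use G_sq Gm' in auto)
  have G2: "integrable ?M (\<lambda>x. (G x $ i $ j)\<^sup>2)" for i j
  proof (rule Bochner_Integration.integrable_bound[OF G_sq])
    show "(\<lambda>x. (G x $ i $ j)\<^sup>2) \<in> borel_measurable ?M" using Gm' by auto
    show "AE x in ?M. norm ((G x $ i $ j)\<^sup>2) \<le> norm ((norm (G x))\<^sup>2)"
      using power_mono[OF component_le_norm_matrix abs_ge_zero, where n=2] by auto
  qed
  have Hi: "integrable lborel (H i j)" for i j
    using lebesgue_on_transfer(1)[OF Gm' D H(1) H(2) H(3), of i j] G1 by auto
  have H2: "integrable lborel (\<lambda>x. (H i j x)\<^sup>2)" "(LINT x|?M. (G x $ i $ j)\<^sup>2) = (\<integral>x. (H i j x)\<^sup>2 \<partial>lborel)" for i j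
  proof -
    have ae: "AE x in lebesgue. x \<in> ?D \<longrightarrow> (G x $ i $ j)\<^sup>2 = (H i j x)\<^sup>2" using GH by eventually_elim auto
    have m: "(\<lambda>x. (G x $ i $ j)\<^sup>2) \<in> borel_measurable ?M" using Gm' by auto
    have "(\<lambda>x. (H i j x)\<^sup>2) \<in> borel_measurable borel" using H(1) by auto
    from lebesgue_on_transfer[OF m D this _ ae] H(2) G2[of i j]
    show "integrable lborel (\<lambda>x. (H i j x)\<^sup>2)" "(LINT x|?M. (G x $ i $ j)\<^sup>2) = (\<integral>x. (H i j x)\<^sup>2 \<partial>lborel)" by auto
  qed
  have weak: "(\<integral>x. U i x * pderiv_at j \<phi> x \<partial>lborel) = - (\<integral>x. H i j x * \<phi> x \<partial>lborel)"
    if \<phi>: "\<phi> \<in> test_functions unit_disc" for i j \<phi>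
  proof -
    have "\<forall>n. \<phi> \<in> C_space n" using \<phi> by (simp add: test_functions_def)
    then have "\<phi> \<in> C_space 0" "\<phi> \<in> C_space (Suc 0)" by blast+
    then have c: "continuous_on UNIV \<phi>" "continuous_on UNIV (pderiv_at j \<phi>)" by auto
    note mb = c[THEN borel_measurable_continuous_onI]
    have mL: "\<phi> \<in> borel_measurable ?M" "pderiv_at j \<phi> \<in> borel_measurable ?M"
      by (rule measurable_restrict_space1, rule measurable_completion, use mb in simp)+
    have "(\<integral>x. U i x * pderiv_at j \<phi> x \<partial>lborel) = (LINT x|?M. u x $ i * pderiv_at j \<phi> x)"
    proof (rule lebesgue_on_transfer(2)[symmetric, OF _ D])
      show "(\<lambda>x. u x $ i * pderiv_at j \<phi> x) \<in> borel_measurable ?M" using um mL by auto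
      show "(\<lambda>x. U i x * pderiv_at j \<phi> x) \<in> borel_measurable borel" using U(1) mb by auto
      show "AE x in lebesgue. x \<in> ?D \<longrightarrow> u x $ i * pderiv_at j \<phi> x = U i x * pderiv_at j \<phi> x"
        using U(3)[of i] by eventually_elim auto
    qed (use U(2) in auto)
    also have "\<dots> = - (LINT x|?M. G x $ i $ j * \<phi> x)"
      using G \<phi> unfolding has_weak_jacobian_def by blast
    also have "(LINT x|?M. G x $ i $ j * \<phi> x) = (\<integral>x. H i j x * \<phi> x \<partial>lborel)"
    proof (rule lebesgue_on_transfer(2)[OF _ D])
      show "(\<lambda>x. G x $ i $ j * \<phi> x) \<in> borel_measurable ?M" using Gm' mL by auto
      show "(\<lambda>x. H i j x * \<phi> x) \<in> borel_measurable borel" using H(1) mb by auto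
      show "AE x in lebesgue. x \<in> ?D \<longrightarrow> G x $ i $ j * \<phi> x = H i j x * \<phi> x"
        using H(3)[of i j] by eventually_elim auto
    qed (use H(2) in auto)
    finally show ?thesis .
  qed
  have z'0: "z' x = 0" if "x \<notin> ?D" for x
    by (rule C1_grad_outside_support[OF z, of "cball 0 r"]) (use zr r that in auto)
  have zD: "z x = 0" if "x \<notin> ?D" for x using zr[of x] r that by auto
  note fc = C1_grad_continuous[OF f, of UNIV] and gc = C1_grad_continuous[OF g, of UNIV]
  have um': "u \<in> borel_measurable ?M" using u by auto
  have Um: "(\<lambda>x. pair2 (U 1 x) (U 2 x)) \<in> borel_measurable borel"
    unfolding pair2_eq using U(1) by measurable
  have cm: "(\<lambda>x. h (u x)) \<in> borel_measurable ?M" "(\<lambda>x. h (pair2 (U 1 x) (U 2 x))) \<in> borel_measurable borel"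
    if "continuous_on UNIV h" for h :: "real^2 \<Rightarrow> real"
    using measurable_compose[OF um' borel_measurable_continuous_onI[OF that]]
      measurable_compose[OF Um borel_measurable_continuous_onI[OF that]] by auto
  have hm: "h \<in> borel_measurable borel" "h \<in> borel_measurable ?M" if "continuous_on UNIV h" for h :: "real^2 \<Rightarrow> real"
  proof -
    show 1: "h \<in> borel_measurable borel" by (rule borel_measurable_continuous_onI[OF that])
    show "h \<in> borel_measurable ?M"
      by (rule measurable_restrict_space1, rule measurable_completion, use 1 in simp)
  qed
  have z'm: "continuous_on UNIV (\<lambda>x. z' x $ i)" for i
    by (rule continuous_on_component[OF C1_grad_continuous_grad[OF z]])
  have zm: "continuous_on UNIV z" by (rule C1_grad_continuous[OF z])
  have L: "(LINT x|?M. f (u x) * z' x $ 1 + g (u x) * z' x $ 2)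
    = (\<integral>x. f (pair2 (U 1 x) (U 2 x)) * z' x $ 1 + g (pair2 (U 1 x) (U 2 x)) * z' x $ 2 \<partial>lborel)"
  proof (rule lebesgue_on_transfer(2)[OF _ D])
    show "(\<lambda>x. f (u x) * z' x $ 1 + g (u x) * z' x $ 2) \<in> borel_measurable ?M"
      by (intro borel_measurable_add borel_measurable_times cm fc gc hm z'm)
    show "(\<lambda>x. f (pair2 (U 1 x) (U 2 x)) * z' x $ 1 + g (pair2 (U 1 x) (U 2 x)) * z' x $ 2) \<in> borel_measurable borel"
      by (intro borel_measurable_add borel_measurable_times cm fc gc hm z'm)
    show "AE x in lebesgue. x \<in> ?D \<longrightarrow> f (u x) * z' x $ 1 + g (u x) * z' x $ 2
        = f (pair2 (U 1 x) (U 2 x)) * z' x $ 1 + g (pair2 (U 1 x) (U 2 x)) * z' x $ 2"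
      using uU by eventually_elim auto
  qed (use z'0 in auto)
  have LV: "(LINT x|?M. z x * V (u x)) = (\<integral>x. z x * V (pair2 (U 1 x) (U 2 x)) \<partial>lborel)"
  proof (rule lebesgue_on_transfer(2)[OF _ D])
    show "(\<lambda>x. z x * V (u x)) \<in> borel_measurable ?M"
      by (intro borel_measurable_times cm hm zm V(1))
    show "(\<lambda>x. z x * V (pair2 (U 1 x) (U 2 x))) \<in> borel_measurable borel"
      by (intro borel_measurable_times cm hm zm V(1))
    show "AE x in lebesgue. x \<in> ?D \<longrightarrow> z x * V (u x) = z x * V (pair2 (U 1 x) (U 2 x))"
      using uU by eventually_elim auto
  qed (use zD in auto)
  have LT: "(LINT x|?M. \<bar>trace (G x)\<bar>) = (\<integral>x. \<bar>H 1 1 x + H 2 2 x\<bar> \<partial>lborel)"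
  proof (rule lebesgue_on_transfer(2)[OF _ D])
    show "(\<lambda>x. \<bar>trace (G x)\<bar>) \<in> borel_measurable ?M"
      unfolding trace_def sum_2 by (intro borel_measurable_abs borel_measurable_add Gm')
    show "(\<lambda>x. \<bar>H 1 1 x + H 2 2 x\<bar>) \<in> borel_measurable borel"
      by (intro borel_measurable_abs borel_measurable_add H(1))
    show "AE x in lebesgue. x \<in> ?D \<longrightarrow> \<bar>trace (G x)\<bar> = \<bar>H 1 1 x + H 2 2 x\<bar>"
      using GH by eventually_elim (auto simp: trace_def sum_2)
  qed (use H(2) in auto)
  have LJ: "(LINT x|?M. \<bar>G x $ 2 $ 1\<bar> + \<bar>G x $ 2 $ 2\<bar>) = (\<integral>x. \<bar>H 2 1 x\<bar> + \<bar>H 2 2 x\<bar> \<partial>lborel)"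
  proof (rule lebesgue_on_transfer(2)[OF _ D])
    show "(\<lambda>x. \<bar>G x $ 2 $ 1\<bar> + \<bar>G x $ 2 $ 2\<bar>) \<in> borel_measurable ?M"
      by (intro borel_measurable_abs borel_measurable_add Gm')
    show "(\<lambda>x. \<bar>H 2 1 x\<bar> + \<bar>H 2 2 x\<bar>) \<in> borel_measurable borel"
      by (intro borel_measurable_abs borel_measurable_add H(1))
    show "AE x in lebesgue. x \<in> ?D \<longrightarrow> \<bar>G x $ 2 $ 1\<bar> + \<bar>G x $ 2 $ 2\<bar> = \<bar>H 2 1 x\<bar> + \<bar>H 2 2 x\<bar>"
      using GH by eventually_elim auto
  qed (use H(2) in auto)
  have LG: "(LINT x|?M. (norm (G x))\<^sup>2) = (\<Sum>j\<in>UNIV. (\<integral>x. (H 1 j x)\<^sup>2 \<partial>lborel) + (\<integral>x. (H 2 j x)\<^sup>2 \<partial>lborel))"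
    unfolding norm_sq_matrix_2 H2(2)[symmetric] using G2
    by (simp add: Bochner_Integration.integral_sum Bochner_Integration.integral_add Bochner_Integration.integrable_add)
  show ?thesis
    unfolding L LV LT LJ LG
    by (rule weak_energy_bound_borel[OF f g R fR gR V quad A z zr r z0 z1 Z \<epsilon> Ui Ui Hi Hi H2(1) H2(1) weak weak])
qed

section \<open>The energy of admissible families\<close>

lemma ennreal_half_eq:
  assumes "N / 2 = ennreal e" "e \<ge> 0" shows "N = ennreal (2 * e)"
proof (cases N)
  case (real r)
  have "ennreal (r / 2) = ennreal e"
    using assms(1) real divide_ennreal[of r 2] by simp
  then have "r / 2 = e" using real assms(2) by (subst (asm) ennreal_inj) auto
  then show ?thesis using real by auto
next
  case top
  then show ?thesis using assms(1) by (simp add: ennreal_top_divide)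
qed

text \<open>Measurability on the disc is obtained from an exhaustion by closed discs. It is needed
  because the Jacobian in the energy is an arbitrary choice, about which at first only local
  integrability is known.\<close>

lemma locally_integrable_disc_measurable:
  fixes G :: "real^2 \<Rightarrow> 'b::{banach, second_countable_topology}"
  assumes "locally_integrable unit_disc G"
  shows "G \<in> borel_measurable (lebesgue_on unit_disc)"
proof -
  define K where "K n = cball (0::real^2) (1 - 1 / real (Suc n))" for n
  have Km: "(\<lambda>x. indicator (K n) x *\<^sub>R G x) \<in> borel_measurable lebesgue" for n
  proof -
    have "K n \<subseteq> unit_disc"
    proof
      fix x assume "x \<in> K n"
      then have "norm x \<le> 1 - 1 / real (Suc n)" by (simp add: K_def)
      also have "\<dots> < 1" by simp
      finally show "x \<in> unit_disc" by simp
    qed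
    then have "integrable (lebesgue_on (K n)) G"
      using assms by (auto simp: locally_integrable_def K_def)
    then have "G \<in> borel_measurable (lebesgue_on (K n))" by auto
    then show ?thesis by (subst (asm) borel_measurable_restrict_space_iff) (auto simp: K_def)
  qed
  have "(\<lambda>x. indicator unit_disc x *\<^sub>R G x) \<in> borel_measurable lebesgue"
  proof (rule borel_measurable_LIMSEQ_metric[OF Km])
    fix x :: "real^2"
    show "(\<lambda>n. indicator (K n) x *\<^sub>R G x) \<longlonglongrightarrow> indicator unit_disc x *\<^sub>R G x"
    proof (cases "norm x < 1")
      case True
      have "(\<lambda>n. 1 / real (Suc n)) \<longlonglongrightarrow> 0" using LIMSEQ_Suc[OF lim_1_over_n[where ?'a=real]] by simp
      then have "\<forall>\<^sub>F n in sequentially. 1 / real (Suc n) < 1 - norm x"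
        by (rule order_tendstoD) (use True in simp)
      then have "\<forall>\<^sub>F n in sequentially. indicator (K n) x *\<^sub>R G x = indicator unit_disc x *\<^sub>R G x"
        by eventually_elim (use True in \<open>auto simp: K_def indicator_def\<close>)
      then show ?thesis by (rule tendsto_eventually)
    next
      case False
      have "x \<notin> K n" for n
      proof
        assume "x \<in> K n"
        then have "norm x \<le> 1 - 1 / real (Suc n)" by (simp add: K_def)
        also have "\<dots> < 1" by simp
        finally show False using False by simp
      qed
      then show ?thesis using False by simp
    qed
  qed
  then show ?thesis by (subst borel_measurable_restrict_space_iff) auto
qed

lemma square_integrable_disc_integrable:
  fixes u :: "real^2 \<Rightarrow> 'b::{banach, second_countable_topology}"
  assumes "square_integrable unit_disc u"
  shows "integrable (lebesgue_on unit_disc) u"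
proof -
  interpret finite_measure "lebesgue_on unit_disc" by (rule finite_measure_disc)
  show ?thesis
  proof (rule Bochner_Integration.integrable_bound[of _ "\<lambda>x. 1 + (norm (u x))\<^sup>2"])
    show "AE x in lebesgue_on unit_disc. norm (u x) \<le> norm (1 + (norm (u x))\<^sup>2)"
    proof (rule AE_I2)
      fix x
      have "2 * norm (u x) \<le> 1 + (norm (u x))\<^sup>2"
        using zero_le_power2[of "norm (u x) - 1"] by (simp add: power2_diff)
      then have "norm (u x) \<le> 1 + (norm (u x))\<^sup>2" using norm_ge_zero[of "u x"] by linarith
      then show "norm (u x) \<le> norm (1 + (norm (u x))\<^sup>2)" by simp
    qed
  qed (use assms in \<open>auto simp: square_integrable_def\<close>)
qed

text \<open>Finiteness of the energy makes the chosen weak Jacobian square integrable, which brings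
  it within reach of \<open>weak_energy_bound\<close>. The determinant error is
  \<open>\<epsilon>\<close> times an \<open>L^1\<close> norm of the Jacobian and thus of order
  \<open>sqrt \<epsilon>\<close> as long as the energy stays bounded.\<close>

lemma energy_lower_bound:
  assumes f: "C1_grad f f'" and g: "C1_grad g g'" and R: "R > 0"
    and fR: "\<And>y. norm y > R \<Longrightarrow> f y = 0" and gR: "\<And>y. norm y > R \<Longrightarrow> g y = 0"
    and V: "continuous_on UNIV V" "\<And>y. 0 \<le> V y" "\<And>y. V y \<le> K"
    and quad: "\<And>y a b. \<bar>f' y $ 2 * a\<^sup>2 - (f' y $ 1 - g' y $ 2) * a * b - g' y $ 1 * b\<^sup>2\<bar> \<le> sqrt (V y) * (a\<^sup>2 + b\<^sup>2)"
    and A: "\<And>y. \<bar>f' y $ 1 + g' y $ 2\<bar> \<le> 2 * A"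
    and z: "C1_grad z z'" and zr: "\<And>x. norm x > r \<Longrightarrow> z x = 0" and r: "r < 1"
    and z0: "\<And>x. 0 \<le> z x" and z1: "\<And>x. z x \<le> 1" and Z: "\<And>x. norm (z' x) \<le> Z"
    and \<epsilon>: "\<epsilon> > 0" and W: "continuous_on UNIV W" and VW: "\<And>y. V y \<le> W y"
    and u: "u \<in> W12 unit_disc" and e: "energy W \<epsilon> u unit_disc = ennreal e" "0 \<le> e"
  shows "integrable (lebesgue_on unit_disc) (weak_div unit_disc u)"
    and "- (LINT x|lebesgue_on unit_disc. f (u x) * z' x $ 1 + g (u x) * z' x $ 2)
      \<le> e + A * (LINT x|lebesgue_on unit_disc. \<bar>weak_div unit_disc u x\<bar>)
        + sqrt \<epsilon> * (4 * (R + 1) * Z * (measure lebesgue unit_disc + 2 * e))"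
proof -
  let ?M = "lebesgue_on unit_disc"
  interpret finite_measure ?M by (rule finite_measure_disc)
  define G where "G = weak_jacobian unit_disc u"
  have G: "has_weak_jacobian unit_disc u G"
  proof -
    have "\<exists>G. has_weak_jacobian unit_disc u G" using u by (auto simp: W12_def)
    then show ?thesis unfolding G_def weak_jacobian_def by (rule someI_ex)
  qed
  then have Gm: "G \<in> borel_measurable ?M"
    unfolding has_weak_jacobian_def by (intro locally_integrable_disc_measurable) blast
  have ui: "integrable ?M u"
    using u by (intro square_integrable_disc_integrable) (auto simp: W12_def)
  then have um: "u \<in> borel_measurable ?M" by auto
  have Wm: "(\<lambda>x. W (u x)) \<in> borel_measurable ?M" and Vm: "(\<lambda>x. V (u x)) \<in> borel_measurable ?M"
    using measurable_compose[OF um borel_measurable_continuous_onI[OF W]]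
      measurable_compose[OF um borel_measurable_continuous_onI[OF V(1)]] by auto
  have zm: "z \<in> borel_measurable ?M"
    using borel_measurable_continuous_onI[OF C1_grad_continuous[OF z]]
    by (intro measurable_restrict_space1 measurable_completion) simp
  have W0: "0 \<le> W y" for y using V(2)[of y] VW[of y] by linarith
  define F where "F x = \<epsilon> * (norm (G x))\<^sup>2 + 1 / \<epsilon> * W (u x)" for x
  have F0: "0 \<le> F x" for x unfolding F_def using \<epsilon> W0[of "u x"] by simp
  have Fm: "F \<in> borel_measurable ?M" unfolding F_def using Gm Wm by measurable
  have N: "(\<integral>\<^sup>+ x. ennreal (F x) \<partial>?M) = ennreal (2 * e)"
    using e unfolding energy_def F_def G_def by (intro ennreal_half_eq) auto
  have Fi: "integrable ?M F"
    by (rule integrableI_nn_integral_finite[OF Fm _ N]) (use F0 e in auto)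
  have FI: "(LINT x|?M. F x) = 2 * e"
    using nn_integral_eq_integral[OF Fi] F0 N e(2) by (simp add: integral_nonneg_AE ennreal_inj)
  have G_sq: "integrable ?M (\<lambda>x. (norm (G x))\<^sup>2)"
  proof (rule Bochner_Integration.integrable_bound[of _ "\<lambda>x. F x / \<epsilon>"])
    show "AE x in ?M. norm ((norm (G x))\<^sup>2) \<le> norm (F x / \<epsilon>)"
    proof (rule AE_I2)
      fix x
      have "\<epsilon> * (norm (G x))\<^sup>2 \<le> F x" unfolding F_def using \<epsilon> W0[of "u x"] by simp
      then show "norm ((norm (G x))\<^sup>2) \<le> norm (F x / \<epsilon>)" using \<epsilon> F0[of x] by (simp add: pos_le_divide_eq mult.commute)
    qed
  qed (use Fi Gm in auto)
  have Wi: "integrable ?M (\<lambda>x. W (u x))"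
  proof (rule Bochner_Integration.integrable_bound[of _ "\<lambda>x. \<epsilon> * F x"])
    show "AE x in ?M. norm (W (u x)) \<le> norm (\<epsilon> * F x)"
    proof (rule AE_I2)
      fix x
      have "\<epsilon> * F x = \<epsilon> * \<epsilon> * (norm (G x))\<^sup>2 + W (u x)" unfolding F_def using \<epsilon> by (simp add: field_simps)
      then show "norm (W (u x)) \<le> norm (\<epsilon> * F x)" using \<epsilon> W0[of "u x"] F0[of x] by simp
    qed
  qed (use Fi Wm in auto)
  have Gsq: "square_integrable unit_disc G" using Gm G_sq by (simp add: square_integrable_def)
  have Gi: "integrable ?M G" by (rule square_integrable_disc_integrable[OF Gsq])
  have Gij: "integrable ?M (\<lambda>x. G x $ i $ j)" for i j
    using integrable_bounded_linear[OF bounded_linear_vec_nth integrable_bounded_linear[OF bounded_linear_vec_nth Gi]] by blast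
  have wd: "weak_div unit_disc u = (\<lambda>x. trace (G x))" by (simp add: fun_eq_iff weak_div_def G_def)
  show "integrable ?M (weak_div unit_disc u)"
    unfolding wd trace_def sum_2 by (intro Bochner_Integration.integrable_add Gij)
  have E1: "(1 / \<epsilon> * (LINT x|?M. z x * V (u x)) + \<epsilon> * (LINT x|?M. (norm (G x))\<^sup>2)) / 2 \<le> e"
  proof -
    have zV: "0 \<le> z x * V (u x)" "z x * V (u x) \<le> W (u x)" for x
      using z0[of x] V(2)[of "u x"] mult_left_le_one_le[of "V (u x)" "z x"] z1[of x] VW[of "u x"] by auto
    have "(LINT x|?M. z x * V (u x)) \<le> (LINT x|?M. W (u x))"
    proof (rule integral_mono[OF _ Wi zV(2)])
      show "integrable ?M (\<lambda>x. z x * V (u x))"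
        by (rule Bochner_Integration.integrable_bound[OF Wi])
          (use zV zm Vm W0 in \<open>auto intro!: borel_measurable_times AE_I2 simp: abs_of_nonneg\<close>)
    qed
    then have "1 / \<epsilon> * (LINT x|?M. z x * V (u x)) + \<epsilon> * (LINT x|?M. (norm (G x))\<^sup>2)
        \<le> 1 / \<epsilon> * (LINT x|?M. W (u x)) + \<epsilon> * (LINT x|?M. (norm (G x))\<^sup>2)"
      using \<epsilon> by (intro add_mono mult_left_mono) auto
    also have "\<dots> = (LINT x|?M. F x)" unfolding F_def using Wi G_sq by simp
    finally show ?thesis using FI by simp
  qed
  have E2: "\<epsilon> * (LINT x|?M. \<bar>G x $ 2 $ 1\<bar> + \<bar>G x $ 2 $ 2\<bar>) \<le> sqrt \<epsilon> * (measure lebesgue unit_disc + 2 * e)"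
  proof -
    have Hi: "integrable ?M (\<lambda>x. \<bar>G x $ 2 $ 1\<bar> + \<bar>G x $ 2 $ 2\<bar>)"
      by (intro Bochner_Integration.integrable_add integrable_abs Gij)
    have "\<epsilon> * (LINT x|?M. \<bar>G x $ 2 $ 1\<bar> + \<bar>G x $ 2 $ 2\<bar>) = (LINT x|?M. \<epsilon> * (\<bar>G x $ 2 $ 1\<bar> + \<bar>G x $ 2 $ 2\<bar>))" by simp
    also have "\<dots> \<le> (LINT x|?M. sqrt \<epsilon> * (1 + F x))"
    proof (rule integral_mono)
      show "integrable ?M (\<lambda>x. \<epsilon> * (\<bar>G x $ 2 $ 1\<bar> + \<bar>G x $ 2 $ 2\<bar>))" by (rule integrable_mult_right[OF Hi])
      show "integrable ?M (\<lambda>x. sqrt \<epsilon> * (1 + F x))" using Fi by auto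
      fix x
      define n where "n = norm (G x)"
      \<comment> \<open>Only one of the two factors \<open>t\<close> of \<open>\<epsilon>\<close> is
        kept; the other is joined to \<open>n\<close>, and \<open>2 * (t * n)\<close> is at most
        \<open>1\<close> plus the energy density.\<close>
      define t where "t = sqrt \<epsilon>"
      have t: "t > 0" "\<epsilon> = t * t" using \<epsilon> by (auto simp: t_def)
      have "\<bar>G x $ 2 $ 1\<bar> + \<bar>G x $ 2 $ 2\<bar> \<le> 2 * n"
        using component_le_norm_matrix[of "G x" 2 1] component_le_norm_matrix[of "G x" 2 2] by (simp add: n_def)
      then have "\<epsilon> * (\<bar>G x $ 2 $ 1\<bar> + \<bar>G x $ 2 $ 2\<bar>) \<le> \<epsilon> * (2 * n)" using \<epsilon> by simp
      also have "\<dots> = t * (2 * (t * n))" by (simp add: t(2))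
      also have "\<dots> \<le> t * (1 + (t * n)\<^sup>2)"
        using zero_le_power2[of "t * n - 1"] t(1) by (intro mult_left_mono) (auto simp: power2_diff)
      also have "(t * n)\<^sup>2 = \<epsilon> * n\<^sup>2" by (simp add: t(2) power_mult_distrib power2_eq_square)
      also have "t * (1 + \<epsilon> * n\<^sup>2) \<le> t * (1 + F x)"
        using t \<epsilon> W0[of "u x"] by (intro mult_left_mono) (auto simp: F_def n_def)
      finally show "\<epsilon> * (\<bar>G x $ 2 $ 1\<bar> + \<bar>G x $ 2 $ 2\<bar>) \<le> sqrt \<epsilon> * (1 + F x)" by (simp add: t_def)
    qed
    also have "\<dots> = sqrt \<epsilon> * (measure lebesgue unit_disc + 2 * e)"
      using Fi FI by (simp add: measure_restrict_space)
    finally show ?thesis .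
  qed
  have "0 \<le> Z" using Z[of 0] norm_ge_zero[of "z' 0"] by linarith
  then have RZ: "0 \<le> 4 * (R + 1) * Z" using R by simp
  have "- (LINT x|?M. f (u x) * z' x $ 1 + g (u x) * z' x $ 2)
    \<le> (1 / \<epsilon> * (LINT x|?M. z x * V (u x)) + \<epsilon> * (LINT x|?M. (norm (G x))\<^sup>2)) / 2
      + A * (LINT x|?M. \<bar>trace (G x)\<bar>)
      + \<epsilon> * (4 * (R + 1) * (Z * (LINT x|?M. \<bar>G x $ 2 $ 1\<bar> + \<bar>G x $ 2 $ 2\<bar>)))"
    by (rule weak_energy_bound[OF f g R fR gR V quad A z zr r z0 z1 Z \<epsilon> ui G Gm G_sq])
  moreover have "\<epsilon> * (4 * (R + 1) * (Z * (LINT x|?M. \<bar>G x $ 2 $ 1\<bar> + \<bar>G x $ 2 $ 2\<bar>)))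
      = 4 * (R + 1) * Z * (\<epsilon> * (LINT x|?M. \<bar>G x $ 2 $ 1\<bar> + \<bar>G x $ 2 $ 2\<bar>))" by simp
  moreover have "4 * (R + 1) * Z * (\<epsilon> * (LINT x|?M. \<bar>G x $ 2 $ 1\<bar> + \<bar>G x $ 2 $ 2\<bar>))
      \<le> 4 * (R + 1) * Z * (sqrt \<epsilon> * (measure lebesgue unit_disc + 2 * e))"
    by (rule mult_left_mono[OF E2 RZ])
  moreover have "4 * (R + 1) * Z * (sqrt \<epsilon> * (measure lebesgue unit_disc + 2 * e))
      = sqrt \<epsilon> * (4 * (R + 1) * Z * (measure lebesgue unit_disc + 2 * e))" by simp
  ultimately show "- (LINT x|?M. f (u x) * z' x $ 1 + g (u x) * z' x $ 2)
      \<le> e + A * (LINT x|?M. \<bar>weak_div unit_disc u x\<bar>)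
        + sqrt \<epsilon> * (4 * (R + 1) * Z * (measure lebesgue unit_disc + 2 * e))"
    using E1 unfolding wd by linarith
qed

text \<open>In place of Hoelder's inequality: where \<open>\<bar>F x\<bar>\<close> exceeds
  \<open>\<eta>\<close>, it is at most \<open>\<eta> powr (1 - s) * \<bar>F x\<bar> powr s\<close>.
  The free parameter \<open>\<eta>\<close> is chosen later to balance the two terms.\<close>

lemma L1_le_Ls_norm:
  assumes F: "integrable (lebesgue_on unit_disc) F" and s: "s > 1" and \<theta>: "0 \<le> \<theta>" and \<eta>: "0 < \<eta>"
    and L: "Ls_norm s unit_disc F \<le> ennreal \<theta>"
  shows "(LINT x|lebesgue_on unit_disc. \<bar>F x\<bar>) \<le> \<eta> * measure lebesgue unit_disc + \<eta> powr (1 - s) * \<theta> powr s"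
proof -
  let ?M = "lebesgue_on unit_disc"
  interpret finite_measure ?M by (rule finite_measure_disc)
  define N where "N = (\<integral>\<^sup>+ x. ennreal (\<bar>F x\<bar> powr s) \<partial>?M)"
  have Nfin: "N \<noteq> \<infinity>" using L unfolding Ls_norm_def Let_def N_def[symmetric] by (auto simp: top_unique)
  then obtain i where i: "i \<ge> 0" "N = ennreal i" by (cases N) auto
  have "i powr (1 / s) \<le> \<theta>"
    using L Nfin i \<theta> unfolding Ls_norm_def Let_def N_def[symmetric] by (simp add: ennreal_le_iff)
  then have "(i powr (1 / s)) powr s \<le> \<theta> powr s" using s by (intro powr_mono2) auto
  then have i\<theta>: "i \<le> \<theta> powr s" using s i by (simp add: powr_powr)
  have m: "(\<lambda>x. \<bar>F x\<bar> powr s) \<in> borel_measurable ?M" using F by measurable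
  have P: "integrable ?M (\<lambda>x. \<bar>F x\<bar> powr s)"
    by (rule integrableI_nn_integral_finite[OF m]) (use i N_def in auto)
  have PI: "(LINT x|?M. \<bar>F x\<bar> powr s) = i"
    using nn_integral_eq_integral[OF P] i N_def by (simp add: integral_nonneg_AE ennreal_inj)
  have "(LINT x|?M. \<bar>F x\<bar>) \<le> (LINT x|?M. \<eta> + \<eta> powr (1 - s) * \<bar>F x\<bar> powr s)"
  proof (rule integral_mono)
    show "integrable ?M (\<lambda>x. \<bar>F x\<bar>)" using F by auto
    show "integrable ?M (\<lambda>x. \<eta> + \<eta> powr (1 - s) * \<bar>F x\<bar> powr s)" using P by auto
    fix x
    show "\<bar>F x\<bar> \<le> \<eta> + \<eta> powr (1 - s) * \<bar>F x\<bar> powr s"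
    proof (cases "\<bar>F x\<bar> \<le> \<eta>")
      case True
      have "0 \<le> \<eta> powr (1 - s) * \<bar>F x\<bar> powr s" by simp
      then show ?thesis using True by linarith
    next
      case False
      have "1 = \<eta> powr (1 - s) * \<eta> powr (s - 1)" using \<eta> by (simp flip: powr_add)
      also have "\<dots> \<le> \<eta> powr (1 - s) * \<bar>F x\<bar> powr (s - 1)"
        using False \<eta> s by (intro mult_left_mono powr_mono2) auto
      finally have "\<bar>F x\<bar> * 1 \<le> \<bar>F x\<bar> * (\<eta> powr (1 - s) * \<bar>F x\<bar> powr (s - 1))" by (intro mult_left_mono) auto
      also have "\<dots> = \<eta> powr (1 - s) * \<bar>F x\<bar> powr s"
        using False \<eta> by (simp add: powr_diff)
      finally show ?thesis using \<eta> by simp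
    qed
  qed
  also have "\<dots> = \<eta> * measure lebesgue unit_disc + \<eta> powr (1 - s) * i"
    using P PI by (simp add: measure_restrict_space)
  also have "\<dots> \<le> \<eta> * measure lebesgue unit_disc + \<eta> powr (1 - s) * \<theta> powr s"
    using mult_left_mono[OF i\<theta>, of "\<eta> powr (1 - s)"] by simp
  finally show ?thesis .
qed

text \<open>The gradient \<open>z'\<close> has integral zero over the plane, so only the jumps of
  \<open>f\<close> and \<open>g\<close> across the line matter. The jump of \<open>g\<close> meets
  \<open>z' $ 2\<close>, whose integral over the half plane vanishes. The flux of
  \<open>z' $ 1\<close> is estimated from one side only, hence the hypothesis on the sign of the
  jump of \<open>f\<close>.\<close>

lemma jump_integral:
  assumes f: "C1_grad f f'" and g: "C1_grad g g'"
    and z: "C1_grad z z'" and zr: "\<And>x. norm x > r \<Longrightarrow> z x = 0" and r: "r < 1" and z0: "\<And>x. 0 \<le> z x"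
    and z1: "\<And>x. norm x \<le> r1 \<Longrightarrow> z x = 1" and L: "0 < L" "L < r1" and fa: "f am \<le> f ap"
  shows "2 * L * (f ap - f am)
    \<le> - (LINT x|lebesgue_on unit_disc. f (jump_map am ap x) * z' x $ 1 + g (jump_map am ap x) * z' x $ 2)"
proof -
  let ?M = "lebesgue_on unit_disc"
  define h :: "real^2 \<Rightarrow> real" where "h x = indicator {x. x $ 1 > 0} x" for x
  have H: "{x::real^2. x $ 1 > 0} \<in> sets borel"
    by (intro borel_open open_Collect_less continuous_intros)
  have z'i: "integrable lborel (\<lambda>x. z' x $ i)" for i by (rule integrable_gradient[OF z zr])
  have hi: "integrable lborel (\<lambda>x. h x * z' x $ i)" for i
    unfolding h_def using H integrable_real_mult_indicator[OF _ z'i[of i], of "{x::real^2. x $ 1 > 0}"]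
    by (simp add: mult.commute)
  have zero: "(\<integral>x. z' x $ i \<partial>lborel) = 0" for i
    by (rule integral_gradient_eq_0[OF z, of "cball 0 r"]) (use zr in auto)
  have eq: "f (jump_map am ap x) * z' x $ 1 + g (jump_map am ap x) * z' x $ 2
    = (f am * z' x $ 1 + (f ap - f am) * (h x * z' x $ 1)) + (g am * z' x $ 2 + (g ap - g am) * (h x * z' x $ 2))" for x
    by (simp add: jump_map_def h_def algebra_simps)
  have i: "integrable lborel (\<lambda>x. c * z' x $ j + d * (h x * z' x $ j))" for c d j
    by (intro Bochner_Integration.integrable_add integrable_mult_right z'i hi)
  have v: "(\<integral>x. c * z' x $ j + d * (h x * z' x $ j) \<partial>lborel) = d * (\<integral>x. h x * z' x $ j \<partial>lborel)" for c d j
    using Bochner_Integration.integral_add[OF integrable_mult_right[OF z'i[of j], of c] integrable_mult_right[OF hi[of j], of d]]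
      zero by simp
  have m: "(\<lambda>x. f (jump_map am ap x) * z' x $ 1 + g (jump_map am ap x) * z' x $ 2) \<in> borel_measurable borel"
    unfolding eq using borel_measurable_integrable[OF Bochner_Integration.integrable_add[OF i i]] by simp
  have "(LINT x|?M. f (jump_map am ap x) * z' x $ 1 + g (jump_map am ap x) * z' x $ 2)
      = (\<integral>x. f (jump_map am ap x) * z' x $ 1 + g (jump_map am ap x) * z' x $ 2 \<partial>lborel)"
  proof (rule lebesgue_on_transfer(2)[OF _ _ m])
    show "(\<lambda>x. f (jump_map am ap x) * z' x $ 1 + g (jump_map am ap x) * z' x $ 2) \<in> borel_measurable ?M"
      by (intro measurable_restrict_space1 measurable_completion) (use m in simp)
    fix x assume "x \<notin> unit_disc"
    then have "z' x = 0"
      by (intro C1_grad_outside_support[OF z, of "cball 0 r"]) (use zr r in auto)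
    then show "f (jump_map am ap x) * z' x $ 1 + g (jump_map am ap x) * z' x $ 2 = 0" by simp
  qed auto
  also have "\<dots> = (f ap - f am) * (\<integral>x. h x * z' x $ 1 \<partial>lborel) + (g ap - g am) * (\<integral>x. h x * z' x $ 2 \<partial>lborel)"
    unfolding eq Bochner_Integration.integral_add[OF i i] v ..
  also have "\<dots> \<le> (f ap - f am) * (- 2 * L)"
  proof -
    have "(\<integral>x. h x * z' x $ 2 \<partial>lborel) = 0" "(\<integral>x. h x * z' x $ 1 \<partial>lborel) \<le> - 2 * L"
      unfolding h_def using half_plane_cutoff[OF z zr z0 z1 L] by auto
    then show ?thesis using fa mult_left_mono[of "\<integral>x. h x * z' x $ 1 \<partial>lborel" "- 2 * L" "f ap - f am"] by simp
  qed
  finally show ?thesis by (simp add: mult_ac)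
qed


text \<open>The argument is by contradiction at a fixed small \<open>\<epsilon>\<close>: an energy
  below \<open>c\<close> is finite and bounded independently of \<open>\<epsilon>\<close>, as the
  error terms require. With \<open>\<gamma>\<close> the gap between \<open>c\<close> and the
  weighted jump, the errors from the distance to the jump map, from the divergence and from the
  determinant each use at most a quarter of \<open>\<gamma>\<close>.\<close>

lemma eventually_energy_ge:
  fixes u :: "real \<Rightarrow> real^2 \<Rightarrow> real^2"
  assumes f: "C1_grad f f'" and g: "C1_grad g g'" and R: "R > 0"
    and fR: "\<And>y. norm y > R \<Longrightarrow> f y = 0" and gR: "\<And>y. norm y > R \<Longrightarrow> g y = 0"
    and V: "continuous_on UNIV V" "\<And>y. 0 \<le> V y" "\<And>y. V y \<le> K"
    and quad: "\<And>y a b. \<bar>f' y $ 2 * a\<^sup>2 - (f' y $ 1 - g' y $ 2) * a * b - g' y $ 1 * b\<^sup>2\<bar> \<le> sqrt (V y) * (a\<^sup>2 + b\<^sup>2)"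
    and W: "continuous_on UNIV W" and VW: "\<And>y. V y \<le> W y"
    and u: "u \<in> admissible am ap" and fa: "f am \<le> f ap"
    and L: "0 < L" "L < 1" and c: "c < 2 * L * (f ap - f am)"
  shows "\<forall>\<^sub>F \<epsilon> in at_right 0. ennreal c \<le> energy W \<epsilon> (u \<epsilon>) unit_disc"
proof -
  let ?M = "lebesgue_on unit_disc"
  let ?u0 = "jump_map am ap"
  define P where "P = measure lebesgue unit_disc"
  have P0: "P \<ge> 0" by (simp add: P_def)
  interpret finite_measure ?M by (rule finite_measure_disc)
  \<comment> \<open>The two radii divide the interval from \<open>L\<close> to \<open>1\<close> into
    thirds.\<close>
  define r1 where "r1 = (2 * L + 1) / 3"
  define r where "r = (L + 2) / 3"
  have r: "L < r1" "r1 < r" "r < 1" "0 \<le> r1" using L by (auto simp: r1_def r_def)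
  obtain z z' where z: "C1_grad z z'" "\<And>x. 0 \<le> z x" "\<And>x. z x \<le> 1"
    "\<And>x. norm x \<le> r1 \<Longrightarrow> z x = 1" "\<And>x. norm x > r \<Longrightarrow> z x = 0"
    using radial_cutoff[OF r(4,2)] by blast
  have z'0: "z' x = 0" if "norm x > r" for x
    by (rule C1_grad_outside_support[OF z(1), of "cball 0 r"]) (use z(5) that in auto)
  obtain Z where Z: "Z > 0" "\<And>x. norm (z' x) \<le> Z"
    by (rule continuous_compact_support_bounded[OF C1_grad_continuous_grad[OF z(1)], of "cball 0 r"]) (use z'0 in auto)
  have f'R: "f' y = 0" and g'R: "g' y = 0" if "norm y > R" for y
    using C1_grad_outside_support[OF f, of "cball 0 R" y] C1_grad_outside_support[OF g, of "cball 0 R" y] fR gR that by auto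
  obtain Bf where Bf: "Bf > 0" "\<And>y. norm (f' y) \<le> Bf"
    by (rule continuous_compact_support_bounded[OF C1_grad_continuous_grad[OF f], of "cball 0 R"]) (use f'R in auto)
  obtain Bg where Bg: "Bg > 0" "\<And>y. norm (g' y) \<le> Bg"
    by (rule continuous_compact_support_bounded[OF C1_grad_continuous_grad[OF g], of "cball 0 R"]) (use g'R in auto)
  obtain Cf where Cf: "\<And>y. norm (f y) \<le> Cf"
    by (rule continuous_compact_support_bounded[OF C1_grad_continuous[OF f], of "cball 0 R"]) (use fR in auto)
  obtain Cg where Cg: "\<And>y. norm (g y) \<le> Cg"
    by (rule continuous_compact_support_bounded[OF C1_grad_continuous[OF g], of "cball 0 R"]) (use gR in auto)
  define A where "A = (Bf + Bg) / 2"
  have A: "\<bar>f' y $ 1 + g' y $ 2\<bar> \<le> 2 * A" for y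
  proof -
    have "\<bar>f' y $ 1 + g' y $ 2\<bar> \<le> Bf + Bg"
      using component_le_norm_cart[of "f' y" 1] component_le_norm_cart[of "g' y" 2] Bf(2)[of y] Bg(2)[of y]
      by linarith
    then show ?thesis by (simp add: A_def)
  qed
  have A0: "A > 0" using Bf Bg by (simp add: A_def)
  define \<gamma> where "\<gamma> = 2 * L * (f ap - f am) - c"
  have \<gamma>: "\<gamma> > 0" using c by (simp add: \<gamma>_def)
  obtain \<tau> s where \<tau>: "\<tau> > 0" and s: "s > 2" and div: "((\<lambda>\<epsilon>. ennreal (\<epsilon> powr (- \<tau>)) * Ls_norm s unit_disc (weak_div unit_disc (u \<epsilon>))) \<longlongrightarrow> 0) (at_right 0)"
    and conv: "((\<lambda>\<epsilon>. LINT x|?M. norm (u \<epsilon> x - ?u0 x)) \<longlongrightarrow> 0) (at_right 0)"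
    and W12: "\<And>\<epsilon>. \<epsilon> > 0 \<Longrightarrow> u \<epsilon> \<in> W12 unit_disc"
    using u by (auto simp: admissible_def)
  \<comment> \<open>\<open>\<eta>\<close> and then \<open>\<theta>\<close> are chosen so that each
    of the two terms in \<open>L1_le_Ls_norm\<close> is at most \<open>\<gamma> / (8 * A)\<close>;
    after multiplication by \<open>A\<close> the divergence error is at most a quarter of
    \<open>\<gamma>\<close>.\<close>
  define \<eta> where "\<eta> = \<gamma> / (8 * A) / (P + 1)"
  have \<eta>: "\<eta> > 0" unfolding \<eta>_def using \<gamma> A0 P0 by (auto intro!: divide_pos_pos mult_pos_pos)
  define \<theta> where "\<theta> = (\<gamma> / (8 * A) / \<eta> powr (1 - s)) powr (1 / s)"
  have \<theta>: "\<theta> > 0" unfolding \<theta>_def using \<gamma> A0 \<eta> by simp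
  have \<theta>s: "\<eta> powr (1 - s) * \<theta> powr s = \<gamma> / (8 * A)"
    unfolding \<theta>_def using s \<gamma> A0 \<eta> by (simp add: powr_powr)
  have \<eta>P: "\<eta> * P \<le> \<gamma> / (8 * A)"
  proof -
    have "P + 1 \<noteq> 0" using P0 by simp
    from nonzero_eq_divide_eq[OF this, of \<eta> "\<gamma> / (8 * A)"]
    have "\<eta> * (P + 1) = \<gamma> / (8 * A)" using \<eta>_def by blast
    then show ?thesis using \<eta> by (simp add: distrib_left)
  qed
  define Q where "Q = 4 * (R + 1) * Z * (P + 2 * \<bar>c\<bar>)"
  have pos: "\<forall>\<^sub>F \<epsilon> in at_right 0. (0::real) < \<epsilon>" by (auto simp: eventually_at_filter)
  have small: "\<forall>\<^sub>F \<epsilon> in at_right 0. \<epsilon> < (1::real)"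
    by (rule order_tendstoD(2)[OF tendsto_ident_at]) simp
  have ev1: "\<forall>\<^sub>F \<epsilon> in at_right 0. (LINT x|?M. norm (u \<epsilon> x - ?u0 x)) < \<gamma> / (4 * ((Bf + Bg) * Z))"
    by (rule order_tendstoD(2)[OF conv]) (use \<gamma> Bf Bg Z in auto)
  have ev2: "\<forall>\<^sub>F \<epsilon> in at_right 0. ennreal (\<epsilon> powr (- \<tau>)) * Ls_norm s unit_disc (weak_div unit_disc (u \<epsilon>)) < ennreal \<theta>"
    by (rule order_tendstoD(2)[OF div]) (use \<theta> in simp)
  have "((\<lambda>\<epsilon>. sqrt \<epsilon> * Q) \<longlongrightarrow> sqrt 0 * Q) (at_right 0)"
    by (intro tendsto_intros tendsto_ident_at)
  then have ev3: "\<forall>\<^sub>F \<epsilon> in at_right 0. sqrt \<epsilon> * Q < \<gamma> / 4"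
    by (rule order_tendstoD(2)) (use \<gamma> in simp)
  show ?thesis
    using pos small ev1 ev2 ev3
  proof eventually_elim
    case (elim \<epsilon>)
    show ?case
    proof (rule ccontr)
      assume "\<not> ennreal c \<le> energy W \<epsilon> (u \<epsilon>) unit_disc"
      then have lt: "energy W \<epsilon> (u \<epsilon>) unit_disc < ennreal c" by simp
      then obtain e where e: "energy W \<epsilon> (u \<epsilon>) unit_disc = ennreal e" "0 \<le> e"
        by (cases "energy W \<epsilon> (u \<epsilon>) unit_disc") (auto simp: top_unique)
      have c0: "c > 0" using lt e by (metis ennreal_eq_0_iff linorder_not_le not_less_zero)
      have ec: "e < c" using lt e by (simp add: ennreal_less_iff)
      let ?v = "u \<epsilon>"
      note elb = energy_lower_bound[OF f g R fR gR V quad A z(1,5) r(3) z(2,3) Z(2) elim(1) W VW W12[OF elim(1)] e]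
      have "Ls_norm s unit_disc (weak_div unit_disc ?v)
          \<le> ennreal (\<epsilon> powr (- \<tau>)) * Ls_norm s unit_disc (weak_div unit_disc ?v)"
      proof -
        have "1 \<le> \<epsilon> powr (- \<tau>)"
          using elim(1,2) \<tau> powr_mono2'[of "- \<tau>" \<epsilon> 1] by simp
        then have "ennreal 1 \<le> ennreal (\<epsilon> powr (- \<tau>))" by (rule ennreal_leI)
        from mult_right_mono[OF this, of "Ls_norm s unit_disc (weak_div unit_disc ?v)"] show ?thesis by simp
      qed
      also have "\<dots> \<le> ennreal \<theta>" using elim(4) by simp
      finally have "(LINT x|?M. \<bar>weak_div unit_disc ?v x\<bar>) \<le> \<eta> * P + \<eta> powr (1 - s) * \<theta> powr s"
        unfolding P_def using s \<theta> \<eta> elb(1) by (intro L1_le_Ls_norm) auto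
      also have "\<dots> \<le> \<gamma> / (4 * A)" using \<eta>P \<theta>s A0 by (simp add: field_simps)
      finally have "A * (LINT x|?M. \<bar>weak_div unit_disc ?v x\<bar>) \<le> A * (\<gamma> / (4 * A))"
        using A0 by (intro mult_left_mono) auto
      then have T2: "A * (LINT x|?M. \<bar>weak_div unit_disc ?v x\<bar>) \<le> \<gamma> / 4" using A0 by simp
      have T3: "sqrt \<epsilon> * (4 * (R + 1) * Z * (P + 2 * e)) \<le> \<gamma> / 4"
      proof -
        have "4 * (R + 1) * Z * (P + 2 * e) \<le> Q"
          unfolding Q_def using ec e(2) R Z(1) by (intro mult_left_mono) auto
        then have "sqrt \<epsilon> * (4 * (R + 1) * Z * (P + 2 * e)) \<le> sqrt \<epsilon> * Q"
          using elim(1) by (intro mult_left_mono) auto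
        then show ?thesis using elim(5) by linarith
      qed
      define I where "I w = (\<lambda>x. f (w x) * z' x $ 1 + g (w x) * z' x $ 2)" for w :: "real^2 \<Rightarrow> real^2"
      have vi: "integrable ?M ?v"
        using W12[OF elim(1)] by (intro square_integrable_disc_integrable) (auto simp: W12_def)
      have u0m: "?u0 \<in> borel_measurable ?M"
      proof -
        have H: "{x::real^2. x $ 1 > 0} \<in> sets borel"
          by (intro borel_open open_Collect_less continuous_intros)
        have "(\<lambda>x. if x \<in> {x::real^2. x $ 1 > 0} then ap else am) \<in> borel_measurable borel"
          using H by measurable
        then have "?u0 \<in> borel_measurable borel" by (simp add: jump_map_def[abs_def])
        then show ?thesis by (intro measurable_restrict_space1 measurable_completion) simp
      qed
      have u0i: "integrable ?M ?u0"
        by (rule integrable_const_bound[of _ "max (norm am) (norm ap)"]) (use u0m in \<open>auto simp: jump_map_def\<close>)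
      have Ii: "integrable ?M (I w)" if "w \<in> borel_measurable ?M" for w
      proof (rule integrable_const_bound[of _ "Cf * Z + Cg * Z"])
        have m: "(\<lambda>x. z' x $ i) \<in> borel_measurable ?M" for i
        proof (intro measurable_restrict_space1 measurable_completion)
          show "(\<lambda>x. z' x $ i) \<in> borel_measurable lborel"
            using borel_measurable_continuous_onI[OF continuous_on_component[OF C1_grad_continuous_grad[OF z(1)]], of i] by simp
        qed
        have m': "(\<lambda>x. h (w x)) \<in> borel_measurable ?M" if "continuous_on UNIV h" for h :: "real^2 \<Rightarrow> real"
          by (rule measurable_compose[OF \<open>w \<in> _\<close> borel_measurable_continuous_onI[OF that]])
        show "I w \<in> borel_measurable ?M"
          unfolding I_def by (intro borel_measurable_add borel_measurable_times m m' C1_grad_continuous[OF f] C1_grad_continuous[OF g])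
        show "AE x in ?M. norm (I w x) \<le> Cf * Z + Cg * Z"
        proof (rule AE_I2)
          fix x
          have "norm (I w x) \<le> \<bar>f (w x)\<bar> * \<bar>z' x $ 1\<bar> + \<bar>g (w x)\<bar> * \<bar>z' x $ 2\<bar>"
            unfolding I_def by (metis abs_mult abs_triangle_ineq real_norm_def)
          also have "\<dots> \<le> Cf * Z + Cg * Z"
            using Cf[of "w x"] Cg[of "w x"] component_le_norm_cart[of "z' x" 1] component_le_norm_cart[of "z' x" 2] Z(2)[of x]
            by (intro add_mono mult_mono) (auto intro: order_trans[OF abs_ge_zero])
          finally show "norm (I w x) \<le> Cf * Z + Cg * Z" .
        qed
      qed
      have nd: "integrable ?M (\<lambda>x. norm (?v x - ?u0 x))"
        using vi u0i by (intro integrable_norm Bochner_Integration.integrable_diff)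
      have Iv: "integrable ?M (I ?v)" and I0: "integrable ?M (I ?u0)" using vi u0m by (auto intro: Ii)
      have "(LINT x|?M. I ?v x) - (LINT x|?M. I ?u0 x) = (LINT x|?M. I ?v x - I ?u0 x)"
        by (rule Bochner_Integration.integral_diff[OF Iv I0, symmetric])
      also have "\<dots> \<le> (LINT x|?M. (Bf + Bg) * Z * norm (?v x - ?u0 x))"
      proof (rule integral_mono)
        show "integrable ?M (\<lambda>x. I ?v x - I ?u0 x)" by (rule Bochner_Integration.integrable_diff[OF Iv I0])
        show "integrable ?M (\<lambda>x. (Bf + Bg) * Z * norm (?v x - ?u0 x))" using nd by (rule integrable_mult_right)
        fix x
        let ?n = "norm (?v x - ?u0 x)"
        have "\<bar>f (?v x) - f (?u0 x)\<bar> \<le> Bf * ?n" "\<bar>g (?v x) - g (?u0 x)\<bar> \<le> Bg * ?n"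
          by (rule C1_grad_mvt[OF f Bf(2)] C1_grad_mvt[OF g Bg(2)])+
        moreover have "\<bar>z' x $ 1\<bar> \<le> Z" "\<bar>z' x $ 2\<bar> \<le> Z"
          using component_le_norm_cart[of "z' x" 1] component_le_norm_cart[of "z' x" 2] Z(2)[of x] by linarith+
        ultimately have "\<bar>(f (?v x) - f (?u0 x)) * z' x $ 1\<bar> \<le> Bf * ?n * Z" "\<bar>(g (?v x) - g (?u0 x)) * z' x $ 2\<bar> \<le> Bg * ?n * Z"
          unfolding abs_mult using Bf(1) Bg(1) by (auto intro!: mult_mono)
        moreover have "I ?v x - I ?u0 x = (f (?v x) - f (?u0 x)) * z' x $ 1 + (g (?v x) - g (?u0 x)) * z' x $ 2"
          by (simp add: I_def algebra_simps)
        ultimately have "I ?v x - I ?u0 x \<le> Bf * ?n * Z + Bg * ?n * Z" by linarith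
        also have "\<dots> = (Bf + Bg) * Z * ?n" by (simp add: algebra_simps)
        finally show "I ?v x - I ?u0 x \<le> (Bf + Bg) * Z * ?n" .
      qed
      also have "\<dots> = (Bf + Bg) * Z * (LINT x|?M. norm (?v x - ?u0 x))" by simp
      also have "\<dots> \<le> (Bf + Bg) * Z * (\<gamma> / (4 * ((Bf + Bg) * Z)))"
        using elim(3) Bf Bg Z by (intro mult_left_mono) auto
      also have "\<dots> = \<gamma> / 4" using Bf(1) Bg(1) Z(1) by (simp add: divide_simps add_pos_pos)
      finally have T1: "(LINT x|?M. I ?v x) - (LINT x|?M. I ?u0 x) \<le> \<gamma> / 4" .
      have T0: "2 * L * (f ap - f am) \<le> - (LINT x|?M. I ?u0 x)"
        unfolding I_def by (rule jump_integral[OF f g z(1,5) r(3) z(2,4) L(1) r(1) fa])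
      have "- (LINT x|?M. I ?v x) \<le> e + A * (LINT x|?M. \<bar>weak_div unit_disc ?v x\<bar>) + sqrt \<epsilon> * (4 * (R + 1) * Z * (P + 2 * e))"
        unfolding I_def P_def by (rule elb(2))
      then have "2 * L * (f ap - f am) \<le> e + 3 * (\<gamma> / 4)" using T0 T1 T2 T3 by linarith
      moreover have "2 * L * (f ap - f am) = \<gamma> + c" by (simp add: \<gamma>_def)
      ultimately have "\<gamma> + c \<le> e + 3 * (\<gamma> / 4)" by simp
      then show False using ec \<gamma> by linarith
    qed
  qed
qed

section \<open>Regularity of the data and conclusion\<close>

lemma locally_hoelder_continuous:
  assumes "locally_hoelder f" shows "continuous_on UNIV f"
proof (rule continuous_at_imp_continuous_on, rule ballI)
  fix x
  obtain r \<alpha> C where r: "r > 0" "0 < \<alpha>" "\<And>y z. y \<in> ball x r \<Longrightarrow> z \<in> ball x r \<Longrightarrow> \<bar>f y - f z\<bar> \<le> C * dist y z powr \<alpha>"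
    using assms unfolding locally_hoelder_def by blast
  have "((\<lambda>y. f y - f x) \<longlongrightarrow> 0) (at x)"
  proof (rule Lim_null_comparison)
    show "\<forall>\<^sub>F y in at x. norm (f y - f x) \<le> C * dist y x powr \<alpha>"
      unfolding eventually_at using r by (intro exI[of _ r]) (auto simp: dist_commute)
    have "((\<lambda>y. dist y x) \<longlongrightarrow> dist x x) (at x)" by (intro tendsto_intros)
    then have d0: "((\<lambda>y. dist y x) \<longlongrightarrow> 0) (at x)" by simp
    have "((\<lambda>y. C * dist y x powr \<alpha>) \<longlongrightarrow> C * 0) (at x)"
      using r(2) by (intro tendsto_mult tendsto_const tendsto_zero_powrI[OF d0 tendsto_const]) auto
    then show "((\<lambda>y. C * dist y x powr \<alpha>) \<longlongrightarrow> 0) (at x)" by simp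
  qed
  then show "isCont f x" by (simp add: isCont_def LIM_zero_cancel)
qed

lemma C_space_2_gradients:
  assumes "f \<in> C_space 2"
  obtains f' f'' where "C1_grad f f'" "\<And>i. C1_grad (\<lambda>x. f' x $ i) (f'' i)"
    "\<And>x i j. f'' j x $ i = pderiv_at i (pderiv_at j f) x"
proof
  have 2: "f \<in> C_space (Suc (Suc 0))" using assms by (simp add: numeral_2_eq_2)
  show "C1_grad f (\<lambda>x. \<chi> i. pderiv_at i f x)" by (rule C_space_Suc_imp_C1_grad[OF 2])
  show "C1_grad (\<lambda>x. (\<chi> i. pderiv_at i f x) $ i) (\<lambda>x. \<chi> j. pderiv_at j (pderiv_at i f) x)" for i
    unfolding vec_lambda_beta using 2 by (intro C_space_Suc_imp_C1_grad[where j=0]) auto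
  show "(\<chi> j'. pderiv_at j' (pderiv_at j f) x) $ i = pderiv_at i (pderiv_at j f) x" for x i j by simp
qed

theorem corollary5:
  fixes W w \<iota> \<kappa> lam :: "real^2 \<Rightarrow> real"
    and c1 c2 p :: real
    and am ap :: "real^2"
  assumes W_nonneg: "\<And>y. 0 \<le> W y"
    and W_hoelder: "locally_hoelder W"
    and "c1 > 0" and "c2 > 0" and "p > 0"
    and W_lower: "\<And>y. c1 * norm y powr (2 * p) - 1 \<le> W y"
    and W_upper: "\<And>y. W y \<le> c2 * (norm y powr (2 * p) + 1)"
    and a1: "am $ 1 = ap $ 1"
    and a2: "am $ 2 < ap $ 2"
    and W_square: "\<And>y. W y = (w y)\<^sup>2"
    and borel: "\<iota> \<in> borel_measurable borel" "\<kappa> \<in> borel_measurable borel"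
      "lam \<in> borel_measurable borel"
    and range: "\<And>y. \<iota> y \<in> {-1..1}" "\<And>y. \<kappa> y \<in> {-1..1}" "\<And>y. lam y \<in> {-1..1}"
    and iota_le: "\<And>y. (\<iota> y)\<^sup>2 \<le>
      Min {1 - (lam y)\<^sup>2, (1 + \<kappa> y) * (1 - lam y), (1 - \<kappa> y) * (1 + lam y)}"
    and regular: "(\<lambda>y. \<iota> y * w y) \<in> C_space 2 \<inter> C_growth 1 p"
      "(\<lambda>y. \<kappa> y * w y) \<in> C_space 2 \<inter> C_growth 1 p"
      "(\<lambda>y. lam y * w y) \<in> C_space 2 \<inter> C_growth 1 p"
    and pde: "\<And>y. pderiv_at 1 (pderiv_at 1 (\<lambda>y. \<kappa> y * w y)) y =
      pderiv_at 2 (pderiv_at 2 (\<lambda>y. lam y * w y)) y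
        + 2 * pderiv_at 1 (pderiv_at 2 (\<lambda>y. \<iota> y * w y)) y"
  shows "enn2ereal (transition_energy W am ap) \<ge>
    ereal (integral {am $ 2..ap $ 2} (\<lambda>t. \<kappa> (vector [am $ 1, t]) * w (vector [am $ 1, t])))"
proof -
  define I where "I = integral {am $ 2..ap $ 2} (\<lambda>t. \<kappa> (pair2 (am $ 1) t) * w (pair2 (am $ 1) t))"
  have "ennreal I \<le> transition_energy W am ap"
  \<comment> \<open>A non-positive \<open>I\<close> is sent to \<open>0\<close> by
    \<open>ennreal\<close>; in the other case the calibration has a positive jump, as the estimate
    of the flux requires.\<close>
  proof (cases "I > 0")
    case False
    then show ?thesis by (simp add: ennreal_neg)
  next
    case True
    obtain m' m'' where m: "C1_grad (\<lambda>y. \<iota> y * w y) m'" "\<And>i. C1_grad (\<lambda>x. m' x $ i) (m'' i)"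
      "\<And>x i j. m'' j x $ i = pderiv_at i (pderiv_at j (\<lambda>y. \<iota> y * w y)) x"
      using C_space_2_gradients regular(1) by blast
    obtain k' k'' where k: "C1_grad (\<lambda>y. \<kappa> y * w y) k'" "\<And>i. C1_grad (\<lambda>x. k' x $ i) (k'' i)"
      "\<And>x i j. k'' j x $ i = pderiv_at i (pderiv_at j (\<lambda>y. \<kappa> y * w y)) x"
      using C_space_2_gradients regular(2) by blast
    obtain l' l'' where l: "C1_grad (\<lambda>y. lam y * w y) l'" "\<And>i. C1_grad (\<lambda>x. l' x $ i) (l'' i)"
      "\<And>x i j. l'' j x $ i = pderiv_at i (pderiv_at j (\<lambda>y. lam y * w y)) x"
      using C_space_2_gradients regular(3) by blast
    have pde': "k'' 1 x $ 1 = l'' 2 x $ 2 + 2 * m'' 2 x $ 1" for x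
      unfolding k(3) l(3) m(3) by (rule pde)
    have sqrtW: "sqrt (W y) = \<bar>w y\<bar>" for y by (simp add: W_square)
    have quad0: "\<bar>(\<kappa> y * w y) * a\<^sup>2 - 2 * (\<iota> y * w y) * a * b - (lam y * w y) * b\<^sup>2\<bar> \<le> sqrt (W y) * (a\<^sup>2 + b\<^sup>2)" for y a b
    proof -
      have "\<bar>\<kappa> y * a\<^sup>2 - 2 * \<iota> y * a * b - lam y * b\<^sup>2\<bar> \<le> a\<^sup>2 + b\<^sup>2"
        by (rule quadratic_form_bound) (use range[of y] iota_le[of y] in auto)
      then have "\<bar>w y\<bar> * \<bar>\<kappa> y * a\<^sup>2 - 2 * \<iota> y * a * b - lam y * b\<^sup>2\<bar> \<le> \<bar>w y\<bar> * (a\<^sup>2 + b\<^sup>2)"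
        by (intro mult_left_mono) auto
      then show ?thesis unfolding sqrtW by (simp flip: abs_mult add: algebra_simps)
    qed
    have liminf: "ennreal c \<le> Liminf (at_right 0) (\<lambda>\<epsilon>. energy W \<epsilon> (u \<epsilon>) unit_disc)"
      if u: "u \<in> admissible am ap" and c: "0 < c" "c < 2 * I" for u c
    proof -
      \<comment> \<open>The ratio \<open>c / (2 * I)\<close> is split into two equal factors
        \<open>q\<close>. One scales the calibration and undoes its factor
        \<open>1 + \<delta>\<close>; the other is beaten by \<open>L\<close>, half the height of the
        box used for the flux.\<close>
      define q where "q = sqrt (c / (2 * I))"
      have q2: "q * q = c / (2 * I)" using c True by (simp add: q_def)
      have q: "0 < q" "q < 1" using c True by (auto simp: q_def)
      define \<delta> where "\<delta> = 1 / q - 1"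
      have \<delta>: "\<delta> > 0" "1 / (1 + \<delta>) = q" using q by (auto simp: \<delta>_def)
      define L where "L = (1 + q) / 2"
      have L: "0 < L" "L < 1" "q < L" using q by (auto simp: L_def)
      obtain f f' g g' R where f: "C1_grad f f'" and g: "C1_grad g g'" and R: "R > 0"
        and fR: "\<And>y. norm y > R \<Longrightarrow> f y = 0" and gR: "\<And>y. norm y > R \<Longrightarrow> g y = 0"
        and quad: "\<And>y a b. \<bar>f' y $ 2 * a\<^sup>2 - (f' y $ 1 - g' y $ 2) * a * b - g' y $ 1 * b\<^sup>2\<bar>
          \<le> (1 + \<delta>) * sqrt (W y) * (a\<^sup>2 + b\<^sup>2)"
        and jump: "\<And>a b. a $ 1 = b $ 1 \<Longrightarrow> a $ 2 \<le> b $ 2 \<Longrightarrow> norm a \<le> max (norm am) (norm ap) \<Longrightarrow>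
           norm b \<le> max (norm am) (norm ap) \<Longrightarrow>
           f b - f a = integral {a $ 2..b $ 2} (\<lambda>t. \<kappa> (pair2 (a $ 1) t) * w (pair2 (a $ 1) t))"
        using calibration_exists[OF k(1) l(1) m(1) k(2)[of 1] l(2)[of 2] m(2)[of 2] pde' \<open>p > 0\<close> \<open>c1 > 0\<close> \<open>c2 > 0\<close>
            W_lower W_upper quad0 \<delta>(1), of "max (norm am) (norm ap)"] by blast
      have fI: "f ap - f am = I" unfolding I_def using a1 a2 by (intro jump) auto
      let ?f = "\<lambda>x. q * f x" and ?f' = "\<lambda>x. q *\<^sub>R f' x" and ?g = "\<lambda>x. q * g x" and ?g' = "\<lambda>x. q *\<^sub>R g' x"
      have quad': "\<bar>?f' y $ 2 * a\<^sup>2 - (?f' y $ 1 - ?g' y $ 2) * a * b - ?g' y $ 1 * b\<^sup>2\<bar> \<le> sqrt (W y) * (a\<^sup>2 + b\<^sup>2)" for y a b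
      proof -
        have "?f' y $ 2 * a\<^sup>2 - (?f' y $ 1 - ?g' y $ 2) * a * b - ?g' y $ 1 * b\<^sup>2
          = q * (f' y $ 2 * a\<^sup>2 - (f' y $ 1 - g' y $ 2) * a * b - g' y $ 1 * b\<^sup>2)" by (simp add: algebra_simps)
        also have "\<bar>\<dots>\<bar> \<le> q * ((1 + \<delta>) * sqrt (W y) * (a\<^sup>2 + b\<^sup>2))"
          unfolding abs_mult using quad q by (intro mult_mono) auto
        also have "\<dots> = sqrt (W y) * (a\<^sup>2 + b\<^sup>2)" using \<delta> by (simp flip: \<delta>(2))
        finally show ?thesis .
      qed
      have F: "C1_grad ?f ?f'" and G: "C1_grad ?g ?g'" by (rule C1_grad_cmult[OF f] C1_grad_cmult[OF g])+
      have f'R: "?f' y = 0" "?g' y = 0" if "norm y > R" for y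
        using C1_grad_outside_support[OF f, of "cball 0 R" y] C1_grad_outside_support[OF g, of "cball 0 R" y] fR gR that by auto
      obtain Bf where Bf: "Bf > 0" "\<And>y. norm (?f' y) \<le> Bf"
        by (rule continuous_compact_support_bounded[OF C1_grad_continuous_grad[OF F], of "cball 0 R"]) (use f'R in auto)
      obtain Bg where Bg: "Bg > 0" "\<And>y. norm (?g' y) \<le> Bg"
        by (rule continuous_compact_support_bounded[OF C1_grad_continuous_grad[OF G], of "cball 0 R"]) (use f'R in auto)
      define S where "S = 2 * Bf + 2 * Bg"
      have S0: "S > 0" using Bf Bg by (simp add: S_def)
      have quadS: "\<bar>?f' y $ 2 * a\<^sup>2 - (?f' y $ 1 - ?g' y $ 2) * a * b - ?g' y $ 1 * b\<^sup>2\<bar> \<le> S * (a\<^sup>2 + b\<^sup>2)" for y a b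
      proof -
        have ab: "\<bar>a * b\<bar> \<le> a\<^sup>2 + b\<^sup>2"
        proof -
          have "2 * (\<bar>a\<bar> * \<bar>b\<bar>) \<le> a\<^sup>2 + b\<^sup>2"
            using zero_le_power2[of "\<bar>a\<bar> - \<bar>b\<bar>"] by (simp add: power2_diff)
          moreover have "0 \<le> \<bar>a\<bar> * \<bar>b\<bar>" by simp
          ultimately show ?thesis unfolding abs_mult by linarith
        qed
        have cf: "\<bar>?f' y $ i\<bar> \<le> Bf" "\<bar>?g' y $ i\<bar> \<le> Bg" for i
          using component_le_norm_cart[of "?f' y" i] component_le_norm_cart[of "?g' y" i] Bf(2)[of y] Bg(2)[of y] by linarith+
        have "\<bar>?f' y $ 2 * a\<^sup>2\<bar> \<le> Bf * (a\<^sup>2 + b\<^sup>2)" "\<bar>?g' y $ 1 * b\<^sup>2\<bar> \<le> Bg * (a\<^sup>2 + b\<^sup>2)"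
          unfolding abs_mult using cf Bf(1) Bg(1) by (auto intro!: mult_mono)
        moreover have "\<bar>?f' y $ 1 - ?g' y $ 2\<bar> \<le> Bf + Bg" using cf(1)[of 1] cf(2)[of 2] by linarith
        then have "\<bar>(?f' y $ 1 - ?g' y $ 2) * (a * b)\<bar> \<le> (Bf + Bg) * (a\<^sup>2 + b\<^sup>2)"
          unfolding abs_mult[of "_ - _"] using ab by (intro mult_mono) auto
        ultimately show ?thesis unfolding S_def mult.assoc[of "_ - _" a b] distrib_right by linarith
      qed
      \<comment> \<open>The form of the calibration is at most \<open>S\<close> on the unit circle,
        so truncating \<open>W\<close> at \<open>S\<^sup>2\<close> keeps the bound by
        \<open>sqrt (V y)\<close>. The truncated function is bounded, which is what the passage from
        mollified to weakly differentiable maps requires.\<close>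
      define V where "V y = min (W y) (S\<^sup>2)" for y
      have Wc: "continuous_on UNIV W" by (rule locally_hoelder_continuous[OF W_hoelder])
      have Vc: "continuous_on UNIV V" unfolding V_def by (intro continuous_intros Wc)
      have V0: "0 \<le> V y" "V y \<le> S\<^sup>2" "V y \<le> W y" for y using W_nonneg[of y] by (auto simp: V_def)
      have quadV: "\<bar>?f' y $ 2 * a\<^sup>2 - (?f' y $ 1 - ?g' y $ 2) * a * b - ?g' y $ 1 * b\<^sup>2\<bar> \<le> sqrt (V y) * (a\<^sup>2 + b\<^sup>2)" for y a b
      proof (cases "W y \<le> S\<^sup>2")
        case True
        then show ?thesis using quad'[of y a b] by (simp add: V_def)
      next
        case False
        then have "sqrt (V y) = S" using S0 by (simp add: V_def)
        then show ?thesis using quadS[of y a b] by simp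
      qed
      have "\<forall>\<^sub>F \<epsilon> in at_right 0. ennreal c \<le> energy W \<epsilon> (u \<epsilon>) unit_disc"
      proof (rule eventually_energy_ge[OF F G R _ _ Vc V0(1,2) quadV Wc V0(3) u _ L(1,2)])
        show "q * f y = 0" "q * g y = 0" if "norm y > R" for y using fR gR that by auto
        show "q * f am \<le> q * f ap" using fI True q by (intro mult_left_mono) auto
        have "c = q * q * (2 * I)" unfolding q2 using True by simp
        also have "\<dots> = 2 * q * (q * I)" by simp
        also have "\<dots> < 2 * L * (q * I)" using L q True by simp
        also have "q * I = q * f ap - q * f am" by (simp flip: fI add: right_diff_distrib)
        finally show "c < 2 * L * (q * f ap - q * f am)" .
      qed
      then show ?thesis by (rule Liminf_bounded)
    qed
    have lim2: "ennreal (2 * I) \<le> Liminf (at_right 0) (\<lambda>\<epsilon>. energy W \<epsilon> (u \<epsilon>) unit_disc)"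
      if u: "u \<in> admissible am ap" for u
    proof (rule ennreal_le_epsilon)
      fix e :: real assume e: "0 < e"
      \<comment> \<open>Taking at most \<open>I\<close> away keeps \<open>2 * I - d\<close>
        positive, as \<open>liminf\<close> demands of its constant.\<close>
      define d where "d = min e I"
      have d: "0 < d" "d \<le> e" "d < 2 * I" using e True by (auto simp: d_def)
      have "ennreal (2 * I - d) \<le> Liminf (at_right 0) (\<lambda>\<epsilon>. energy W \<epsilon> (u \<epsilon>) unit_disc)"
        by (rule liminf[OF u]) (use d in auto)
      then have "ennreal (2 * I - d) + ennreal d \<le> Liminf (at_right 0) (\<lambda>\<epsilon>. energy W \<epsilon> (u \<epsilon>) unit_disc) + ennreal e"
        using d by (intro add_mono) (auto intro: ennreal_leI)
      then show "ennreal (2 * I) \<le> Liminf (at_right 0) (\<lambda>\<epsilon>. energy W \<epsilon> (u \<epsilon>) unit_disc) + ennreal e"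
        using d by (simp flip: ennreal_plus)
    qed
    have "ennreal I = ennreal (2 * I) / 2" using True divide_ennreal[of "2 * I" 2] by simp
    also have "\<dots> \<le> transition_energy W am ap"
      unfolding transition_energy_def by (intro divide_right_mono_ennreal INF_greatest lim2)
    finally show ?thesis .
  qed
  then have "enn2ereal (ennreal I) \<le> enn2ereal (transition_energy W am ap)" by (simp add: less_eq_ennreal.rep_eq)
  \<comment> \<open>Only an inequality holds here, since for negative \<open>I\<close> the right
    side is \<open>0\<close>.\<close>
  moreover have "ereal I \<le> enn2ereal (ennreal I)" by (cases "I \<ge> 0") (auto simp: enn2ereal_ennreal ennreal_neg zero_ennreal.rep_eq)
  ultimately show ?thesis unfolding I_def by (rule order_trans[rotated])
qed

end
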